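(* Let $R\to S$ be a homomorphism of Noetherian rings that splits. Let $\mathcal{T}$ be a Lyubeznik functor induced by ideals of $R$ (equivalently, on $S$-modules, by the extensions of these ideals to $S$), and suppose that $\operatorname{Ass}_S \mathcal{T}(S)$ is finite. Then $\operatorname{Ass}_R \mathcal{T}(R)$ is finite. In particular, for every ideal $I\subset R$ and every $i\ge 0$, if $\operatorname{Ass}_S H^i_{IS}(S)$ is finite, then $\operatorname{Ass}_R H^i_I(R)$ is finite.
   Context: All rings are commutative Noetherian with unity. A ring homomorphism $R\to S$ splits if there is an $R$-linear map $S\to R$ whose composition with $R\to S$ is the identity of $R$. $H^i_I(M)$ denotes the $i$-th local cohomology module of $M$ with support in the ideal $I$. Lyubeznik functors. For a closed subset $Z=\mathcal{V}(I)=\{P\in\operatorname{Spec}(R): I\subset P\}$ of $\operatorname{Spec}(R)$, put $H^i_Z(-)=H^i_I(-)$. For closed subsets $Z_1\subset Z_2$ of $\operatorname{Spec}(R)$ there is a long exact sequence of functors $$\cdots\to H^i_{Z_1}\to H^i_{Z_2}\to H^i_{Z_1/Z_2}\to H^{i+1}_{Z_1}\to\cdots,$$ where $H^i_{Z_1/Z_2}(M)$ is the $i$-th cohomology of the complex $\Gamma_{Z_2}(E^\bullet)/\Gamma_{Z_1}(E^\bullet)$, with $E^\bullet$ an injective resolution of $M$ and $\Gamma_Z$ the functor of sections with support in $Z$. A Lyubeznik functor is a functor of the form $\mathcal{T}=\mathcal{T}_1\circ\cdots\circ\mathcal{T}_t$, where each $\mathcal{T}_j$ is either $H^i_Z$ for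 some $i$ and some closed subset $Z$ of $\operatorname{Spec}(R)$, or the kernel, image or cokernel of some morphism in the long exact sequence $\cdots\to H^i_{Z_1}\to H^i_{Z_2}\to H^i_{Z_1/Z_2}\to H^{i+1}_{Z_1}\to\cdots$ for some closed subsets $Z_1\subset Z_2$ of $\operatorname{Spec}(R)$. Given $R\to S$, for an ideal $I\subset R$ the functors $H^i_I(-)$ and $H^i_{IS}(-)$ are naturally isomorphic on $S$-modules, compatibly with the natural maps between them for different ideals. Hence every Lyubeznik functor $\mathcal{T}$ for $R$, restricted to $S$-modules, is the Lyubeznik functor for $S$ of the same type, obtained by replacing each ideal of $R$ defining the closed sets by its extension to $S$. For an $S$-module $M$, $\mathcal{T}(M)$ is regarded as an $S$-module in this way, with no distinction in notation. *)

theory Defs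
  imports "HOL-Algebra.Module" "HOL-Algebra.Ring_Divisibility" "HOL-Algebra.Ideal_Product"
begin

section \<open>Modules\<close>

definition ring_module :: "('a, 'x) ring_scheme \<Rightarrow> ('a, 'a) module" where
  "ring_module R =
     \<lparr>carrier = carrier R, mult = mult R, one = one R, zero = zero R, add = add R,
      smult = mult R\<rparr>"

definition restrict_scalars :: "('a \<Rightarrow> 'b) \<Rightarrow> ('b, 'm) module \<Rightarrow> ('a, 'm) module" where
  "restrict_scalars f M =
     \<lparr>carrier = carrier M, mult = mult M, one = one M, zero = zero M, add = add M,
      smult = (\<lambda>a x. f a \<odot>\<^bsub>M\<^esub> x)\<rparr>"

definition module_hom ::
    "('a, 'x) ring_scheme \<Rightarrow> ('a, 'm) module \<Rightarrow> ('a, 'n) module \<Rightarrow> ('m \<Rightarrow> 'n) set" where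
  "module_hom R M N =
     {h \<in> hom (add_monoid M) (add_monoid N).
        \<forall>a\<in>carrier R. \<forall>x\<in>carrier M. h (a \<odot>\<^bsub>M\<^esub> x) = a \<odot>\<^bsub>N\<^esub> h x}"

definition module_iso ::
    "('a, 'x) ring_scheme \<Rightarrow> ('a, 'm) module \<Rightarrow> ('a, 'n) module \<Rightarrow> bool" where
  "module_iso R M N \<longleftrightarrow>
     module R M \<and> module R N \<and> (\<exists>h\<in>module_hom R M N. bij_betw h (carrier M) (carrier N))"

text \<open>Elements of the quotient are additive cosets, as for \<^const>\<open>FactRing\<close>. The multiplicative
  fields of a module record play no role.\<close>

definition quotient_module :: "('a, 'm) module \<Rightarrow> 'm set \<Rightarrow> ('a, 'm set) module" where
  "quotient_module M H =
     \<lparr>carrier = a_rcosets\<^bsub>M\<^esub> H, mult = undefined, one = undefined, zero = H, add = set_add M,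
      smult = (\<lambda>a X. H <+>\<^bsub>M\<^esub> ((\<lambda>x. a \<odot>\<^bsub>M\<^esub> x) ` X))\<rparr>"

definition kernel_module ::
    "('a, 'm) module \<Rightarrow> ('a, 'n) module \<Rightarrow> ('m \<Rightarrow> 'n) \<Rightarrow> ('a, 'm) module" where
  "kernel_module M N h = M\<lparr>carrier := a_kernel M N h\<rparr>"

definition image_module ::
    "('a, 'm) module \<Rightarrow> ('a, 'n) module \<Rightarrow> ('m \<Rightarrow> 'n) \<Rightarrow> ('a, 'n) module" where
  "image_module M N h = N\<lparr>carrier := h ` carrier M\<rparr>"

definition cokernel_module ::
    "('a, 'm) module \<Rightarrow> ('a, 'n) module \<Rightarrow> ('m \<Rightarrow> 'n) \<Rightarrow> ('a, 'n set) module" where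
  "cokernel_module M N h = quotient_module N (h ` carrier M)"

definition associated_primes :: "('a, 'x) ring_scheme \<Rightarrow> ('a, 'm) module \<Rightarrow> 'a set set" where
  "associated_primes R M =
     {P. primeideal P R \<and> (\<exists>m\<in>carrier M. P = {a \<in> carrier R. a \<odot>\<^bsub>M\<^esub> m = \<zero>\<^bsub>M\<^esub>})}"

text \<open>The modules against which injectivity is tested have underlying sets in the type of the
  ring elements. This is no restriction: \<open>R\<close> and its ideals are among them, so by Baer's criterion
  the extension property then holds for modules over every type.\<close>

definition injective_module :: "('a, 'x) ring_scheme \<Rightarrow> ('a, 'e) module \<Rightarrow> bool" where
  "injective_module R E \<longleftrightarrow>
     module R E \<and>
     (\<forall>(A :: ('a, 'a) module) (B :: ('a, 'a) module) i g.
        module R A \<and> module R B \<and> i \<in> module_hom R A B \<and> inj_on i (carrier A) \<and>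
        g \<in> module_hom R A E \<longrightarrow>
        (\<exists>h\<in>module_hom R B E. \<forall>x\<in>carrier A. h (i x) = g x))"


section \<open>Cochain complexes in nonnegative degrees\<close>

record ('a, 'e) cochain =
  obj :: "nat \<Rightarrow> ('a, 'e) module"
  dmap :: "nat \<Rightarrow> 'e \<Rightarrow> 'e"

definition cocycles :: "('a, 'e) cochain \<Rightarrow> nat \<Rightarrow> 'e set" where
  "cocycles C i = a_kernel (obj C i) (obj C (Suc i)) (dmap C i)"

definition coboundaries :: "('a, 'e) cochain \<Rightarrow> nat \<Rightarrow> 'e set" where
  "coboundaries C i =
     (case i of 0 \<Rightarrow> {\<zero>\<^bsub>obj C 0\<^esub>} | Suc j \<Rightarrow> dmap C j ` carrier (obj C j))"

definition cohomology :: "('a, 'e) cochain \<Rightarrow> nat \<Rightarrow> ('a, 'e set) module" where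
  "cohomology C i = quotient_module ((obj C i)\<lparr>carrier := cocycles C i\<rparr>) (coboundaries C i)"

text \<open>The map induced on \<open>i\<close>-th cohomology by the degree \<open>i\<close> component \<open>h\<close> of a morphism of
  complexes with target \<open>D\<close>; it sends the class of \<open>x\<close> to the class of \<open>h x\<close>.\<close>

definition cohomology_map ::
    "('a, 'f) cochain \<Rightarrow> nat \<Rightarrow> ('e \<Rightarrow> 'f) \<Rightarrow> 'e set \<Rightarrow> 'f set" where
  "cohomology_map D i h X = coboundaries D i <+>\<^bsub>obj D i\<^esub> (h ` X)"

definition injective_resolution ::
    "('a, 'x) ring_scheme \<Rightarrow> ('a, 'm) module \<Rightarrow> ('a, 'e) cochain \<Rightarrow> ('m \<Rightarrow> 'e) \<Rightarrow> bool" where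
  "injective_resolution R M E \<epsilon> \<longleftrightarrow>
     module R M \<and>
     (\<forall>i. injective_module R (obj E i)) \<and>
     (\<forall>i. dmap E i \<in> module_hom R (obj E i) (obj E (Suc i))) \<and>
     \<epsilon> \<in> module_hom R M (obj E 0) \<and> inj_on \<epsilon> (carrier M) \<and>
     \<epsilon> ` carrier M = cocycles E 0 \<and>
     (\<forall>i. coboundaries E (Suc i) = cocycles E (Suc i))"


section \<open>Local cohomology\<close>

definition closed_set :: "('a, 'x) ring_scheme \<Rightarrow> 'a set \<Rightarrow> 'a set set" where
  "closed_set R I = {P. primeideal P R \<and> I \<subseteq> P}"

text \<open>The submodule of elements killed by a power of \<open>I\<close>. For Noetherian \<open>R\<close> these are the
  elements with support in \<open>closed_set R I\<close>.\<close>

definition sections_supp :: "('a, 'x) ring_scheme \<Rightarrow> 'a set \<Rightarrow> ('a, 'm) module \<Rightarrow> 'm set" where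
  "sections_supp R I M =
     {m \<in> carrier M. \<exists>n::nat. \<forall>a \<in> I [^]\<^bsub>ideals_set R\<^esub> n. a \<odot>\<^bsub>M\<^esub> m = \<zero>\<^bsub>M\<^esub>}"

definition sections_complex ::
    "('a, 'x) ring_scheme \<Rightarrow> 'a set \<Rightarrow> ('a, 'e) cochain \<Rightarrow> ('a, 'e) cochain" where
  "sections_complex R I E =
     \<lparr>obj = (\<lambda>i. (obj E i)\<lparr>carrier := sections_supp R I (obj E i)\<rparr>), dmap = dmap E\<rparr>"

text \<open>The complex \<open>\<Gamma>\<^bsub>Z2\<^esub>(E) / \<Gamma>\<^bsub>Z1\<^esub>(E)\<close> for \<open>Z1 = closed_set R I1 \<subseteq> Z2 = closed_set R I2\<close>.\<close>

definition relative_complex ::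
    "('a, 'x) ring_scheme \<Rightarrow> 'a set \<Rightarrow> 'a set \<Rightarrow> ('a, 'e) cochain \<Rightarrow> ('a, 'e set) cochain" where
  "relative_complex R I1 I2 E =
     \<lparr>obj = (\<lambda>i. quotient_module (obj (sections_complex R I2 E) i) (sections_supp R I1 (obj E i))),
      dmap = (\<lambda>i X. sections_supp R I1 (obj E (Suc i)) <+>\<^bsub>obj E (Suc i)\<^esub> (dmap E i ` X))\<rparr>"

text \<open>The three kinds of morphisms in the long exact sequence of
  \<open>0 \<rightarrow> \<Gamma>\<^bsub>Z1\<^esub>(E) \<rightarrow> \<Gamma>\<^bsub>Z2\<^esub>(E) \<rightarrow> \<Gamma>\<^bsub>Z2\<^esub>(E) / \<Gamma>\<^bsub>Z1\<^esub>(E) \<rightarrow> 0\<close>.\<close>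

definition les_inclusion ::
    "('a, 'x) ring_scheme \<Rightarrow> 'a set \<Rightarrow> 'a set \<Rightarrow> ('a, 'e) cochain \<Rightarrow> nat \<Rightarrow> 'e set \<Rightarrow> 'e set" where
  "les_inclusion R I1 I2 E i = cohomology_map (sections_complex R I2 E) i (\<lambda>x. x)"

definition les_projection ::
    "('a, 'x) ring_scheme \<Rightarrow> 'a set \<Rightarrow> 'a set \<Rightarrow> ('a, 'e) cochain \<Rightarrow> nat \<Rightarrow> 'e set \<Rightarrow> 'e set set" where
  "les_projection R I1 I2 E i =
     cohomology_map (relative_complex R I1 I2 E) i
       (\<lambda>x. sections_supp R I1 (obj E i) +>\<^bsub>obj E i\<^esub> x)"

text \<open>The class of the coset of \<open>b\<close> is sent to the class of \<open>d b\<close>. The elements \<open>d b\<close>, for \<open>b\<close>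
  running over all lifts of all representatives of the given class \<open>X\<close>, make up the whole coset.\<close>

definition les_connecting ::
    "('a, 'x) ring_scheme \<Rightarrow> 'a set \<Rightarrow> 'a set \<Rightarrow> ('a, 'e) cochain \<Rightarrow> nat \<Rightarrow> 'e set set \<Rightarrow> 'e set" where
  "les_connecting R I1 I2 E i X =
     {a \<in> sections_supp R I1 (obj E (Suc i)).
        \<exists>b \<in> sections_supp R I2 (obj E i).
          sections_supp R I1 (obj E i) +>\<^bsub>obj E i\<^esub> b \<in> X \<and> a = dmap E i b}"

text \<open>Local cohomology is determined up to isomorphism: \<open>is_local_cohomology R I i M N\<close> says that
  \<open>N\<close> is (a copy of) \<open>H\<^sup>i\<^sub>I(M)\<close>. The type \<open>'u\<close> serves as a universe housing the resolution as well
  as \<open>N\<close>; statements about it are meant polymorphically in \<open>'u\<close>. Over a Noetherian ring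
  \<open>R\<close>, a module \<open>M\<close> embeds into an injective module of cardinality at most
  \<open>max \<bar>R\<bar> \<bar>M\<bar> \<aleph>\<^sub>0\<close>, so every infinite \<open>'u\<close> at least as large as \<open>R\<close> and \<open>M\<close> is big enough.\<close>

definition is_local_cohomology ::
    "('a, 'x) ring_scheme \<Rightarrow> 'a set \<Rightarrow> nat \<Rightarrow> ('a, 'm) module \<Rightarrow> ('a, 'u) module \<Rightarrow> bool" where
  "is_local_cohomology R I i M N \<longleftrightarrow>
     (\<exists>(E :: ('a, 'u) cochain) \<epsilon>.
        injective_resolution R M E \<epsilon> \<and> module_iso R (cohomology (sections_complex R I E) i) N)"


section \<open>Lyubeznik functors\<close>

datatype hom_part = Kernel | Image | Cokernel

datatype les_map = Inclusion | Projection | Connecting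

text \<open>Closed sets are given by defining ideals, so the parameter \<open>'i\<close> is instantiated to the type
  of ideals of the ring. \<open>LES_Part p m I1 I2 i\<close> stands for the kernel, image or cokernel of the
  morphism of the long exact sequence of \<open>I1\<close>, \<open>I2\<close> which is of kind \<open>m\<close> and starts in
  degree \<open>i\<close>.\<close>

datatype 'i lyubeznik_factor =
    Local_Cohomology 'i nat
  | LES_Part hom_part les_map 'i 'i nat

primrec valid_factor :: "('a, 'x) ring_scheme \<Rightarrow> 'a set lyubeznik_factor \<Rightarrow> bool" where
  "valid_factor R (Local_Cohomology I i) \<longleftrightarrow> ideal I R"
| "valid_factor R (LES_Part p m I1 I2 i) \<longleftrightarrow>
     ideal I1 R \<and> ideal I2 R \<and> closed_set R I1 \<subseteq> closed_set R I2"

definition is_hom_part ::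
    "('a, 'x) ring_scheme \<Rightarrow> hom_part \<Rightarrow> ('a, 'm) module \<Rightarrow> ('a, 'n) module \<Rightarrow> ('m \<Rightarrow> 'n) \<Rightarrow>
     ('a, 'u) module \<Rightarrow> bool" where
  "is_hom_part R p A B h N \<longleftrightarrow>
     (case p of
        Kernel \<Rightarrow> module_iso R (kernel_module A B h) N
      | Image \<Rightarrow> module_iso R (image_module A B h) N
      | Cokernel \<Rightarrow> module_iso R (cokernel_module A B h) N)"

definition is_les_part ::
    "('a, 'x) ring_scheme \<Rightarrow> hom_part \<Rightarrow> les_map \<Rightarrow> 'a set \<Rightarrow> 'a set \<Rightarrow> nat \<Rightarrow> ('a, 'e) cochain \<Rightarrow>
     ('a, 'u) module \<Rightarrow> bool" where
  "is_les_part R p m I1 I2 i E N \<longleftrightarrow>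
     (case m of
        Inclusion \<Rightarrow>
          is_hom_part R p (cohomology (sections_complex R I1 E) i)
            (cohomology (sections_complex R I2 E) i) (les_inclusion R I1 I2 E i) N
      | Projection \<Rightarrow>
          is_hom_part R p (cohomology (sections_complex R I2 E) i)
            (cohomology (relative_complex R I1 I2 E) i) (les_projection R I1 I2 E i) N
      | Connecting \<Rightarrow>
          is_hom_part R p (cohomology (relative_complex R I1 I2 E) i)
            (cohomology (sections_complex R I1 E) (Suc i)) (les_connecting R I1 I2 E i) N)"

primrec is_factor_value ::
    "('a, 'x) ring_scheme \<Rightarrow> 'a set lyubeznik_factor \<Rightarrow> ('a, 'm) module \<Rightarrow> ('a, 'u) module \<Rightarrow>
     bool" where
  "is_factor_value R (Local_Cohomology I i) M N \<longleftrightarrow> is_local_cohomology R I i M N"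
| "is_factor_value R (LES_Part p m I1 I2 i) M N \<longleftrightarrow>
     (\<exists>(E :: ('a, 'u) cochain) \<epsilon>.
        injective_resolution R M E \<epsilon> \<and> is_les_part R p m I1 I2 i E N)"

text \<open>The list \<open>[T\<^sub>1, \<dots>, T\<^sub>t]\<close> represents the composite \<open>T\<^sub>1 \<circ> \<dots> \<circ> T\<^sub>t\<close>, and
  \<open>is_lyubeznik_value R T M N\<close> says that \<open>N\<close> is (a copy of) \<open>T(M)\<close>; see
  \<^const>\<open>is_local_cohomology\<close> for the role of the type \<open>'u\<close>.\<close>

definition lyubeznik_functor :: "('a, 'x) ring_scheme \<Rightarrow> 'a set lyubeznik_factor list \<Rightarrow> bool" where
  "lyubeznik_functor R T \<longleftrightarrow> T \<noteq> [] \<and> (\<forall>F\<in>set T. valid_factor R F)"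

primrec is_lyubeznik_value ::
    "('a, 'x) ring_scheme \<Rightarrow> 'a set lyubeznik_factor list \<Rightarrow> ('a, 'm) module \<Rightarrow>
     ('a, 'u) module \<Rightarrow> bool" where
  "is_lyubeznik_value R [] M N \<longleftrightarrow> module_iso R M N"
| "is_lyubeznik_value R (F # T) M N \<longleftrightarrow>
     (\<exists>K :: ('a, 'u) module. is_lyubeznik_value R T M K \<and> is_factor_value R F K N)"


section \<open>Change of rings\<close>

definition extended_ideal :: "('b, 'y) ring_scheme \<Rightarrow> ('a \<Rightarrow> 'b) \<Rightarrow> 'a set \<Rightarrow> 'b set" where
  "extended_ideal S f I = genideal S (f ` I)"

definition extended_functor ::
    "('b, 'y) ring_scheme \<Rightarrow> ('a \<Rightarrow> 'b) \<Rightarrow> 'a set lyubeznik_factor list \<Rightarrow>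
     'b set lyubeznik_factor list" where
  "extended_functor S f T = map (map_lyubeznik_factor (extended_ideal S f)) T"

definition splits ::
    "('a, 'x) ring_scheme \<Rightarrow> ('b, 'y) ring_scheme \<Rightarrow> ('a \<Rightarrow> 'b) \<Rightarrow> bool" where
  "splits R S f \<longleftrightarrow>
     (\<exists>p \<in> module_hom R (restrict_scalars f (ring_module S)) (ring_module R).
        \<forall>r\<in>carrier R. p (f r) = r)"

end

theory Submission
  imports Defs "HOL-Algebra.IntRing"
begin

text \<open>The map \<open>R \<rightarrow> S\<close> is a split injection of \<open>R\<close>-modules, so \<open>T(R)\<close> is a direct summand of \<open>T\<close> applied
  to the \<open>R\<close>-module \<open>S\<close>, which is \<open>T(S)\<close> computed over \<open>S\<close>. Hence every associated prime of \<open>T(R)\<close>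
  is the annihilator of an element of \<open>T(S)\<close>, and such primes are contracted from associated primes
  of \<open>T(S)\<close> over \<open>S\<close>.

  For the independence of the base ring, call a module \<open>M\<close> flasque if every \<open>x\<close> acts surjectively
  modulo \<open>x\<close>-torsion on each torsion submodule \<open>\<Gamma>\<^sub>Y(M)\<close>. Injective modules over Noetherian rings are
  flasque, and flasqueness survives restriction of scalars. An exact complex of flasque modules
  that is bounded below remains exact under \<open>\<Gamma>\<^sub>Y\<close>; applied to mapping cones this shows that
  flasque resolutions compute local cohomology together with its long exact sequences.\<close>

section \<open>Homomorphisms and subquotients\<close>

text \<open>The obstacle is that an injective \<open>S\<close>-module need not be injective over
  \<open>R\<close>, as \<open>S\<close> is not assumed flat; an injective resolution over
  \<open>S\<close> is therefore not one over \<open>R\<close>, and chain maps into it may fail to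
  exist. Flasqueness says that a fraction \<open>m/x\<close> of \<Gamma>_Y(M) already comes from
  \<Gamma>_Y(M): \<open>m/x = m'/1\<close> in the localization means
  \<open>x^(k+1) m' = x^k m\<close> for some \<open>k\<close>. It speaks of elements of the ring
  only, so it passes from \<open>S\<close> to \<open>R\<close>, and it allows torsion elements to be
  lifted along a surjection, one generator of the ideal at a time.

  Values of functors are given by a relation, up to isomorphism. The induction over the factors of
  \<open>T\<close> therefore carries the statement that one value is a retract, over
  \<open>R\<close>, of the restriction of the other, and each factor is shown to preserve it. On
  cohomology the two halves of a splitting compose to a bijection, obtained from the same cone
  argument as the comparison of resolutions; its inverse corrects them to a retraction.\<close>

lemma (in abelian_group) minus_arith:
  assumes "x \<in> carrier G" "y \<in> carrier G"
  shows "x \<ominus> \<zero> = x" "x \<ominus> x = \<zero>" "(x \<ominus> y) \<oplus> y = x" "y \<oplus> (x \<ominus> y) = x" "(x \<oplus> y) \<ominus> y = x"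
    "x \<ominus> y = \<zero> \<longleftrightarrow> x = y" "x \<ominus> (x \<ominus> y) = y" "\<ominus> (x \<ominus> y) = y \<ominus> x"
proof -
  have z: "\<ominus> \<zero> = \<zero>" by (rule minus_equality) auto
  show 1: "x \<ominus> \<zero> = x" "x \<ominus> x = \<zero>" "(x \<ominus> y) \<oplus> y = x" "y \<oplus> (x \<ominus> y) = x" "(x \<oplus> y) \<ominus> y = x"
    using assms z by (simp_all add: minus_eq a_assoc r_neg l_neg r_neg1 r_neg2 a_lcomm)
  show "x \<ominus> y = \<zero> \<longleftrightarrow> x = y" using 1(2,3) assms by (metis l_zero)
  show "\<ominus> (x \<ominus> y) = y \<ominus> x"
    using assms by (simp add: minus_eq minus_add a_comm)
  then show "x \<ominus> (x \<ominus> y) = y"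
    using assms by (metis a_inv_closed a_lcomm minus_eq r_neg r_zero)
qed

lemma (in module) smult_minus:
  assumes "a \<in> carrier R" "x \<in> carrier M" "y \<in> carrier M"
  shows "a \<odot>\<^bsub>M\<^esub> (x \<ominus>\<^bsub>M\<^esub> y) = a \<odot>\<^bsub>M\<^esub> x \<ominus>\<^bsub>M\<^esub> a \<odot>\<^bsub>M\<^esub> y"
  using assms by (simp add: M.minus_eq smult_r_distr smult_r_minus)

lemma module_homI:
  assumes "\<And>x. x \<in> carrier M \<Longrightarrow> h x \<in> carrier N"
    and "\<And>x y. x \<in> carrier M \<Longrightarrow> y \<in> carrier M \<Longrightarrow> h (x \<oplus>\<^bsub>M\<^esub> y) = h x \<oplus>\<^bsub>N\<^esub> h y"
    and "\<And>a x. a \<in> carrier R \<Longrightarrow> x \<in> carrier M \<Longrightarrow> h (a \<odot>\<^bsub>M\<^esub> x) = a \<odot>\<^bsub>N\<^esub> h x"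
  shows "h \<in> module_hom R M N"
  using assms by (auto simp: module_hom_def hom_def)

lemma module_homD:
  assumes "h \<in> module_hom R M N"
  shows "\<And>x. x \<in> carrier M \<Longrightarrow> h x \<in> carrier N"
    and "\<And>x y. x \<in> carrier M \<Longrightarrow> y \<in> carrier M \<Longrightarrow> h (x \<oplus>\<^bsub>M\<^esub> y) = h x \<oplus>\<^bsub>N\<^esub> h y"
    and "\<And>a x. a \<in> carrier R \<Longrightarrow> x \<in> carrier M \<Longrightarrow> h (a \<odot>\<^bsub>M\<^esub> x) = a \<odot>\<^bsub>N\<^esub> h x"
  using assms by (auto simp: module_hom_def hom_def)

lemma module_hom_zero:
  assumes "module R M" "module R N" "h \<in> module_hom R M N"
  shows "h \<zero>\<^bsub>M\<^esub> = \<zero>\<^bsub>N\<^esub>"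
proof -
  interpret M: module R M by fact
  interpret N: module R N by fact
  have "h (\<zero>\<^bsub>R\<^esub> \<odot>\<^bsub>M\<^esub> \<zero>\<^bsub>M\<^esub>) = \<zero>\<^bsub>R\<^esub> \<odot>\<^bsub>N\<^esub> h \<zero>\<^bsub>M\<^esub>"
    by (intro module_homD[OF assms(3)]) auto
  then show ?thesis using module_homD(1)[OF assms(3)] by simp
qed

lemma module_hom_minus:
  assumes "module R M" "module R N" "h \<in> module_hom R M N" "x \<in> carrier M" "y \<in> carrier M"
  shows "h (x \<ominus>\<^bsub>M\<^esub> y) = h x \<ominus>\<^bsub>N\<^esub> h y"
proof -
  interpret M: module R M by fact
  interpret N: module R N by fact
  note h = module_homD[OF assms(3)]
  have "h (\<ominus>\<^bsub>M\<^esub> y) = h ((\<ominus>\<^bsub>R\<^esub> \<one>\<^bsub>R\<^esub>) \<odot>\<^bsub>M\<^esub> y)"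
    using assms by (simp add: M.smult_l_minus)
  also have "\<dots> = \<ominus>\<^bsub>N\<^esub> h y"
    using assms by (simp add: h N.smult_l_minus)
  finally show ?thesis using assms h by (simp add: a_minus_def)
qed

lemma module_hom_comp:
  assumes "h \<in> module_hom R M N" "g \<in> module_hom R N P"
  shows "(\<lambda>x. g (h x)) \<in> module_hom R M P"
  by (rule module_homI) (auto simp: module_homD[OF assms(1)] module_homD[OF assms(2)])

lemma module_hom_cong:
  assumes "h \<in> module_hom R M N" "\<And>x. x \<in> carrier M \<Longrightarrow> g x = h x" "module R M"
  shows "g \<in> module_hom R M N"
proof -
  interpret M: module R M by fact
  show ?thesis by (rule module_homI) (auto simp: module_homD[OF assms(1)] assms(2))
qed

lemma module_hom_id: "(\<lambda>x. x) \<in> module_hom R M M"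
  by (rule module_homI) auto

lemma module_hom_inv:
  assumes "module R M" "module R N" "h \<in> module_hom R M N" "bij_betw h (carrier M) (carrier N)"
  shows "inv_into (carrier M) h \<in> module_hom R N M"
proof -
  interpret M: module R M by fact
  interpret N: module R N by fact
  let ?k = "inv_into (carrier M) h"
  note h = module_homD[OF assms(3)]
  have k: "?k y \<in> carrier M" "h (?k y) = y" if "y \<in> carrier N" for y
    using assms(4) that by (auto simp: bij_betw_def inv_into_into f_inv_into_f)
  have kI: "?k y = x" if "x \<in> carrier M" "h x = y" for x y
    using assms(4) that by (auto simp: bij_betw_def inv_into_f_f)
  show ?thesis
    by (rule module_homI) (auto intro!: kI simp: k h)
qed

lemma submodule_minus:
  assumes "module R M" "submodule H R M" "x \<in> H" "y \<in> H"
  shows "x \<ominus>\<^bsub>M\<^esub> y \<in> H"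
  using module.submoduleE[OF assms(1,2)] assms(3,4) by (simp add: a_minus_def)

lemma submodule_zero: "submodule H R M \<Longrightarrow> \<zero>\<^bsub>M\<^esub> \<in> H"
  using subgroup.one_closed[OF submodule.axioms(1)] by fastforce

lemma submodule_self: "module R M \<Longrightarrow> submodule (carrier M) R M"
  by (rule module.carrier_is_submodule)

lemma submoduleI':
  assumes "module R M" "H \<subseteq> carrier M" "\<zero>\<^bsub>M\<^esub> \<in> H"
    and "\<And>a b. a \<in> H \<Longrightarrow> b \<in> H \<Longrightarrow> a \<oplus>\<^bsub>M\<^esub> b \<in> H"
    and "\<And>a x. a \<in> carrier R \<Longrightarrow> x \<in> H \<Longrightarrow> a \<odot>\<^bsub>M\<^esub> x \<in> H"
  shows "submodule H R M"
proof -
  interpret M: module R M by fact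
  show ?thesis
  proof (rule M.submoduleI)
    fix a assume a: "a \<in> H"
    then have "\<ominus>\<^bsub>M\<^esub> a = (\<ominus>\<^bsub>R\<^esub> \<one>\<^bsub>R\<^esub>) \<odot>\<^bsub>M\<^esub> a"
      using assms(2) by (auto simp: M.smult_l_minus subset_iff)
    then show "\<ominus>\<^bsub>M\<^esub> a \<in> H" using assms(5)[of "\<ominus>\<^bsub>R\<^esub> \<one>\<^bsub>R\<^esub>" a] a by simp
  qed (use assms in auto)
qed

lemma submodule_kernel:
  assumes "module R M" "module R N" "h \<in> module_hom R M N"
  shows "submodule {x \<in> carrier M. h x = \<zero>\<^bsub>N\<^esub>} R M"
proof -
  interpret M: module R M by fact
  interpret N: module R N by fact
  show ?thesis
    by (rule submoduleI'[OF assms(1)])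
      (auto simp: module_homD[OF assms(3)] module_hom_zero[OF assms])
qed

lemma submodule_image:
  assumes "module R M" "module R N" "h \<in> module_hom R M N" "submodule H R M"
  shows "submodule (h ` H) R N"
proof -
  interpret M: module R M by fact
  interpret N: module R N by fact
  note H = M.submoduleE[OF assms(4)] submodule_zero[OF assms(4)]
  note h = module_homD[OF assms(3)]
  show ?thesis
  proof (rule submoduleI'[OF assms(2)])
    show "h ` H \<subseteq> carrier N" using h H by auto
    show "\<zero>\<^bsub>N\<^esub> \<in> h ` H" using H(7) module_hom_zero[OF assms(1,2,3)] by (metis image_eqI)
    fix a b assume "a \<in> h ` H" "b \<in> h ` H"
    then obtain x y where "x \<in> H" "y \<in> H" "a = h x" "b = h y" by auto
    moreover have "x \<in> carrier M" "y \<in> carrier M" using calculation H(1) by auto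
    ultimately show "a \<oplus>\<^bsub>N\<^esub> b \<in> h ` H"
      using h(2) H(5) by (intro image_eqI[of _ _ "x \<oplus>\<^bsub>M\<^esub> y"]) auto
  next
    fix a x assume "a \<in> carrier R" "x \<in> h ` H"
    then obtain y where y: "y \<in> H" "x = h y" "a \<in> carrier R" by auto
    moreover have "y \<in> carrier M" using calculation H(1) by auto
    ultimately show "a \<odot>\<^bsub>N\<^esub> x \<in> h ` H"
      using h(3) H(4) by (intro image_eqI[of _ _ "a \<odot>\<^bsub>M\<^esub> y"]) auto
  qed
qed

section \<open>Cosets, quotient modules and subquotients\<close>

lemma a_r_coset_carrier_update [simp]:
  fixes M :: "('a, 'm) module"
  shows "H +>\<^bsub>M\<lparr>carrier := Z\<rparr>\<^esub> x = H +>\<^bsub>M\<^esub> x"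
  by (simp add: a_r_coset_def')

lemma set_add_carrier_update [simp]:
  fixes M :: "('a, 'm) module"
  shows "H <+>\<^bsub>M\<lparr>carrier := Z\<rparr>\<^esub> K = H <+>\<^bsub>M\<^esub> K"
  by (simp add: set_add_def')

lemma a_r_coset_eq_iff:
  assumes "module R M" "submodule H R M" "x \<in> carrier M" "y \<in> carrier M"
  shows "H +>\<^bsub>M\<^esub> x = H +>\<^bsub>M\<^esub> y \<longleftrightarrow> x \<ominus>\<^bsub>M\<^esub> y \<in> H"
proof -
  interpret M: module R M by fact
  interpret H: abelian_subgroup H M
    by (rule abelian_subgroupI3)
      (auto intro: additive_subgroup.intro submodule.axioms(1)[OF assms(2)] M.abelian_group_axioms)
  have eq: "x = (x \<ominus>\<^bsub>M\<^esub> y) \<oplus>\<^bsub>M\<^esub> y"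
    using assms(3,4) by (simp add: M.minus_eq M.add.m_assoc M.l_neg)
  show ?thesis
  proof
    assume "H +>\<^bsub>M\<^esub> x = H +>\<^bsub>M\<^esub> y"
    then have "x \<in> H +>\<^bsub>M\<^esub> y" using H.a_rcos_self[OF assms(3)] by simp
    then obtain h where "h \<in> H" "x = h \<oplus>\<^bsub>M\<^esub> y" by (auto simp: a_r_coset_def')
    then show "x \<ominus>\<^bsub>M\<^esub> y \<in> H"
      using assms(3,4) H.a_subset by (auto simp: M.minus_eq M.add.m_assoc M.r_neg subset_iff)
  next
    assume "x \<ominus>\<^bsub>M\<^esub> y \<in> H"
    then have "x \<in> H +>\<^bsub>M\<^esub> y" using eq by (auto simp: a_r_coset_def')
    then show "H +>\<^bsub>M\<^esub> x = H +>\<^bsub>M\<^esub> y"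
      using M.a_repr_independence[OF _ assms(4) H.a_subgroup] by simp
  qed
qed

text \<open>Since \<open>h\<close> sends \<open>H\<close> into \<open>K\<close>, the summand
  \<open>K\<close> absorbs every \<open>h a\<close>. Scalar multiplication on quotients,
  \<open>cohomology_map\<close> and the differential of \<open>relative_complex\<close> are all
  defined in the shape of the left-hand side; this lemma evaluates them on cosets.\<close>

lemma set_add_image_coset:
  assumes "module R N" "submodule K R N" "H \<noteq> {}" "h x \<in> carrier N"
    and "\<And>a. a \<in> H \<Longrightarrow> h a \<in> K" "\<And>a. a \<in> H \<Longrightarrow> h (a \<oplus>\<^bsub>M\<^esub> x) = h a \<oplus>\<^bsub>N\<^esub> h x"
  shows "K <+>\<^bsub>N\<^esub> (h ` (H +>\<^bsub>M\<^esub> x)) = K +>\<^bsub>N\<^esub> h x"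
proof -
  interpret N: module R N by fact
  note K = N.submoduleE[OF assms(2)]
  have "k \<oplus>\<^bsub>N\<^esub> h (a \<oplus>\<^bsub>M\<^esub> x) = (k \<oplus>\<^bsub>N\<^esub> h a) \<oplus>\<^bsub>N\<^esub> h x" if "k \<in> K" "a \<in> H" for k a
    using that assms K by (auto simp: N.add.m_assoc subset_iff)
  moreover have "k \<oplus>\<^bsub>N\<^esub> h a \<in> K" if "k \<in> K" "a \<in> H" for k a
    using that assms K by auto
  moreover have "\<exists>k'\<in>K. \<exists>a\<in>H. k = k' \<oplus>\<^bsub>N\<^esub> h a" if "k \<in> K" for k
  proof -
    obtain a where a: "a \<in> H" using assms(3) by auto
    have "k = (k \<ominus>\<^bsub>N\<^esub> h a) \<oplus>\<^bsub>N\<^esub> h a"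
      using that a assms(5)[OF a] K(1) by (simp add: subset_iff N.minus_eq N.add.m_assoc N.l_neg)
    moreover have "k \<ominus>\<^bsub>N\<^esub> h a \<in> K" using submodule_minus[OF assms(1,2) that assms(5)[OF a]] .
    ultimately show ?thesis using a by blast
  qed
  ultimately show ?thesis
    by (fastforce simp: set_add_def' a_r_coset_def')
qed

lemma quotient_module_simps:
  assumes "module R M" "submodule H R M"
  shows "carrier (quotient_module M H) = (\<lambda>x. H +>\<^bsub>M\<^esub> x) ` carrier M"
    and "\<zero>\<^bsub>quotient_module M H\<^esub> = H"
    and "x \<in> carrier M \<Longrightarrow> y \<in> carrier M \<Longrightarrow>
      (H +>\<^bsub>M\<^esub> x) \<oplus>\<^bsub>quotient_module M H\<^esub> (H +>\<^bsub>M\<^esub> y) = H +>\<^bsub>M\<^esub> (x \<oplus>\<^bsub>M\<^esub> y)"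
    and "x \<in> carrier M \<Longrightarrow> a \<in> carrier R \<Longrightarrow>
      a \<odot>\<^bsub>quotient_module M H\<^esub> (H +>\<^bsub>M\<^esub> x) = H +>\<^bsub>M\<^esub> (a \<odot>\<^bsub>M\<^esub> x)"
    and "H +>\<^bsub>M\<^esub> \<zero>\<^bsub>M\<^esub> = H"
proof -
  interpret M: module R M by fact
  interpret H: abelian_subgroup H M
    by (rule abelian_subgroupI3)
      (auto intro: additive_subgroup.intro submodule.axioms(1)[OF assms(2)] M.abelian_group_axioms)
  note H = M.submoduleE[OF assms(2)]
  show "carrier (quotient_module M H) = (\<lambda>x. H +>\<^bsub>M\<^esub> x) ` carrier M"
    by (auto simp: quotient_module_def A_RCOSETS_def')
  show "\<zero>\<^bsub>quotient_module M H\<^esub> = H" by (simp add: quotient_module_def)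
  show "x \<in> carrier M \<Longrightarrow> y \<in> carrier M \<Longrightarrow>
      (H +>\<^bsub>M\<^esub> x) \<oplus>\<^bsub>quotient_module M H\<^esub> (H +>\<^bsub>M\<^esub> y) = H +>\<^bsub>M\<^esub> (x \<oplus>\<^bsub>M\<^esub> y)"
    by (simp add: quotient_module_def H.a_rcos_sum)
  show "x \<in> carrier M \<Longrightarrow> a \<in> carrier R \<Longrightarrow>
      a \<odot>\<^bsub>quotient_module M H\<^esub> (H +>\<^bsub>M\<^esub> x) = H +>\<^bsub>M\<^esub> (a \<odot>\<^bsub>M\<^esub> x)"
    unfolding quotient_module_def
    apply simp
    apply (rule set_add_image_coset[OF assms(1,2), where h = "\<lambda>x. a \<odot>\<^bsub>M\<^esub> x"])
    using H by (auto simp: M.smult_r_distr subset_iff)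
  show "H +>\<^bsub>M\<^esub> \<zero>\<^bsub>M\<^esub> = H" using H(1) by simp
qed

lemma quotient_module_is_module:
  assumes "module R M" "submodule H R M"
  shows "module R (quotient_module M H)"
proof -
  interpret M: module R M by fact
  note q = quotient_module_simps[OF assms]
  let ?Q = "quotient_module M H"
  show ?thesis
  proof (rule moduleI)
    show "cring R" by (rule M.R.is_cring)
    show "abelian_group ?Q"
    proof (rule abelian_groupI)
      show "\<zero>\<^bsub>?Q\<^esub> \<in> carrier ?Q" using q(1,2,5) M.M.zero_closed by (metis image_eqI)
      fix x assume x: "x \<in> carrier ?Q"
      then obtain x' where x': "x' \<in> carrier M" "x = H +>\<^bsub>M\<^esub> x'" using q by auto
      have "\<zero>\<^bsub>?Q\<^esub> = H +>\<^bsub>M\<^esub> \<zero>\<^bsub>M\<^esub>" using q by simp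
      then show "\<zero>\<^bsub>?Q\<^esub> \<oplus>\<^bsub>?Q\<^esub> x = x" using x' q(3)[of "\<zero>\<^bsub>M\<^esub>" x'] by simp
      show "\<exists>y\<in>carrier ?Q. y \<oplus>\<^bsub>?Q\<^esub> x = \<zero>\<^bsub>?Q\<^esub>"
        using q(1,2,5) q(3)[of "\<ominus>\<^bsub>M\<^esub> x'" x'] x' by (auto simp: M.M.l_neg)
    qed (auto simp: q(1) q(3) M.M.a_ac)
  qed (auto simp: q(1) q(3) q(4) M.smult_l_distr M.smult_r_distr M.smult_assoc1)
qed

text \<open>The map \<open>\<kappa>\<close> presents \<open>A\<close> as the subquotient \<open>Z / B\<close> of \<open>M\<close>.\<close>

definition subq ::
    "('a, 'x) ring_scheme \<Rightarrow> ('a, 'm) module \<Rightarrow> 'm set \<Rightarrow> 'm set \<Rightarrow> ('a, 'q) module \<Rightarrow> ('m \<Rightarrow> 'q) \<Rightarrow> bool"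
  where "subq R M Z B A \<kappa> \<longleftrightarrow>
     module R M \<and> module R A \<and> submodule Z R M \<and> submodule B R M \<and> B \<subseteq> Z \<and>
     \<kappa> \<in> module_hom R (M\<lparr>carrier := Z\<rparr>) A \<and> \<kappa> ` Z = carrier A \<and>
     (\<forall>x\<in>Z. \<forall>y\<in>Z. \<kappa> x = \<kappa> y \<longleftrightarrow> x \<ominus>\<^bsub>M\<^esub> y \<in> B)"

lemma submodule_restrict:
  assumes "module R M" "submodule Z R M" "submodule B R M" "B \<subseteq> Z"
  shows "submodule B R (M\<lparr>carrier := Z\<rparr>)"
proof -
  interpret M: module R M by fact
  show ?thesis
    using M.submoduleE[OF assms(3)] submodule_zero[OF assms(3)] assms(4)
    by (intro submoduleI'[OF submodule.submodule_is_module[OF assms(2,1)]]) auto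
qed

lemma subq_quotient:
  assumes "module R M" "submodule Z R M" "submodule B R M" "B \<subseteq> Z"
  shows "subq R M Z B (quotient_module (M\<lparr>carrier := Z\<rparr>) B) (\<lambda>x. B +>\<^bsub>M\<^esub> x)"
proof -
  interpret M: module R M by fact
  have MZ: "module R (M\<lparr>carrier := Z\<rparr>)" by (rule submodule.submodule_is_module[OF assms(2,1)])
  have BZ: "submodule B R (M\<lparr>carrier := Z\<rparr>)" by (rule submodule_restrict[OF assms])
  note q = quotient_module_simps[OF MZ BZ, simplified]
  have "(\<lambda>x. B +>\<^bsub>M\<^esub> x) \<in> module_hom R (M\<lparr>carrier := Z\<rparr>) (quotient_module (M\<lparr>carrier := Z\<rparr>) B)"
    by (rule module_homI) (auto simp: q)
  moreover have "B +>\<^bsub>M\<^esub> x = B +>\<^bsub>M\<^esub> y \<longleftrightarrow> x \<ominus>\<^bsub>M\<^esub> y \<in> B" if "x \<in> Z" "y \<in> Z" for x y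
    using that M.submoduleE(1)[OF assms(2)] by (intro a_r_coset_eq_iff[OF assms(1,3)]) auto
  ultimately show ?thesis
    unfolding subq_def using assms q(1) quotient_module_is_module[OF MZ BZ] by auto
qed

lemma subqD:
  assumes "subq R M Z B A \<kappa>"
  shows "module R M" "module R A" "submodule Z R M" "submodule B R M" "B \<subseteq> Z" "Z \<subseteq> carrier M"
    "\<And>x. x \<in> Z \<Longrightarrow> \<kappa> x \<in> carrier A"
    "\<And>x y. x \<in> Z \<Longrightarrow> y \<in> Z \<Longrightarrow> \<kappa> (x \<oplus>\<^bsub>M\<^esub> y) = \<kappa> x \<oplus>\<^bsub>A\<^esub> \<kappa> y"
    "\<And>a x. a \<in> carrier R \<Longrightarrow> x \<in> Z \<Longrightarrow> \<kappa> (a \<odot>\<^bsub>M\<^esub> x) = a \<odot>\<^bsub>A\<^esub> \<kappa> x"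
    "\<And>x y. x \<in> Z \<Longrightarrow> y \<in> Z \<Longrightarrow> \<kappa> x = \<kappa> y \<longleftrightarrow> x \<ominus>\<^bsub>M\<^esub> y \<in> B"
    "\<And>q. q \<in> carrier A \<Longrightarrow> \<exists>x\<in>Z. q = \<kappa> x"
    "\<And>x. x \<in> Z \<Longrightarrow> \<kappa> x = \<zero>\<^bsub>A\<^esub> \<longleftrightarrow> x \<in> B"
proof -
  have s: "module R M" "module R A" "submodule Z R M" "submodule B R M" "B \<subseteq> Z"
    "\<kappa> \<in> module_hom R (M\<lparr>carrier := Z\<rparr>) A" "\<kappa> ` Z = carrier A"
    "\<And>x y. x \<in> Z \<Longrightarrow> y \<in> Z \<Longrightarrow> \<kappa> x = \<kappa> y \<longleftrightarrow> x \<ominus>\<^bsub>M\<^esub> y \<in> B"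
    using assms by (auto simp: subq_def)
  interpret M: module R M by fact
  have ZM: "Z \<subseteq> carrier M" using M.submoduleE(1)[OF s(3)] .
  have k: "\<kappa> \<zero>\<^bsub>M\<^esub> = \<zero>\<^bsub>A\<^esub>"
    using module_hom_zero[OF submodule.submodule_is_module[OF s(3,1)] s(2,6)] by simp
  show "\<And>x. x \<in> Z \<Longrightarrow> \<kappa> x = \<zero>\<^bsub>A\<^esub> \<longleftrightarrow> x \<in> B"
    using s(8)[OF _ submodule_zero[OF s(3)]] ZM k M.M.minus_arith(1) by (auto simp: subset_iff)
  show "module R M" "module R A" "submodule Z R M" "submodule B R M" "B \<subseteq> Z" "Z \<subseteq> carrier M"
    "\<And>x. x \<in> Z \<Longrightarrow> \<kappa> x \<in> carrier A"
    "\<And>x y. x \<in> Z \<Longrightarrow> y \<in> Z \<Longrightarrow> \<kappa> (x \<oplus>\<^bsub>M\<^esub> y) = \<kappa> x \<oplus>\<^bsub>A\<^esub> \<kappa> y"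
    "\<And>a x. a \<in> carrier R \<Longrightarrow> x \<in> Z \<Longrightarrow> \<kappa> (a \<odot>\<^bsub>M\<^esub> x) = a \<odot>\<^bsub>A\<^esub> \<kappa> x"
    "\<And>x y. x \<in> Z \<Longrightarrow> y \<in> Z \<Longrightarrow> \<kappa> x = \<kappa> y \<longleftrightarrow> x \<ominus>\<^bsub>M\<^esub> y \<in> B"
    "\<And>q. q \<in> carrier A \<Longrightarrow> \<exists>x\<in>Z. q = \<kappa> x"
    using s ZM module_homD[OF s(6)] by auto
qed

text \<open>Independence of the representative: elements with the same value under
  \<open>\<kappa>\<close> differ by an element of \<open>B\<close>, and \<open>\<phi>\<close> sends
  \<open>B\<close> into \<open>B'\<close>. The maps that chain maps induce on cohomology are all
  obtained from here.\<close>

lemma subq_map: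
  assumes "subq R M Z B A \<kappa>" "subq R M' Z' B' A' \<kappa>'" "\<phi> \<in> module_hom R M M'"
    and "\<phi> ` Z \<subseteq> Z'" "\<phi> ` B \<subseteq> B'"
  obtains a where "a \<in> module_hom R A A'" "\<And>x. x \<in> Z \<Longrightarrow> a (\<kappa> x) = \<kappa>' (\<phi> x)"
proof -
  note s = subqD[OF assms(1)]
  note s' = subqD[OF assms(2)]
  note h = module_homD[OF assms(3)]
  interpret M: module R M by fact
  define a where "a q = \<kappa>' (\<phi> (SOME x. x \<in> Z \<and> q = \<kappa> x))" for q
  have ak: "a (\<kappa> x) = \<kappa>' (\<phi> x)" if x: "x \<in> Z" for x
  proof -
    define y where "y = (SOME y. y \<in> Z \<and> \<kappa> x = \<kappa> y)"
    have y: "y \<in> Z" "\<kappa> x = \<kappa> y"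
      using someI[of "\<lambda>y. y \<in> Z \<and> \<kappa> x = \<kappa> y" x] x by (auto simp: y_def)
    then have "\<phi> (y \<ominus>\<^bsub>M\<^esub> x) \<in> B'" using s(10)[of y x] x assms(5) by auto
    then have "\<phi> y \<ominus>\<^bsub>M'\<^esub> \<phi> x \<in> B'"
      using module_hom_minus[OF s(1) s'(1) assms(3), of y x] subsetD[OF s(6) x] subsetD[OF s(6) y(1)]
      by simp
    then have "\<kappa>' (\<phi> y) = \<kappa>' (\<phi> x)" using s'(10) x y assms(4) by auto
    then show ?thesis by (simp add: a_def y_def)
  qed
  note Z = M.submoduleE[OF s(3)]
  have "a \<in> module_hom R A A'"
  proof (rule module_homI)
    fix x assume "x \<in> carrier A"
    then obtain u where "u \<in> Z" "x = \<kappa> u" using s(11) by blast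
    then show "a x \<in> carrier A'" using ak s' assms(4) by auto
  next
    fix x y assume "x \<in> carrier A" "y \<in> carrier A"
    then obtain u v where u: "u \<in> Z" "x = \<kappa> u" and v: "v \<in> Z" "y = \<kappa> v" using s(11) by meson
    then have "a (x \<oplus>\<^bsub>A\<^esub> y) = \<kappa>' (\<phi> (u \<oplus>\<^bsub>M\<^esub> v))"
      using ak[of "u \<oplus>\<^bsub>M\<^esub> v"] s(8) Z by simp
    also have "\<dots> = a x \<oplus>\<^bsub>A'\<^esub> a y" using u v ak s'(8) assms(4) h s(6) by (auto simp: subset_iff)
    finally show "a (x \<oplus>\<^bsub>A\<^esub> y) = a x \<oplus>\<^bsub>A'\<^esub> a y" .
  next
    fix r x assume r: "r \<in> carrier R" and "x \<in> carrier A"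
    then obtain u where u: "u \<in> Z" "x = \<kappa> u" using s(11) by blast
    then have "a (r \<odot>\<^bsub>A\<^esub> x) = \<kappa>' (\<phi> (r \<odot>\<^bsub>M\<^esub> u))"
      using ak[of "r \<odot>\<^bsub>M\<^esub> u"] s(9) r Z by simp
    also have "\<dots> = r \<odot>\<^bsub>A'\<^esub> a x" using u r ak s'(9) assms(4) h s(6) by (auto simp: subset_iff)
    finally show "a (r \<odot>\<^bsub>A\<^esub> x) = r \<odot>\<^bsub>A'\<^esub> a x" .
  qed
  then show thesis using that ak by blast
qed

text \<open>Injectivity and surjectivity are tested on representatives in the ambient modules. The
  two last assumptions are what exactness of a mapping cone delivers.\<close>

lemma subq_map_bij:
  assumes "subq R M Z B A \<kappa>" "subq R M' Z' B' A' \<kappa>'" "\<phi> \<in> module_hom R M M'"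
    and "a \<in> module_hom R A A'" "\<And>x. x \<in> Z \<Longrightarrow> a (\<kappa> x) = \<kappa>' (\<phi> x)"
    and "\<phi> ` Z \<subseteq> Z'" "\<And>x. x \<in> Z \<Longrightarrow> \<phi> x \<in> B' \<Longrightarrow> x \<in> B"
    and "\<And>y. y \<in> Z' \<Longrightarrow> \<exists>x\<in>Z. \<phi> x \<ominus>\<^bsub>M'\<^esub> y \<in> B'"
  shows "bij_betw a (carrier A) (carrier A')"
proof -
  note s = subqD[OF assms(1)]
  note s' = subqD[OF assms(2)]
  note ah = module_homD[OF assms(4)]
  interpret M: module R M by fact
  have "inj_on a (carrier A)"
  proof (rule inj_onI)
    fix x y assume "x \<in> carrier A" "y \<in> carrier A" and e: "a x = a y"
    then obtain u v where u: "u \<in> Z" "x = \<kappa> u" and v: "v \<in> Z" "y = \<kappa> v" using s(11) by meson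
    then have "\<kappa>' (\<phi> u) = \<kappa>' (\<phi> v)" using e assms(5) by simp
    then have "\<phi> u \<ominus>\<^bsub>M'\<^esub> \<phi> v \<in> B'" using s'(10) u v assms(6) by auto
    then have "\<phi> (u \<ominus>\<^bsub>M\<^esub> v) \<in> B'"
      using module_hom_minus[OF s(1) s'(1) assms(3), of u v] subsetD[OF s(6) u(1)] subsetD[OF s(6) v(1)]
      by simp
    then have "u \<ominus>\<^bsub>M\<^esub> v \<in> B" using assms(7) submodule_minus[OF s(1,3)] u v by auto
    then show "x = y" using s(10) u v by simp
  qed
  moreover have "\<exists>x\<in>carrier A. q = a x" if q: "q \<in> carrier A'" for q
  proof -
    obtain y where y: "y \<in> Z'" "q = \<kappa>' y" using s'(11)[OF q] by meson
    then obtain x where x: "x \<in> Z" "\<phi> x \<ominus>\<^bsub>M'\<^esub> y \<in> B'" using assms(8) by meson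
    then have "a (\<kappa> x) = q" using s'(10)[of "\<phi> x" y] y assms(5,6) by auto
    then show ?thesis using x s(7) by metis
  qed
  ultimately show ?thesis using ah(1) by (auto simp: bij_betw_def)
qed

section \<open>Torsion submodules over Noetherian rings\<close>

lemma (in cring) idealI':
  assumes "I \<subseteq> carrier R" "\<zero> \<in> I"
    and add: "\<And>a b. a \<in> I \<Longrightarrow> b \<in> I \<Longrightarrow> a \<oplus> b \<in> I"
    and mult: "\<And>a r. a \<in> I \<Longrightarrow> r \<in> carrier R \<Longrightarrow> r \<otimes> a \<in> I"
  shows "ideal I R"
proof (rule idealI[OF ring_axioms])
  have "\<ominus> a \<in> I" if "a \<in> I" for a
    using mult[OF that, of "\<ominus> \<one>"] assms(1) that by (auto simp: l_minus subset_iff)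
  then show "subgroup I (add_monoid R)"
    using assms by (intro subgroup.intro) (auto simp: a_inv_def[symmetric])
  fix a x assume "a \<in> I" "x \<in> carrier R"
  then show "x \<otimes> a \<in> I" "a \<otimes> x \<in> I" using mult[of a x] assms(1) by (auto simp: m_comm subset_iff)
qed

lemma idealD:
  assumes "ideal I R"
  shows "I \<subseteq> carrier R" "\<zero>\<^bsub>R\<^esub> \<in> I"
    and "\<And>a b. a \<in> I \<Longrightarrow> b \<in> I \<Longrightarrow> a \<oplus>\<^bsub>R\<^esub> b \<in> I"
    and "\<And>a r. a \<in> I \<Longrightarrow> r \<in> carrier R \<Longrightarrow> r \<otimes>\<^bsub>R\<^esub> a \<in> I"
    and "\<And>a r. a \<in> I \<Longrightarrow> r \<in> carrier R \<Longrightarrow> a \<otimes>\<^bsub>R\<^esub> r \<in> I"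
    and "\<And>a b. a \<in> I \<Longrightarrow> b \<in> I \<Longrightarrow> a \<ominus>\<^bsub>R\<^esub> b \<in> I"
proof -
  interpret ideal I R by fact
  show "I \<subseteq> carrier R" "\<zero>\<^bsub>R\<^esub> \<in> I"
    "\<And>a b. a \<in> I \<Longrightarrow> b \<in> I \<Longrightarrow> a \<oplus>\<^bsub>R\<^esub> b \<in> I"
    "\<And>a r. a \<in> I \<Longrightarrow> r \<in> carrier R \<Longrightarrow> r \<otimes>\<^bsub>R\<^esub> a \<in> I"
    "\<And>a r. a \<in> I \<Longrightarrow> r \<in> carrier R \<Longrightarrow> a \<otimes>\<^bsub>R\<^esub> r \<in> I"
    "\<And>a b. a \<in> I \<Longrightarrow> b \<in> I \<Longrightarrow> a \<ominus>\<^bsub>R\<^esub> b \<in> I"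
    by (auto simp: I_l_closed I_r_closed a_minus_def)
qed

text \<open>The union of a nonempty chain of ideals of a Noetherian ring belongs to the chain, so
  Zorn's lemma applies to an arbitrary nonempty set of ideals. This is the form in which Noetherian
  induction is used below.\<close>

lemma (in noetherian_ring) exists_maximal_ideal_in:
  assumes "C \<noteq> {}" "\<And>I. I \<in> C \<Longrightarrow> ideal I R"
  obtains I where "I \<in> C" "\<And>J. J \<in> C \<Longrightarrow> I \<subseteq> J \<Longrightarrow> J = I"
proof -
  have "\<exists>M\<in>C. \<forall>X\<in>C. M \<subseteq> X \<longrightarrow> X = M"
  proof (rule subset_Zorn_nonempty[OF assms(1)])
    fix \<C> assume "\<C> \<noteq> {}" "subset.chain C \<C>"
    then show "\<Union>\<C> \<in> C"
      using ideal_chain_is_trivial[of \<C>] assms(2) by (auto simp: subset.chain_def subset_iff)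
  qed
  then show thesis using that by blast
qed

lemma (in cring) ideal_add_principal:
  assumes "ideal A R" "z \<in> carrier R"
  defines "A' \<equiv> {a \<oplus> r \<otimes> z | a r. a \<in> A \<and> r \<in> carrier R}"
  shows "ideal A' R" "A \<subseteq> A'" "z \<in> A'"
proof -
  note A = idealD[OF assms(1)]
  have "A' = A <+> PIdl z"
    by (auto simp: A'_def set_add_def' cgenideal_def)
  then show "ideal A' R" using add_ideals[OF assms(1) cgenideal_ideal[OF assms(2)]] by simp
  show "A \<subseteq> A'" unfolding A'_def using A(1) assms(2)
    by (smt (verit, best) l_null mem_Collect_eq r_zero subset_iff zero_closed)
  have "z = \<zero> \<oplus> \<one> \<otimes> z" using assms(2) by simp
  then show "z \<in> A'" unfolding A'_def using A(2) by blast
qed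

lemma (in cring) pow_in_ideal_mono:
  assumes "ideal A R" "a \<in> carrier R" "a [^] n \<in> A" "n \<le> (m::nat)"
  shows "a [^] m \<in> A"
proof -
  have "a [^] m = a [^] (m - n) \<otimes> a [^] n" using assms by (simp add: nat_pow_mult)
  then show ?thesis using idealD(4)[OF assms(1,3)] assms(2) by simp
qed

lemma (in cring) radical_add_closed:
  assumes A: "ideal A R" and ab: "a \<in> carrier R" "b \<in> carrier R"
    and n: "a [^] (n::nat) \<in> A" and k: "b [^] (k::nat) \<in> A"
  shows "(a \<oplus> b) [^] (n + k) \<in> A"
proof -
  note AD = idealD[OF A]
  \<comment> \<open>A substitute for the binomial theorem, by induction on \<open>N\<close>:
    expanding one factor \<open>a \<oplus> b\<close> raises \<open>i\<close> or \<open>j\<close> by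
    one, and at \<open>N = 0\<close> one of \<open>n \<le> i\<close> and \<open>k \<le> j\<close>
    must hold.\<close>
  have "(a [^] i \<otimes> b [^] j) \<otimes> (a \<oplus> b) [^] N \<in> A" if "n + k \<le> N + i + j" for N i j :: nat
    using that
  proof (induction N arbitrary: i j)
    case 0
    then have "n \<le> i \<or> k \<le> j" by auto
    then have "a [^] i \<in> A \<or> b [^] j \<in> A" using pow_in_ideal_mono[OF A] ab n k by blast
    then have "a [^] i \<otimes> b [^] j \<in> A" using AD(4,5) ab by auto
    then show ?case using AD(1) by auto
  next
    case (Suc N)
    have "(a [^] Suc i \<otimes> b [^] j) \<otimes> (a \<oplus> b) [^] N \<oplus> (a [^] i \<otimes> b [^] Suc j) \<otimes> (a \<oplus> b) [^] N \<in> A"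
      by (intro AD(3) Suc.IH) (use Suc.prems in simp_all)
    also have "(a [^] Suc i \<otimes> b [^] j) \<otimes> (a \<oplus> b) [^] N \<oplus> (a [^] i \<otimes> b [^] Suc j) \<otimes> (a \<oplus> b) [^] N
        = (a [^] i \<otimes> b [^] j) \<otimes> (a \<oplus> b) [^] Suc N"
    proof -
      define u v w where "u = a [^] i" "v = b [^] j" "w = (a \<oplus> b) [^] N"
      have c: "u \<in> carrier R" "v \<in> carrier R" "w \<in> carrier R" using ab by (auto simp: u_v_w_def)
      have "((u \<otimes> a) \<otimes> v) \<otimes> w \<oplus> (u \<otimes> (v \<otimes> b)) \<otimes> w = (u \<otimes> v) \<otimes> (w \<otimes> (a \<oplus> b))"
        using ab c by algebra
      then show ?thesis by (simp add: u_v_w_def)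
    qed
    finally show ?case .
  qed
  from this[of "n + k" 0 0] show ?thesis using ab by simp
qed

text \<open>Compared with \<^const>\<open>sections_supp\<close>, this version allows finite generating sets in place of
  ideals and is compatible with restriction of scalars.\<close>

definition gam :: "('a, 'x) ring_scheme \<Rightarrow> 'a set \<Rightarrow> ('a, 'm) module \<Rightarrow> 'm set" where
  "gam R Y M = {m \<in> carrier M. \<forall>y\<in>Y. \<exists>n::nat. (y [^]\<^bsub>R\<^esub> n) \<odot>\<^bsub>M\<^esub> m = \<zero>\<^bsub>M\<^esub>}"

lemma (in module) ideal_annihilator:
  assumes "m \<in> carrier M"
  shows "ideal {a \<in> carrier R. a \<odot>\<^bsub>M\<^esub> m = \<zero>\<^bsub>M\<^esub>} R"
  using assms by (intro R.idealI') (auto simp: smult_l_distr smult_assoc1)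

lemma (in module) smult_pow_mono:
  assumes "y \<in> carrier R" "m \<in> carrier M" "(y [^] n) \<odot>\<^bsub>M\<^esub> m = \<zero>\<^bsub>M\<^esub>" "n \<le> (k::nat)"
  shows "(y [^] k) \<odot>\<^bsub>M\<^esub> m = \<zero>\<^bsub>M\<^esub>"
  using R.pow_in_ideal_mono[OF ideal_annihilator[OF assms(2)] assms(1) _ assms(4)] assms by auto

lemma gam_subset: "gam R Y M \<subseteq> carrier M"
  by (auto simp: gam_def)

lemma submodule_gam:
  assumes "module R M" "Y \<subseteq> carrier R"
  shows "submodule (gam R Y M) R M"
proof -
  interpret M: module R M by fact
  show ?thesis
  proof (rule submoduleI'[OF assms(1)])
    show "gam R Y M \<subseteq> carrier M" by (rule gam_subset)
    show "\<zero>\<^bsub>M\<^esub> \<in> gam R Y M" using assms(2) by (auto simp: gam_def subset_iff)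
    fix a b assume ab: "a \<in> gam R Y M" "b \<in> gam R Y M"
    have "\<exists>n::nat. (y [^]\<^bsub>R\<^esub> n) \<odot>\<^bsub>M\<^esub> (a \<oplus>\<^bsub>M\<^esub> b) = \<zero>\<^bsub>M\<^esub>" if y: "y \<in> Y" for y
    proof -
      obtain n k :: nat where "(y [^]\<^bsub>R\<^esub> n) \<odot>\<^bsub>M\<^esub> a = \<zero>\<^bsub>M\<^esub>" "(y [^]\<^bsub>R\<^esub> k) \<odot>\<^bsub>M\<^esub> b = \<zero>\<^bsub>M\<^esub>"
        using ab y unfolding gam_def by blast
      then have "(y [^]\<^bsub>R\<^esub> (max n k)) \<odot>\<^bsub>M\<^esub> a = \<zero>\<^bsub>M\<^esub>" "(y [^]\<^bsub>R\<^esub> (max n k)) \<odot>\<^bsub>M\<^esub> b = \<zero>\<^bsub>M\<^esub>"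
        using M.smult_pow_mono y assms(2) ab by (auto simp: gam_def)
      then show ?thesis using ab that assms(2)
        by (intro exI[of _ "max n k"]) (auto simp: M.smult_r_distr gam_def subset_iff)
    qed
    then show "a \<oplus>\<^bsub>M\<^esub> b \<in> gam R Y M" using ab by (auto simp: gam_def)
  next
    fix r m assume r: "r \<in> carrier R" and m: "m \<in> gam R Y M"
    have "\<exists>n::nat. (y [^]\<^bsub>R\<^esub> n) \<odot>\<^bsub>M\<^esub> (r \<odot>\<^bsub>M\<^esub> m) = \<zero>\<^bsub>M\<^esub>" if y: "y \<in> Y" for y
    proof -
      obtain n :: nat where n: "(y [^]\<^bsub>R\<^esub> n) \<odot>\<^bsub>M\<^esub> m = \<zero>\<^bsub>M\<^esub>" using m y by (auto simp: gam_def)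
      have "y [^]\<^bsub>R\<^esub> n \<in> carrier R" "m \<in> carrier M" using y assms(2) m by (auto simp: gam_def)
      then have "(y [^]\<^bsub>R\<^esub> n) \<odot>\<^bsub>M\<^esub> (r \<odot>\<^bsub>M\<^esub> m) = r \<odot>\<^bsub>M\<^esub> ((y [^]\<^bsub>R\<^esub> n) \<odot>\<^bsub>M\<^esub> m)"
        using r by (simp add: M.smult_assoc1[symmetric] M.R.m_comm)
      then show ?thesis using n r by auto
    qed
    then show "r \<odot>\<^bsub>M\<^esub> m \<in> gam R Y M" using r m by (auto simp: gam_def)
  qed
qed

lemma gam_hom:
  assumes "module R M" "module R N" "h \<in> module_hom R M N" "Y \<subseteq> carrier R" "m \<in> gam R Y M"
  shows "h m \<in> gam R Y N"
proof -
  interpret M: module R M by fact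
  note h = module_homD[OF assms(3)]
  show ?thesis
    unfolding gam_def
  proof (intro CollectI conjI ballI)
    show "h m \<in> carrier N" using h assms(5) by (auto simp: gam_def)
    fix y assume y: "y \<in> Y"
    then obtain n :: nat where n: "(y [^]\<^bsub>R\<^esub> n) \<odot>\<^bsub>M\<^esub> m = \<zero>\<^bsub>M\<^esub>" using assms(5) by (auto simp: gam_def)
    have "(y [^]\<^bsub>R\<^esub> n) \<odot>\<^bsub>N\<^esub> h m = h ((y [^]\<^bsub>R\<^esub> n) \<odot>\<^bsub>M\<^esub> m)"
      using y assms(4,5) h(3) by (auto simp: gam_def)
    then show "\<exists>n::nat. (y [^]\<^bsub>R\<^esub> n) \<odot>\<^bsub>N\<^esub> h m = \<zero>\<^bsub>N\<^esub>"
      using n module_hom_zero[OF assms(1,2,3)] by auto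
  qed
qed

text \<open>The ring elements having a power that kills \<open>m\<close> form the radical of the
  annihilator of \<open>m\<close>. As this is an ideal, it contains the ideal generated by
  \<open>Y\<close> as soon as it contains \<open>Y\<close>.\<close>

lemma gam_genideal:
  assumes "module R M" "Y \<subseteq> carrier R"
  shows "gam R (genideal R Y) M = gam R Y M"
proof
  interpret M: module R M by fact
  show "gam R (genideal R Y) M \<subseteq> gam R Y M"
    using M.R.genideal_self[OF assms(2)] by (auto simp: gam_def)
  show "gam R Y M \<subseteq> gam R (genideal R Y) M"
  proof
    fix m assume m: "m \<in> gam R Y M"
    then have mM: "m \<in> carrier M" by (auto simp: gam_def)
    let ?A = "{a \<in> carrier R. a \<odot>\<^bsub>M\<^esub> m = \<zero>\<^bsub>M\<^esub>}"
    let ?J = "{a \<in> carrier R. \<exists>n::nat. a [^]\<^bsub>R\<^esub> n \<in> ?A}"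
    note A = M.ideal_annihilator[OF mM]
    have "ideal ?J R"
    proof (rule M.R.idealI')
      have "\<zero>\<^bsub>R\<^esub> [^]\<^bsub>R\<^esub> (1::nat) \<in> ?A" using mM by simp
      then show "\<zero>\<^bsub>R\<^esub> \<in> ?J" by blast
      show "a \<oplus>\<^bsub>R\<^esub> b \<in> ?J" if "a \<in> ?J" "b \<in> ?J" for a b
        using that M.R.radical_add_closed[OF A] by blast
      show "r \<otimes>\<^bsub>R\<^esub> a \<in> ?J" if ar: "a \<in> ?J" "r \<in> carrier R" for a r
      proof -
        obtain n :: nat where n: "a [^]\<^bsub>R\<^esub> n \<in> ?A" using ar by blast
        then have "r [^]\<^bsub>R\<^esub> n \<otimes>\<^bsub>R\<^esub> a [^]\<^bsub>R\<^esub> n \<in> ?A" using idealD(4)[OF A] ar by blast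
        then have "(r \<otimes>\<^bsub>R\<^esub> a) [^]\<^bsub>R\<^esub> n \<in> ?A" using ar by (simp add: M.R.nat_pow_distrib)
        then show ?thesis using ar by blast
      qed
    qed auto
    moreover have "Y \<subseteq> ?J" using m assms(2) by (auto simp: gam_def)
    ultimately have "genideal R Y \<subseteq> ?J" by (rule M.R.genideal_minimal)
    then show "m \<in> gam R (genideal R Y) M" using mM by (auto simp: gam_def)
  qed
qed

lemma ideal_pow_simps:
  "I [^]\<^bsub>ideals_set R\<^esub> (0::nat) = carrier R"
  "I [^]\<^bsub>ideals_set R\<^esub> Suc n = (I [^]\<^bsub>ideals_set R\<^esub> n) \<cdot>\<^bsub>R\<^esub> I"
  by (simp_all add: ideals_set_def)

text \<open>Noetherian induction: for a maximal counterexample \<open>B\<close> there is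
  \<open>z\<close> outside \<open>B\<close> with square in \<open>B\<close>. Some power
  \<open>I^N\<close> then lies in \<open>B + Rz\<close>, the square of this ideal lies in
  \<open>B\<close>, and so \<open>I^(2N)\<close> does.\<close>

lemma (in cring) ideal_pow_in_of_radical:
  assumes "noetherian_ring R" "ideal I R" "ideal A R" "\<And>y. y \<in> I \<Longrightarrow> \<exists>n::nat. y [^] n \<in> A"
  shows "\<exists>N::nat. I [^]\<^bsub>ideals_set R\<^esub> N \<subseteq> A"
proof (rule ccontr)
  interpret NR: noetherian_ring R by fact
  interpret P: comm_monoid "ideals_set R" by (rule ideals_set_is_comm_monoid)
  assume neg: "\<not> ?thesis"
  define C where "C = {B. ideal B R \<and> (\<forall>y\<in>I. \<exists>n::nat. y [^] n \<in> B) \<and> \<not> (\<exists>N::nat. I [^]\<^bsub>ideals_set R\<^esub> N \<subseteq> B)}"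
  obtain B where B: "B \<in> C" and max: "\<And>J. J \<in> C \<Longrightarrow> B \<subseteq> J \<Longrightarrow> J = B"
    by (rule NR.exists_maximal_ideal_in[of C]) (use neg assms in \<open>auto simp: C_def\<close>)
  have Bi: "ideal B R" using B by (simp add: C_def)
  note BD = idealD[OF Bi] and ID = idealD[OF assms(2)]
  have "\<not> I [^]\<^bsub>ideals_set R\<^esub> (1::nat) \<subseteq> B" using B unfolding C_def by blast
  moreover have "I [^]\<^bsub>ideals_set R\<^esub> (1::nat) = I"
    using P.nat_pow_eone[of I] assms(2) by (simp add: ideals_set_def)
  ultimately obtain y where y: "y \<in> I" "y \<notin> B" by auto
  have yc: "y \<in> carrier R" using y ID by auto
  define n where "n = (LEAST n::nat. y [^] n \<in> B)"
  have "\<exists>n::nat. y [^] n \<in> B" using B y(1) unfolding C_def by blast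
  then have n: "y [^] n \<in> B" unfolding n_def by (rule LeastI_ex)
  have nmin: "y [^] m \<notin> B" if "m < n" for m using that not_less_Least unfolding n_def by blast
  have n2: "n \<ge> 2"
  proof (rule ccontr)
    assume "\<not> n \<ge> 2"
    then have "y [^] (1::nat) \<in> B" using pow_in_ideal_mono[OF Bi yc n, of 1] by auto
    then show False using y yc by simp
  qed
  \<comment> \<open>The last power of \<open>y\<close> outside \<open>B\<close>. The exponent
    \<open>2(n - 1)\<close> of its square is at least \<open>n\<close> because
    \<open>n \<ge> 2\<close>.\<close>
  define z where "z = y [^] (n - 1)"
  have z: "z \<in> carrier R" "z \<notin> B" using yc nmin[of "n - 1"] n2 by (auto simp: z_def)
  have "z \<otimes> z = y [^] (n - 1 + (n - 1))" unfolding z_def using yc by (simp add: nat_pow_mult)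
  then have zz: "z \<otimes> z \<in> B" using pow_in_ideal_mono[OF Bi yc n, of "n - 1 + (n - 1)"] n2 by simp
  define B' where "B' = {a \<oplus> r \<otimes> z | a r. a \<in> B \<and> r \<in> carrier R}"
  have B': "ideal B' R" "B \<subseteq> B'" "z \<in> B'" unfolding B'_def by (rule ideal_add_principal[OF Bi z(1)])+
  have "B' \<notin> C" using max[of B'] B' z by auto
  moreover have "\<forall>y\<in>I. \<exists>n::nat. y [^] n \<in> B'" using B B'(2) unfolding C_def by blast
  ultimately obtain N :: nat where N: "I [^]\<^bsub>ideals_set R\<^esub> N \<subseteq> B'" using B' by (auto simp: C_def)
  have prod: "u \<otimes> v \<in> B" if uv: "u \<in> B'" "v \<in> B'" for u v
  proof -
    obtain a r b s where u: "u = a \<oplus> r \<otimes> z" "a \<in> B" "r \<in> carrier R"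
      and v: "v = b \<oplus> s \<otimes> z" "b \<in> B" "s \<in> carrier R" using uv by (auto simp: B'_def)
    have c: "a \<in> carrier R" "b \<in> carrier R" using u v BD by auto
    have "u \<otimes> v = (v \<otimes> a \<oplus> (r \<otimes> z) \<otimes> b) \<oplus> (r \<otimes> s) \<otimes> (z \<otimes> z)"
      using u v c z(1) by algebra
    moreover have "v \<in> carrier R" using v c z by auto
    ultimately show ?thesis using u v z zz BD(3,4) by auto
  qed
  have "I [^]\<^bsub>ideals_set R\<^esub> (N + N) = (I [^]\<^bsub>ideals_set R\<^esub> N) \<cdot> (I [^]\<^bsub>ideals_set R\<^esub> N)"
    using P.nat_pow_mult[of I N N] assms(2) by (simp add: ideals_set_def)
  moreover have "(I [^]\<^bsub>ideals_set R\<^esub> N) \<cdot> (I [^]\<^bsub>ideals_set R\<^esub> N) \<subseteq> B"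
  proof
    fix x assume "x \<in> (I [^]\<^bsub>ideals_set R\<^esub> N) \<cdot> (I [^]\<^bsub>ideals_set R\<^esub> N)"
    then show "x \<in> B"
    proof (induction rule: ideal_prod.induct)
      case (prod i j)
      then show ?case using N \<open>\<And>u v. u \<in> B' \<Longrightarrow> v \<in> B' \<Longrightarrow> u \<otimes> v \<in> B\<close> by blast
    next
      case (sum s1 s2)
      then show ?case using BD(3) by blast
    qed
  qed
  ultimately have "I [^]\<^bsub>ideals_set R\<^esub> (N + N) \<subseteq> B" by simp
  then show False using B unfolding C_def by blast
qed

text \<open>For \<open>y\<close> in \<open>I\<close> the power \<open>y^n\<close> lies in
  \<open>I^n\<close>, which gives one inclusion. For the other, the preceding lemma is applied to
  the annihilator of \<open>m\<close>; it turns one exponent per element of \<open>I\<close> into a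
  uniform exponent for the ideal.\<close>

lemma sections_supp_eq_gam:
  assumes "noetherian_ring R" "module R M" "ideal I R"
  shows "sections_supp R I M = gam R I M"
proof -
  interpret M: module R M by fact
  have pw: "y [^]\<^bsub>R\<^esub> n \<in> I [^]\<^bsub>ideals_set R\<^esub> n" if "y \<in> I" for y and n :: nat
  proof (induction n)
    case 0
    then show ?case using ideal_pow_simps(1)[where R = R and I = I] by simp
  next
    case (Suc n)
    then have "y [^]\<^bsub>R\<^esub> n \<otimes>\<^bsub>R\<^esub> y \<in> (I [^]\<^bsub>ideals_set R\<^esub> n) \<cdot>\<^bsub>R\<^esub> I" using that by (auto intro: ideal_prod.prod)
    then show ?case using ideal_pow_simps(2)[where R = R and I = I and n = n] by simp
  qed
  have "\<exists>n::nat. \<forall>a\<in>I [^]\<^bsub>ideals_set R\<^esub> n. a \<odot>\<^bsub>M\<^esub> m = \<zero>\<^bsub>M\<^esub>" if m: "m \<in> gam R I M" for m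
  proof -
    have mM: "m \<in> carrier M" using m by (simp add: gam_def)
    have "\<exists>n::nat. y [^]\<^bsub>R\<^esub> n \<in> {a \<in> carrier R. a \<odot>\<^bsub>M\<^esub> m = \<zero>\<^bsub>M\<^esub>}" if y: "y \<in> I" for y
    proof -
      obtain n :: nat where "(y [^]\<^bsub>R\<^esub> n) \<odot>\<^bsub>M\<^esub> m = \<zero>\<^bsub>M\<^esub>" using m y by (auto simp: gam_def)
      moreover have "y [^]\<^bsub>R\<^esub> n \<in> carrier R" using y idealD(1)[OF assms(3)] by auto
      ultimately show ?thesis by blast
    qed
    from M.R.ideal_pow_in_of_radical[OF assms(1,3) M.ideal_annihilator[OF mM] this]
    show ?thesis by blast
  qed
  moreover have "sections_supp R I M \<subseteq> gam R I M"
    using pw unfolding sections_supp_def gam_def by blast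
  ultimately show ?thesis by (auto simp: sections_supp_def gam_def)
qed

text \<open>This is the inclusion of \<open>I2\<close> in the radical of \<open>I1\<close>. An ideal
  that is maximal among those containing \<open>I1\<close> and avoiding all powers of
  \<open>y\<close> is prime.\<close>

lemma (in cring) power_mem_of_closed_set_subset:
  assumes "noetherian_ring R" "ideal I1 R" "ideal I2 R" "closed_set R I1 \<subseteq> closed_set R I2" "y \<in> I2"
  shows "\<exists>n::nat. y [^] n \<in> I1"
proof (rule ccontr)
  interpret NR: noetherian_ring R by fact
  assume neg: "\<not> ?thesis"
  define C where "C = {B. ideal B R \<and> I1 \<subseteq> B \<and> (\<forall>n::nat. y [^] n \<notin> B)}"
  obtain P where P: "P \<in> C" and max: "\<And>J. J \<in> C \<Longrightarrow> P \<subseteq> J \<Longrightarrow> J = P"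
    by (rule NR.exists_maximal_ideal_in[of C]) (use neg assms in \<open>auto simp: C_def\<close>)
  have Pi: "ideal P R" "I1 \<subseteq> P" "\<And>n::nat. y [^] n \<notin> P" using P by (auto simp: C_def)
  note PD = idealD[OF Pi(1)]
  have yc: "y \<in> carrier R" using assms(5) idealD(1)[OF assms(3)] by auto
  \<comment> \<open>By maximality, each \<open>a\<close> outside \<open>P\<close> puts a power of
    \<open>y\<close> into \<open>P + Ra\<close>. Multiplying the expressions for two such elements
    with product in \<open>P\<close> gives a power of \<open>y\<close> in \<open>P\<close>.\<close>
  have ext: "\<exists>n::nat. \<exists>p\<in>P. \<exists>r\<in>carrier R. y [^] n = p \<oplus> r \<otimes> a" if a: "a \<in> carrier R" "a \<notin> P" for a
  proof -
    define P' where "P' = {p \<oplus> r \<otimes> a | p r. p \<in> P \<and> r \<in> carrier R}"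
    have P': "ideal P' R" "P \<subseteq> P'" "a \<in> P'" unfolding P'_def by (rule ideal_add_principal[OF Pi(1) a(1)])+
    have "P' \<notin> C" using max[of P'] P' a by auto
    then obtain n :: nat where "y [^] n \<in> P'" using P' Pi by (auto simp: C_def)
    then show ?thesis by (auto simp: P'_def)
  qed
  have "primeideal P R"
  proof (rule primeidealI[OF Pi(1) is_cring])
    show "carrier R \<noteq> P" using Pi(3)[of 0] by auto
    fix a b assume ab: "a \<in> carrier R" "b \<in> carrier R" "a \<otimes> b \<in> P"
    show "a \<in> P \<or> b \<in> P"
    proof (rule ccontr)
      assume "\<not> ?thesis"
      then obtain n k :: nat and p q r s where
        n: "y [^] n = p \<oplus> r \<otimes> a" "p \<in> P" "r \<in> carrier R" and
        k: "y [^] k = q \<oplus> s \<otimes> b" "q \<in> P" "s \<in> carrier R"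
        using ext ab by meson
      have c: "p \<in> carrier R" "q \<in> carrier R" using n k PD by auto
      have "y [^] (n + k) = (p \<oplus> r \<otimes> a) \<otimes> (q \<oplus> s \<otimes> b)"
        using n k yc by (simp add: nat_pow_mult[symmetric])
      also have "\<dots> = ((q \<oplus> s \<otimes> b) \<otimes> p \<oplus> (r \<otimes> a) \<otimes> q) \<oplus> (r \<otimes> s) \<otimes> (a \<otimes> b)"
        using n k c ab by algebra
      also have "\<dots> \<in> P" using n k c ab PD(3,4) by auto
      finally show False using Pi(3) by blast
    qed
  qed
  then have "P \<in> closed_set R I2" using Pi(2) assms(4) by (auto simp: closed_set_def)
  then have "y \<in> P" using assms(5) by (auto simp: closed_set_def)
  then show False using Pi(3)[of 1] yc by simp
qed

lemma gam_mono_closed_set: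
  assumes "noetherian_ring R" "module R M" "ideal I1 R" "ideal I2 R"
    and "closed_set R I1 \<subseteq> closed_set R I2"
  shows "gam R I1 M \<subseteq> gam R I2 M"
proof
  interpret M: module R M by fact
  fix m assume m: "m \<in> gam R I1 M"
  have "\<exists>n::nat. (y [^]\<^bsub>R\<^esub> n) \<odot>\<^bsub>M\<^esub> m = \<zero>\<^bsub>M\<^esub>" if y: "y \<in> I2" for y
  proof -
    obtain n :: nat where n: "y [^]\<^bsub>R\<^esub> n \<in> I1"
      using M.R.power_mem_of_closed_set_subset[OF assms(1,3,4,5) y] by blast
    then obtain k :: nat where "((y [^]\<^bsub>R\<^esub> n) [^]\<^bsub>R\<^esub> k) \<odot>\<^bsub>M\<^esub> m = \<zero>\<^bsub>M\<^esub>" using m by (auto simp: gam_def)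
    moreover have "y \<in> carrier R" using y idealD(1)[OF assms(4)] by auto
    ultimately have "(y [^]\<^bsub>R\<^esub> (n * k)) \<odot>\<^bsub>M\<^esub> m = \<zero>\<^bsub>M\<^esub>" by (simp add: M.R.nat_pow_pow)
    then show ?thesis by blast
  qed
  then show "m \<in> gam R I2 M" using m by (auto simp: gam_def)
qed

text \<open>The ideals \<open>(Q : y^r)\<close> increase with \<open>r\<close>, so a maximal one
  among them equals its successor. For the zero ideal \<open>Q\<close> these are the annihilators of
  the powers of \<open>y\<close>.\<close>

lemma (in cring) colon_power_stabilises:
  assumes "noetherian_ring R" "ideal Q R" "y \<in> carrier R"
  obtains r :: nat where "\<And>s. s \<in> carrier R \<Longrightarrow> y [^] Suc r \<otimes> s \<in> Q \<Longrightarrow> y [^] r \<otimes> s \<in> Q"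
proof -
  interpret NR: noetherian_ring R by fact
  note QD = idealD[OF assms(2)]
  define K where "K r = {s \<in> carrier R. y [^] (r::nat) \<otimes> s \<in> Q}" for r
  have Ki: "ideal (K r) R" for r
    unfolding K_def
  proof (rule idealI', goal_cases)
    case (4 a t)
    then have "y [^] r \<otimes> (t \<otimes> a) = t \<otimes> (y [^] r \<otimes> a)" using assms(3) by (simp add: m_lcomm)
    then show ?case using 4 QD by auto
  qed (use QD assms(3) in \<open>auto simp: r_distr\<close>)
  obtain I where I: "I \<in> range K" and max: "\<And>J. J \<in> range K \<Longrightarrow> I \<subseteq> J \<Longrightarrow> J = I"
    by (rule NR.exists_maximal_ideal_in[of "range K"]) (use Ki in auto)
  then obtain r where r: "I = K r" by auto
  have "K r \<subseteq> K (Suc r)"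
  proof
    fix s assume s: "s \<in> K r"
    then have "y [^] Suc r \<otimes> s = y \<otimes> (y [^] r \<otimes> s)"
      using assms(3) unfolding K_def by (simp add: m_ac)
    then show "s \<in> K (Suc r)" using s QD(4) assms(3) by (auto simp: K_def simp del: nat_pow_Suc)
  qed
  then have "K (Suc r) = K r" using max[of "K (Suc r)"] r by auto
  then show thesis using that[of r] unfolding K_def by blast
qed

section \<open>Injective modules\<close>

lemma ring_module_simps [simp]:
  "carrier (ring_module R) = carrier R" "add (ring_module R) = add R"
  "zero (ring_module R) = zero R" "smult (ring_module R) = mult R"
  by (simp_all add: ring_module_def)

lemma restrict_scalars_simps [simp]:
  "carrier (restrict_scalars f M) = carrier M" "add (restrict_scalars f M) = add M"
  "zero (restrict_scalars f M) = zero M" "a \<odot>\<^bsub>restrict_scalars f M\<^esub> x = f a \<odot>\<^bsub>M\<^esub> x"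
  by (simp_all add: restrict_scalars_def)

lemma abelian_group_cong:
  assumes "abelian_group M" "carrier N = carrier M" "add N = add M" "zero N = zero M"
  shows "abelian_group N"
proof -
  interpret abelian_group M by fact
  show ?thesis
    by (rule abelian_groupI) (auto simp: assms(2,3,4) a_ac intro: bexI[of _ "\<ominus>\<^bsub>M\<^esub> _"] l_neg)
qed

lemma (in cring) ring_module_is_module: "module R (ring_module R)"
  by (rule moduleI[OF is_cring abelian_group_cong[OF abelian_group_axioms]])
    (auto simp: l_distr r_distr m_assoc)

lemma restrict_scalars_is_module:
  assumes "cring R" "module S M" "f \<in> ring_hom R S"
  shows "module R (restrict_scalars f M)"
proof -
  interpret M: module S M by fact
  note f = ring_hom_memE[OF assms(3)]
  show ?thesis
    by (rule moduleI[OF assms(1) abelian_group_cong[OF M.abelian_group_axioms]])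
      (auto simp: f M.smult_l_distr M.smult_r_distr M.smult_assoc1)
qed

section \<open>Direct products and Baer's criterion\<close>

definition dprod :: "('a, 'm) module \<Rightarrow> ('a, 'n) module \<Rightarrow> ('a, 'm \<times> 'n) module" where
  "dprod M N = \<lparr>carrier = carrier M \<times> carrier N, mult = undefined, one = undefined,
     zero = (\<zero>\<^bsub>M\<^esub>, \<zero>\<^bsub>N\<^esub>), add = (\<lambda>(x, y) (x', y'). (x \<oplus>\<^bsub>M\<^esub> x', y \<oplus>\<^bsub>N\<^esub> y')),
     smult = (\<lambda>a (x, y). (a \<odot>\<^bsub>M\<^esub> x, a \<odot>\<^bsub>N\<^esub> y))\<rparr>"

lemma dprod_simps [simp]:
  "carrier (dprod M N) = carrier M \<times> carrier N" "\<zero>\<^bsub>dprod M N\<^esub> = (\<zero>\<^bsub>M\<^esub>, \<zero>\<^bsub>N\<^esub>)"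
  "(x, y) \<oplus>\<^bsub>dprod M N\<^esub> (x', y') = (x \<oplus>\<^bsub>M\<^esub> x', y \<oplus>\<^bsub>N\<^esub> y')"
  "a \<odot>\<^bsub>dprod M N\<^esub> (x, y) = (a \<odot>\<^bsub>M\<^esub> x, a \<odot>\<^bsub>N\<^esub> y)"
  by (simp_all add: dprod_def)

lemma dprod_is_module:
  assumes "module R M" "module R N"
  shows "module R (dprod M N)"
proof -
  interpret M: module R M by fact
  interpret N: module R N by fact
  show ?thesis
  proof (rule moduleI)
    show "cring R" by (rule M.R.is_cring)
    show "abelian_group (dprod M N)"
    proof (rule abelian_groupI, goal_cases)
      case (6 x)
      then show ?case
        by (cases x) (auto intro!: bexI[of _ "(\<ominus>\<^bsub>M\<^esub> fst x, \<ominus>\<^bsub>N\<^esub> snd x)"] simp: M.l_neg N.l_neg)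
    qed (auto simp: M.a_ac N.a_ac)
  qed (auto simp: M.smult_l_distr M.smult_r_distr M.smult_assoc1
      N.smult_l_distr N.smult_r_distr N.smult_assoc1)
qed

text \<open>The condition in Baer's criterion, where an extension of \<open>g\<close> to the whole
  ring is encoded by its value \<open>y\<close> at one. Only ideals are quantified over, so no type
  of test modules is involved.\<close>

definition baer :: "('a, 'x) ring_scheme \<Rightarrow> ('a, 'e) module \<Rightarrow> bool" where
  "baer R E \<longleftrightarrow> module R E \<and>
     (\<forall>J g. ideal J R \<longrightarrow> g \<in> module_hom R ((ring_module R)\<lparr>carrier := J\<rparr>) E \<longrightarrow>
        (\<exists>y\<in>carrier E. \<forall>a\<in>J. g a = a \<odot>\<^bsub>E\<^esub> y))"

lemma (in cring) submodule_ideal: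
  assumes "ideal J R"
  shows "submodule J R (ring_module R)"
  using idealD[OF assms] by (intro submoduleI'[OF ring_module_is_module]) auto

lemma injective_module_imp_baer:
  assumes "injective_module R E"
  shows "baer R E"
proof -
  interpret E: module R E using assms by (simp add: injective_module_def)
  have "\<exists>y\<in>carrier E. \<forall>a\<in>J. g a = a \<odot>\<^bsub>E\<^esub> y"
    if J: "ideal J R" and g: "g \<in> module_hom R ((ring_module R)\<lparr>carrier := J\<rparr>) E" for J g
  proof -
    note JD = idealD[OF J]
    have m: "module R ((ring_module R)\<lparr>carrier := J\<rparr>)"
      by (rule submodule.submodule_is_module[OF E.R.submodule_ideal[OF J] E.R.ring_module_is_module])
    have i: "(\<lambda>x. x) \<in> module_hom R ((ring_module R)\<lparr>carrier := J\<rparr>) (ring_module R)"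
      using JD(1) by (intro module_homI) auto
    obtain h where h: "h \<in> module_hom R (ring_module R) E" "\<forall>x\<in>J. h x = g x"
    proof -
      have ext: "\<And>(A :: ('a, 'a) module) (B :: ('a, 'a) module) i g. module R A \<Longrightarrow> module R B \<Longrightarrow> i \<in> module_hom R A B \<Longrightarrow>
          inj_on i (carrier A) \<Longrightarrow> g \<in> module_hom R A E \<Longrightarrow>
          \<exists>h\<in>module_hom R B E. \<forall>x\<in>carrier A. h (i x) = g x"
        using assms unfolding injective_module_def by blast
      have "\<exists>h\<in>module_hom R (ring_module R) E. \<forall>x\<in>carrier ((ring_module R)\<lparr>carrier := J\<rparr>). h x = g x"
        using ext[OF m E.R.ring_module_is_module i _ g] by simp
      then show thesis using that by auto
    qed
    have "g a = a \<odot>\<^bsub>E\<^esub> h \<one>\<^bsub>R\<^esub>" if "a \<in> J" for a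
      using h module_homD(3)[OF h(1), of a "\<one>\<^bsub>R\<^esub>"] that JD(1) by (auto simp: subset_iff)
    moreover have "h \<one>\<^bsub>R\<^esub> \<in> carrier E" using module_homD(1)[OF h(1)] by simp
    ultimately show ?thesis by blast
  qed
  then show ?thesis unfolding baer_def using E.module_axioms by blast
qed

text \<open>Baer's criterion, for modules over arbitrary types: a maximal partial extension, viewed as a
  graph, is total.\<close>

lemma baer_extend:
  assumes "baer R E" "module R B0" "module R B"
    and "h \<in> module_hom R B0 B" "g0 \<in> module_hom R B0 E"
    and "\<And>x. x \<in> carrier B0 \<Longrightarrow> h x = \<zero>\<^bsub>B\<^esub> \<Longrightarrow> g0 x = \<zero>\<^bsub>E\<^esub>"
  obtains g where "g \<in> module_hom R B E" "\<And>x. x \<in> carrier B0 \<Longrightarrow> g (h x) = g0 x"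
proof -
  have Em: "module R E" using assms(1) by (simp add: baer_def)
  interpret E: module R E by fact
  interpret B0: module R B0 by fact
  interpret B: module R B by fact
  interpret P: module R "dprod B E" by (rule dprod_is_module[OF assms(3) Em])
  note h = module_homD[OF assms(4)] module_hom_zero[OF assms(2,3,4)]
  note g0 = module_homD[OF assms(5)] module_hom_zero[OF assms(2) Em assms(5)]
  \<comment> \<open>The members are graphs of partial homomorphisms, single-valuedness being the
    triviality of the fibre over zero. The map \<open>h\<close> may have a kernel; the initial graph
    is a member because \<open>g0\<close> vanishes on it.\<close>
  define \<G> where "\<G> = {G. submodule G R (dprod B E) \<and> (\<forall>y. (\<zero>\<^bsub>B\<^esub>, y) \<in> G \<longrightarrow> y = \<zero>\<^bsub>E\<^esub>) \<and>
    (\<forall>x\<in>carrier B0. (h x, g0 x) \<in> G)}"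
  have "(\<lambda>x. (h x, g0 x)) \<in> module_hom R B0 (dprod B E)"
    using h g0 by (intro module_homI) auto
  then have "submodule ((\<lambda>x. (h x, g0 x)) ` carrier B0) R (dprod B E)"
    by (rule submodule_image[OF assms(2) P.module_axioms _ submodule_self[OF assms(2)]])
  then have "(\<lambda>x. (h x, g0 x)) ` carrier B0 \<in> \<G>" unfolding \<G>_def using assms(6) by auto
  then have ne: "\<G> \<noteq> {}" by blast
  have "\<exists>G\<in>\<G>. \<forall>X\<in>\<G>. G \<subseteq> X \<longrightarrow> X = G"
  proof (rule subset_Zorn_nonempty[OF ne])
    fix \<C> assume C: "\<C> \<noteq> {}" "subset.chain \<G> \<C>"
    then obtain X0 where X0: "X0 \<in> \<C>" by auto
    have X: "submodule X R (dprod B E)" "\<And>y. (\<zero>\<^bsub>B\<^esub>, y) \<in> X \<Longrightarrow> y = \<zero>\<^bsub>E\<^esub>"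
      "\<And>x. x \<in> carrier B0 \<Longrightarrow> (h x, g0 x) \<in> X" if "X \<in> \<C>" for X
      using C(2) that by (auto simp: subset.chain_def \<G>_def)
    have "submodule (\<Union>\<C>) R (dprod B E)"
    proof (rule submoduleI'[OF P.module_axioms])
      show "\<Union>\<C> \<subseteq> carrier (dprod B E)" using P.submoduleE(1)[OF X(1)] by blast
      show "\<zero>\<^bsub>dprod B E\<^esub> \<in> \<Union>\<C>" using submodule_zero[OF X(1)] X0 by blast
      show "a \<oplus>\<^bsub>dprod B E\<^esub> b \<in> \<Union>\<C>" if ab: "a \<in> \<Union>\<C>" "b \<in> \<Union>\<C>" for a b
      proof -
        obtain X1 X2 where "a \<in> X1" "b \<in> X2" "X1 \<in> \<C>" "X2 \<in> \<C>" using ab by auto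
        moreover have "X1 \<subseteq> X2 \<or> X2 \<subseteq> X1"
          using C(2) calculation by (auto simp: subset.chain_def)
        ultimately obtain X' where "X' \<in> \<C>" "a \<in> X'" "b \<in> X'" by blast
        then show ?thesis using P.submoduleE(5)[OF X(1)] by blast
      qed
      show "r \<odot>\<^bsub>dprod B E\<^esub> x \<in> \<Union>\<C>" if "r \<in> carrier R" "x \<in> \<Union>\<C>" for r x
        using P.submoduleE(4)[OF X(1)] that by blast
    qed
    then show "\<Union>\<C> \<in> \<G>" using X X0 unfolding \<G>_def by blast
  qed
  then obtain G where G: "G \<in> \<G>" and max: "\<And>X. X \<in> \<G> \<Longrightarrow> G \<subseteq> X \<Longrightarrow> X = G" by blast
  have Gs: "submodule G R (dprod B E)" and G0: "\<And>y. (\<zero>\<^bsub>B\<^esub>, y) \<in> G \<Longrightarrow> y = \<zero>\<^bsub>E\<^esub>"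
    and Gh: "\<And>x. x \<in> carrier B0 \<Longrightarrow> (h x, g0 x) \<in> G" using G by (auto simp: \<G>_def)
  note GD = P.submoduleE[OF Gs] submodule_zero[OF Gs]
  have Gc: "x \<in> carrier B" "y \<in> carrier E" if "(x, y) \<in> G" for x y using GD(1) that by auto
  have Gadd: "(x \<oplus>\<^bsub>B\<^esub> x', y \<oplus>\<^bsub>E\<^esub> y') \<in> G" if "(x, y) \<in> G" "(x', y') \<in> G" for x y x' y'
    using GD(5)[OF that] by simp
  have Gsm: "(r \<odot>\<^bsub>B\<^esub> x, r \<odot>\<^bsub>E\<^esub> y) \<in> G" if "(x, y) \<in> G" "r \<in> carrier R" for x y r
    using GD(4)[OF that(2,1)] by simp
  have Gneg: "(\<ominus>\<^bsub>B\<^esub> x, \<ominus>\<^bsub>E\<^esub> y) \<in> G" if "(x, y) \<in> G" for x y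
    using Gsm[OF that, of "\<ominus>\<^bsub>R\<^esub> \<one>\<^bsub>R\<^esub>"] Gc[OF that] by (simp add: B.smult_l_minus E.smult_l_minus)
  have sv: "y = y'" if "(x, y) \<in> G" "(x, y') \<in> G" for x y y'
  proof -
    have "(x \<oplus>\<^bsub>B\<^esub> \<ominus>\<^bsub>B\<^esub> x, y \<oplus>\<^bsub>E\<^esub> \<ominus>\<^bsub>E\<^esub> y') \<in> G" using Gadd[OF that(1) Gneg[OF that(2)]] .
    then have "y \<ominus>\<^bsub>E\<^esub> y' = \<zero>\<^bsub>E\<^esub>" using G0 Gc[OF that(1)] by (simp add: B.r_neg E.minus_eq)
    then show ?thesis using E.M.minus_arith(6) Gc that by blast
  qed
  have total: "\<exists>y. (b, y) \<in> G" if b: "b \<in> carrier B" for b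
  proof -
    \<comment> \<open>The scalars that bring \<open>b\<close> into the domain of the graph. Baer's
      condition on this ideal yields the value \<open>y0\<close> that can be assigned to
      \<open>b\<close> consistently.\<close>
    define J where "J = {r \<in> carrier R. \<exists>y. (r \<odot>\<^bsub>B\<^esub> b, y) \<in> G}"
    define g where "g r = (THE y. (r \<odot>\<^bsub>B\<^esub> b, y) \<in> G)" for r
    have gI: "g r = y" if "(r \<odot>\<^bsub>B\<^esub> b, y) \<in> G" for r y
      unfolding g_def using that sv by blast
    have gG: "(r \<odot>\<^bsub>B\<^esub> b, g r) \<in> G" if "r \<in> J" for r
      using that gI by (auto simp: J_def)
    have J: "ideal J R"
    proof (rule E.R.idealI')
      show "\<zero>\<^bsub>R\<^esub> \<in> J" using GD(7) b by (auto simp: J_def)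
      show "r \<oplus>\<^bsub>R\<^esub> s \<in> J" if rs: "r \<in> J" "s \<in> J" for r s
        using Gadd[OF gG[OF rs(1)] gG[OF rs(2)]] rs b
        by (auto simp: J_def B.smult_l_distr)
      show "s \<otimes>\<^bsub>R\<^esub> r \<in> J" if rs: "r \<in> J" "s \<in> carrier R" for r s
        using Gsm[OF gG[OF rs(1)] rs(2)] rs b by (auto simp: J_def B.smult_assoc1)
    qed (auto simp: J_def)
    have "g \<in> module_hom R ((ring_module R)\<lparr>carrier := J\<rparr>) E"
    proof (rule module_homI; simp)
      show "g r \<in> carrier E" if "r \<in> J" for r using gG[OF that] Gc by blast
      show "g (r \<oplus>\<^bsub>R\<^esub> s) = g r \<oplus>\<^bsub>E\<^esub> g s" if rs: "r \<in> J" "s \<in> J" for r s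
        using Gadd[OF gG[OF rs(1)] gG[OF rs(2)]] rs b
        by (intro gI) (auto simp: J_def B.smult_l_distr)
      show "g (s \<otimes>\<^bsub>R\<^esub> r) = s \<odot>\<^bsub>E\<^esub> g r" if rs: "s \<in> carrier R" "r \<in> J" for r s
        using Gsm[OF gG[OF rs(2)] rs(1)] rs b by (intro gI) (auto simp: J_def B.smult_assoc1)
    qed
    then obtain y0 where y0: "y0 \<in> carrier E" "\<And>r. r \<in> J \<Longrightarrow> g r = r \<odot>\<^bsub>E\<^esub> y0"
      using assms(1) J unfolding baer_def by meson
    define L where "L = (\<lambda>((x, y), r). (x \<oplus>\<^bsub>B\<^esub> r \<odot>\<^bsub>B\<^esub> b, y \<oplus>\<^bsub>E\<^esub> r \<odot>\<^bsub>E\<^esub> y0))"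
    define G' where "G' = L ` (G \<times> carrier R)"
    have mG: "module R ((dprod B E)\<lparr>carrier := G\<rparr>)"
      by (rule submodule.submodule_is_module[OF Gs P.module_axioms])
    interpret Q: module R "dprod ((dprod B E)\<lparr>carrier := G\<rparr>) (ring_module R)"
      by (rule dprod_is_module[OF mG E.R.ring_module_is_module])
    have "L \<in> module_hom R (dprod ((dprod B E)\<lparr>carrier := G\<rparr>) (ring_module R)) (dprod B E)"
      by (rule module_homI)
        (auto simp: L_def y0 b Gc B.smult_l_distr E.smult_l_distr B.smult_r_distr E.smult_r_distr
          B.smult_assoc1 E.smult_assoc1 B.a_ac E.a_ac dest: Gc)
    from submodule_image[OF Q.module_axioms P.module_axioms this submodule_self[OF Q.module_axioms]]
    have "submodule G' R (dprod B E)" by (simp add: G'_def)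
    moreover have "y = \<zero>\<^bsub>E\<^esub>" if "(\<zero>\<^bsub>B\<^esub>, y) \<in> G'" for y
    proof -
      obtain u v r where r: "(u, v) \<in> G" "r \<in> carrier R" "\<zero>\<^bsub>B\<^esub> = u \<oplus>\<^bsub>B\<^esub> r \<odot>\<^bsub>B\<^esub> b"
        "y = v \<oplus>\<^bsub>E\<^esub> r \<odot>\<^bsub>E\<^esub> y0"
        using \<open>(\<zero>\<^bsub>B\<^esub>, y) \<in> G'\<close> by (auto simp: G'_def L_def)
      have c: "u \<in> carrier B" "v \<in> carrier E" using Gc r by auto
      \<comment> \<open>A point of \<open>G'\<close> over zero forces \<open>r\<close> into
        \<open>J\<close>, and there \<open>g r\<close> equals both \<open>- v\<close> and
        \<open>r y0\<close>.\<close>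
      have "r \<odot>\<^bsub>B\<^esub> b = \<ominus>\<^bsub>B\<^esub> u"
        using r(2,3) c b by (metis B.M.minus_equality B.a_comm B.smult_closed B.M.minus_minus)
      then have "(r \<odot>\<^bsub>B\<^esub> b, \<ominus>\<^bsub>E\<^esub> v) \<in> G" using Gneg[OF r(1)] by simp
      then have "r \<in> J" "g r = \<ominus>\<^bsub>E\<^esub> v" using gI r(2) by (auto simp: J_def)
      then have "r \<odot>\<^bsub>E\<^esub> y0 = \<ominus>\<^bsub>E\<^esub> v" using y0(2)[of r] by simp
      then show "y = \<zero>\<^bsub>E\<^esub>" using r c by (simp add: E.r_neg)
    qed
    moreover have GG': "G \<subseteq> G'"
    proof
      fix p assume p: "p \<in> G"
      have "L (p, \<zero>\<^bsub>R\<^esub>) = p" using Gc p b y0 by (cases p) (auto simp: L_def)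
      then show "p \<in> G'" unfolding G'_def using p by (metis E.R.zero_closed SigmaI image_eqI)
    qed
    ultimately have "G' = G" using Gh by (intro max) (auto simp: \<G>_def)
    moreover have "L ((\<zero>\<^bsub>B\<^esub>, \<zero>\<^bsub>E\<^esub>), \<one>\<^bsub>R\<^esub>) = (b, y0)" using b y0 by (simp add: L_def)
    then have "(b, y0) \<in> G'" unfolding G'_def using GD(7) by (metis E.R.one_closed SigmaI dprod_simps(2) image_eqI)
    ultimately show ?thesis by blast
  qed
  define g where "g x = (THE y. (x, y) \<in> G)" for x
  have gI: "g x = y" if "(x, y) \<in> G" for x y unfolding g_def using that sv by blast
  have gG: "(x, g x) \<in> G" if "x \<in> carrier B" for x using total[OF that] gI by auto
  have "g \<in> module_hom R B E"
  proof (rule module_homI)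
    show "g x \<in> carrier E" if "x \<in> carrier B" for x using gG[OF that] Gc by blast
    show "g (x \<oplus>\<^bsub>B\<^esub> y) = g x \<oplus>\<^bsub>E\<^esub> g y" if "x \<in> carrier B" "y \<in> carrier B" for x y
      using Gadd[OF gG[OF that(1)] gG[OF that(2)]] by (rule gI)
    show "g (r \<odot>\<^bsub>B\<^esub> x) = r \<odot>\<^bsub>E\<^esub> g x" if "r \<in> carrier R" "x \<in> carrier B" for r x
      using Gsm[OF gG[OF that(2)] that(1)] by (rule gI)
  qed
  then show thesis using that gI Gh by blast
qed

section \<open>Flasque modules\<close>

text \<open>An algebraic version of flasqueness: sections with support in \<open>Y\<close> on the complement of
  \<open>V(x)\<close> extend. In contrast to injectivity it is inherited under restriction of scalars.\<close>

definition flasque :: "('a, 'x) ring_scheme \<Rightarrow> ('a, 'm) module \<Rightarrow> 'm set \<Rightarrow> bool" where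
  "flasque R M K \<longleftrightarrow>
     (\<forall>Y x m. finite Y \<longrightarrow> Y \<subseteq> carrier R \<longrightarrow> x \<in> carrier R \<longrightarrow> m \<in> K \<inter> gam R Y M \<longrightarrow>
        (\<exists>m'\<in>K \<inter> gam R Y M. \<exists>k::nat. (x [^]\<^bsub>R\<^esub> Suc k) \<odot>\<^bsub>M\<^esub> m' = (x [^]\<^bsub>R\<^esub> k) \<odot>\<^bsub>M\<^esub> m))"

text \<open>The element \<open>m\<close> is divided by \<open>x\<close> only after multiplication by
  \<open>x^k\<close>, where \<open>k\<close> is such that \<open>x^(k+1)\<close> and
  \<open>x^k\<close> have the same annihilator in the ring. The element \<open>m'\<close> is the
  value at one of a homomorphism that sends \<open>x^(k+1)\<close> to \<open>x^k m\<close> and kills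
  an ideal \<open>Q\<close>. For \<open>m'\<close> to be torsion, \<open>Q\<close> has to contain a
  power of every \<open>y\<close> in \<open>Y\<close>; this is achieved by taking \<open>Q\<close>
  maximal.\<close>

lemma baer_divisible_mod_torsion:
  assumes N: "noetherian_ring S" and E: "baer S E" and Y: "Y \<subseteq> carrier S" and x: "x \<in> carrier S"
    and m: "m \<in> gam S Y E"
  obtains m' k where "m' \<in> gam S Y E" "(x [^]\<^bsub>S\<^esub> Suc k) \<odot>\<^bsub>E\<^esub> m' = (x [^]\<^bsub>S\<^esub> (k::nat)) \<odot>\<^bsub>E\<^esub> m"
proof -
  interpret E: module S E using E by (simp add: baer_def)
  interpret NR: noetherian_ring S by fact
  have mE: "m \<in> carrier E" using m by (simp add: gam_def)
  obtain k where k: "\<And>s. s \<in> carrier S \<Longrightarrow> x [^]\<^bsub>S\<^esub> Suc k \<otimes>\<^bsub>S\<^esub> s \<in> {\<zero>\<^bsub>S\<^esub>} \<Longrightarrow> x [^]\<^bsub>S\<^esub> k \<otimes>\<^bsub>S\<^esub> s \<in> {\<zero>\<^bsub>S\<^esub>}"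
    using E.R.colon_power_stabilises[OF N E.R.zeroideal x] by blast
  define A where "A = {a \<in> carrier S. a \<odot>\<^bsub>E\<^esub> m = \<zero>\<^bsub>E\<^esub>}"
  have A: "ideal A S" unfolding A_def by (rule E.ideal_annihilator[OF mE])
  note AD = idealD[OF A]
  define X where "X = x [^]\<^bsub>S\<^esub> Suc k"
  have X: "X \<in> carrier S" using x unfolding X_def by blast
  define C where "C = (\<lambda>a. X \<otimes>\<^bsub>S\<^esub> a) ` A"
  have C: "ideal C S"
  proof (rule E.R.idealI')
    show "C \<subseteq> carrier S" using AD(1) X by (auto simp: C_def)
    show "\<zero>\<^bsub>S\<^esub> \<in> C" using AD(2) X by (force simp: C_def)
    show "a \<oplus>\<^bsub>S\<^esub> b \<in> C" if "a \<in> C" "b \<in> C" for a b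
    proof -
      obtain a' b' where "a' \<in> A" "b' \<in> A" "a = X \<otimes>\<^bsub>S\<^esub> a'" "b = X \<otimes>\<^bsub>S\<^esub> b'"
        using \<open>a \<in> C\<close> \<open>b \<in> C\<close> by (auto simp: C_def)
      then show ?thesis unfolding C_def using AD(1,3) X
        by (intro image_eqI[of _ _ "a' \<oplus>\<^bsub>S\<^esub> b'"]) (auto simp: E.R.r_distr subset_iff)
    qed
    show "r \<otimes>\<^bsub>S\<^esub> a \<in> C" if "a \<in> C" "r \<in> carrier S" for a r
    proof -
      obtain a' where "a' \<in> A" "a = X \<otimes>\<^bsub>S\<^esub> a'" using \<open>a \<in> C\<close> by (auto simp: C_def)
      then show ?thesis unfolding C_def using AD(1,4) X \<open>r \<in> carrier S\<close>
        by (intro image_eqI[of _ _ "r \<otimes>\<^bsub>S\<^esub> a'"]) (auto simp: E.R.m_lcomm subset_iff)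
    qed
  qed
  \<comment> \<open>A maximal \<open>Q\<close> with \<open>Q \<inter> XS = C\<close> makes
    \<open>XS / C\<close> an essential submodule of \<open>S / Q\<close>. As an image of
    \<open>S / A\<close>, which is isomorphic to \<open>S m\<close>, the module
    \<open>XS / C\<close> is torsion for \<open>Y\<close>; torsion passes to essential extensions
    over a Noetherian ring.\<close>
  define \<Q> where "\<Q> = {Q. ideal Q S \<and> C \<subseteq> Q \<and> (\<forall>s\<in>carrier S. X \<otimes>\<^bsub>S\<^esub> s \<in> Q \<longrightarrow> X \<otimes>\<^bsub>S\<^esub> s \<in> C)}"
  obtain Q where Q: "Q \<in> \<Q>" and max: "\<And>J. J \<in> \<Q> \<Longrightarrow> Q \<subseteq> J \<Longrightarrow> J = Q"
    by (rule NR.exists_maximal_ideal_in[of \<Q>]) (use C in \<open>auto simp: \<Q>_def\<close>)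
  have Qi: "ideal Q S" "C \<subseteq> Q" "\<And>s. s \<in> carrier S \<Longrightarrow> X \<otimes>\<^bsub>S\<^esub> s \<in> Q \<Longrightarrow> X \<otimes>\<^bsub>S\<^esub> s \<in> C"
    using Q by (auto simp: \<Q>_def)
  note QD = idealD[OF Qi(1)]
  \<comment> \<open>Once \<open>(Q : y^(r+1)) = (Q : y^r)\<close>, adjoining \<open>y^r\<close> to
    \<open>Q\<close> creates no new multiples of \<open>X\<close>, so maximality puts
    \<open>y^r\<close> into \<open>Q\<close>.\<close>
  have yQ: "\<exists>r::nat. y [^]\<^bsub>S\<^esub> r \<in> Q" if y: "y \<in> Y" for y
  proof -
    have yc: "y \<in> carrier S" using y Y by auto
    obtain n :: nat where n: "(y [^]\<^bsub>S\<^esub> n) \<odot>\<^bsub>E\<^esub> m = \<zero>\<^bsub>E\<^esub>" using m y by (auto simp: gam_def)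
    obtain r :: nat where r: "\<And>s. s \<in> carrier S \<Longrightarrow> y [^]\<^bsub>S\<^esub> Suc r \<otimes>\<^bsub>S\<^esub> s \<in> Q \<Longrightarrow> y [^]\<^bsub>S\<^esub> r \<otimes>\<^bsub>S\<^esub> s \<in> Q"
      using E.R.colon_power_stabilises[OF N Qi(1) yc] by blast
    have rn: "y [^]\<^bsub>S\<^esub> r \<otimes>\<^bsub>S\<^esub> s \<in> Q" if "s \<in> carrier S" "y [^]\<^bsub>S\<^esub> (j + r) \<otimes>\<^bsub>S\<^esub> s \<in> Q" for s j
      using that
    proof (induction j arbitrary: s)
      case (Suc j)
      have "y [^]\<^bsub>S\<^esub> (Suc j + r) \<otimes>\<^bsub>S\<^esub> s = y [^]\<^bsub>S\<^esub> Suc r \<otimes>\<^bsub>S\<^esub> (y [^]\<^bsub>S\<^esub> j \<otimes>\<^bsub>S\<^esub> s)"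
        using yc Suc.prems(1)
        by (simp add: E.R.nat_pow_mult[symmetric] E.R.m_ac)
      then have "y [^]\<^bsub>S\<^esub> r \<otimes>\<^bsub>S\<^esub> (y [^]\<^bsub>S\<^esub> j \<otimes>\<^bsub>S\<^esub> s) \<in> Q" using r[of "y [^]\<^bsub>S\<^esub> j \<otimes>\<^bsub>S\<^esub> s"] Suc.prems yc by simp
      then have "y [^]\<^bsub>S\<^esub> (j + r) \<otimes>\<^bsub>S\<^esub> s \<in> Q"
        using yc Suc.prems(1) by (simp add: E.R.nat_pow_mult[symmetric] E.R.m_ac)
      then show ?case using Suc by blast
    qed simp
    define Q' where "Q' = {q \<oplus>\<^bsub>S\<^esub> s \<otimes>\<^bsub>S\<^esub> y [^]\<^bsub>S\<^esub> r | q s. q \<in> Q \<and> s \<in> carrier S}"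
    have Q': "ideal Q' S" "Q \<subseteq> Q'" "y [^]\<^bsub>S\<^esub> r \<in> Q'"
      unfolding Q'_def by (rule E.R.ideal_add_principal[OF Qi(1)], use yc in simp)+
    have "X \<otimes>\<^bsub>S\<^esub> t \<in> C" if t: "t \<in> carrier S" "X \<otimes>\<^bsub>S\<^esub> t \<in> Q'" for t
    proof -
      obtain q s where qs: "X \<otimes>\<^bsub>S\<^esub> t = q \<oplus>\<^bsub>S\<^esub> s \<otimes>\<^bsub>S\<^esub> y [^]\<^bsub>S\<^esub> r" "q \<in> Q" "s \<in> carrier S"
        using t by (auto simp: Q'_def)
      define u v where "u = y [^]\<^bsub>S\<^esub> n" "v = y [^]\<^bsub>S\<^esub> r"
      have c: "u \<in> carrier S" "v \<in> carrier S" "q \<in> carrier S" using yc qs QD(1) by (auto simp: u_v_def)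
      have "t \<otimes>\<^bsub>S\<^esub> u \<in> A"
        using n mE t c by (auto simp: A_def E.smult_assoc1 u_v_def)
      then have "X \<otimes>\<^bsub>S\<^esub> (t \<otimes>\<^bsub>S\<^esub> u) \<in> Q" using Qi(2) by (auto simp: C_def)
      then have "X \<otimes>\<^bsub>S\<^esub> (t \<otimes>\<^bsub>S\<^esub> u) \<ominus>\<^bsub>S\<^esub> u \<otimes>\<^bsub>S\<^esub> q \<in> Q" using QD(4)[of q u] QD(6) qs c by blast
      also have "X \<otimes>\<^bsub>S\<^esub> (t \<otimes>\<^bsub>S\<^esub> u) = u \<otimes>\<^bsub>S\<^esub> (X \<otimes>\<^bsub>S\<^esub> t)"
        using c t X by (simp add: E.R.m_ac)
      also have "X \<otimes>\<^bsub>S\<^esub> t = q \<oplus>\<^bsub>S\<^esub> s \<otimes>\<^bsub>S\<^esub> v"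
        using qs(1) by (simp add: u_v_def)
      also have "u \<otimes>\<^bsub>S\<^esub> (q \<oplus>\<^bsub>S\<^esub> s \<otimes>\<^bsub>S\<^esub> v) \<ominus>\<^bsub>S\<^esub> u \<otimes>\<^bsub>S\<^esub> q = (u \<otimes>\<^bsub>S\<^esub> v) \<otimes>\<^bsub>S\<^esub> s"
        using c qs(3) by algebra
      also have "u \<otimes>\<^bsub>S\<^esub> v = y [^]\<^bsub>S\<^esub> (n + r)" using yc by (simp add: u_v_def E.R.nat_pow_mult)
      finally have "v \<otimes>\<^bsub>S\<^esub> s \<in> Q" using rn qs(3) by (simp add: u_v_def)
      then have "X \<otimes>\<^bsub>S\<^esub> t \<in> Q" using qs QD(3) c by (simp add: u_v_def E.R.m_comm)
      then show ?thesis using Qi(3) t by blast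
    qed
    then have "Q' \<in> \<Q>" using Q' Qi(2) unfolding \<Q>_def by blast
    then have "Q' = Q" using max Q'(2) by blast
    then show ?thesis using Q'(3) by blast
  qed
  interpret RM: module S "ring_module S" by (rule E.R.ring_module_is_module)
  have mQ: "module S ((ring_module S)\<lparr>carrier := Q\<rparr>)"
    by (rule submodule.submodule_is_module[OF E.R.submodule_ideal[OF Qi(1)] RM.module_axioms])
  \<comment> \<open>The product of \<open>Q\<close> and \<open>S\<close> covers the ideal
    \<open>Q + XS\<close>. The map \<open>q + Xs \<mapsto> x^k s m\<close> on this ideal is given
    upstairs, and its well-definedness becomes the kernel condition of
    \<open>baer_extend\<close>.\<close>
  define h where "h = (\<lambda>(q, s). q \<oplus>\<^bsub>S\<^esub> X \<otimes>\<^bsub>S\<^esub> s)"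
  define g0 where "g0 = (\<lambda>(q :: 'a, s). (x [^]\<^bsub>S\<^esub> k \<otimes>\<^bsub>S\<^esub> s) \<odot>\<^bsub>E\<^esub> m)"
  let ?P = "dprod ((ring_module S)\<lparr>carrier := Q\<rparr>) (ring_module S)"
  have hh: "h \<in> module_hom S ?P (ring_module S)"
    using QD(1) X
    by (intro module_homI) (auto simp: h_def subset_iff E.R.r_distr E.R.m_ac E.R.a_ac)
  have xk: "x [^]\<^bsub>S\<^esub> k \<in> carrier S" using x by simp
  have g0h: "g0 \<in> module_hom S ?P E"
    using mE xk
    by (intro module_homI)
      (auto simp: g0_def E.R.r_distr E.smult_l_distr E.smult_assoc1[symmetric] E.R.m_ac)
  \<comment> \<open>If \<open>q + Xs = 0\<close>, then \<open>Xs\<close> lies in \<open>Q\<close>,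
    hence \<open>Xs = Xa\<close> for some \<open>a\<close> killing \<open>m\<close>. The choice of
    \<open>k\<close> turns \<open>X(s - a) = 0\<close> into \<open>x^k (s - a) = 0\<close>.\<close>
  have ker: "g0 p = \<zero>\<^bsub>E\<^esub>" if "p \<in> carrier ?P" "h p = \<zero>\<^bsub>ring_module S\<^esub>" for p
  proof -
    obtain q s where p: "p = (q, s)" by (cases p)
    have qs: "q \<in> Q" "s \<in> carrier S" "q \<oplus>\<^bsub>S\<^esub> X \<otimes>\<^bsub>S\<^esub> s = \<zero>\<^bsub>S\<^esub>" using that by (auto simp: p h_def)
    then have "X \<otimes>\<^bsub>S\<^esub> s = \<zero>\<^bsub>S\<^esub> \<ominus>\<^bsub>S\<^esub> q"
      using QD(1) X E.R.minus_arith(5)[of "X \<otimes>\<^bsub>S\<^esub> s" q] by (simp add: subset_iff E.R.a_comm)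
    then have "X \<otimes>\<^bsub>S\<^esub> s \<in> Q" using QD(2,6) qs(1) by simp
    then have "X \<otimes>\<^bsub>S\<^esub> s \<in> C" using Qi(3) qs by blast
    then obtain a where a: "a \<in> A" "X \<otimes>\<^bsub>S\<^esub> s = X \<otimes>\<^bsub>S\<^esub> a" by (auto simp: C_def)
    have ac: "a \<in> carrier S" using a AD(1) by auto
    have "X \<otimes>\<^bsub>S\<^esub> (s \<ominus>\<^bsub>S\<^esub> a) = X \<otimes>\<^bsub>S\<^esub> s \<ominus>\<^bsub>S\<^esub> X \<otimes>\<^bsub>S\<^esub> a"
      using X qs(2) ac by algebra
    then have "X \<otimes>\<^bsub>S\<^esub> (s \<ominus>\<^bsub>S\<^esub> a) = \<zero>\<^bsub>S\<^esub>" using a(2) X ac by (simp add: E.R.minus_arith)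
    then have "x [^]\<^bsub>S\<^esub> k \<otimes>\<^bsub>S\<^esub> (s \<ominus>\<^bsub>S\<^esub> a) = \<zero>\<^bsub>S\<^esub>" using k[of "s \<ominus>\<^bsub>S\<^esub> a"] qs(2) ac by (simp add: X_def)
    moreover have "x [^]\<^bsub>S\<^esub> k \<otimes>\<^bsub>S\<^esub> s = x [^]\<^bsub>S\<^esub> k \<otimes>\<^bsub>S\<^esub> (s \<ominus>\<^bsub>S\<^esub> a) \<oplus>\<^bsub>S\<^esub> x [^]\<^bsub>S\<^esub> k \<otimes>\<^bsub>S\<^esub> a"
      using xk qs(2) ac by algebra
    ultimately have "x [^]\<^bsub>S\<^esub> k \<otimes>\<^bsub>S\<^esub> s = x [^]\<^bsub>S\<^esub> k \<otimes>\<^bsub>S\<^esub> a" using xk ac by simp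
    then show ?thesis using a xk mE ac by (simp add: p g0_def E.smult_assoc1) (simp add: A_def)
  qed
  obtain g where g: "g \<in> module_hom S (ring_module S) E" "\<And>p. p \<in> carrier ?P \<Longrightarrow> g (h p) = g0 p"
    using baer_extend[OF E dprod_is_module[OF mQ RM.module_axioms] RM.module_axioms hh g0h ker] by blast
  have gc: "g \<one>\<^bsub>S\<^esub> \<in> carrier E" using module_homD(1)[OF g(1)] by simp
  have gs: "s \<odot>\<^bsub>E\<^esub> g \<one>\<^bsub>S\<^esub> = g s" if "s \<in> carrier S" for s
    using module_homD(3)[OF g(1), of s "\<one>\<^bsub>S\<^esub>"] that by simp
  have "q \<odot>\<^bsub>E\<^esub> g \<one>\<^bsub>S\<^esub> = \<zero>\<^bsub>E\<^esub>" if q: "q \<in> Q" for q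
    using g(2)[of "(q, \<zero>\<^bsub>S\<^esub>)"] gs[of q] q QD(1) X xk mE by (auto simp: h_def g0_def subset_iff)
  then have "g \<one>\<^bsub>S\<^esub> \<in> gam S Y E" using yQ gc by (fastforce simp: gam_def)
  moreover have "(x [^]\<^bsub>S\<^esub> Suc k) \<odot>\<^bsub>E\<^esub> g \<one>\<^bsub>S\<^esub> = (x [^]\<^bsub>S\<^esub> k) \<odot>\<^bsub>E\<^esub> m"
    using g(2)[of "(\<zero>\<^bsub>S\<^esub>, \<one>\<^bsub>S\<^esub>)"] gs[of X] X QD(2) xk by (simp add: h_def g0_def X_def)
  ultimately show thesis using that by blast
qed

lemma ring_hom_nat_pow:
  assumes "cring R" "f \<in> ring_hom R S" "x \<in> carrier R"
  shows "f (x [^]\<^bsub>R\<^esub> (n :: nat)) = f x [^]\<^bsub>S\<^esub> n"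
proof -
  interpret cring R by fact
  show ?thesis
    using ring_hom_mult[OF assms(2)] ring_hom_one[OF assms(2)] assms(3) by (induction n) auto
qed

lemma gam_restrict_scalars:
  assumes "cring R" "cring S" "f \<in> ring_hom R S" "Y \<subseteq> carrier R"
  shows "gam R Y (restrict_scalars f M) = gam S (f ` Y) M"
proof -
  have "f (y [^]\<^bsub>R\<^esub> n) = f y [^]\<^bsub>S\<^esub> n" if "y \<in> Y" for y and n :: nat
    using that assms(4) by (intro ring_hom_nat_pow[OF assms(1,3)]) auto
  then show ?thesis by (auto simp: gam_def)
qed

text \<open>Elements of \<open>R\<close> act on the restricted module through \<open>f\<close>, so
  the condition over \<open>R\<close> for \<open>Y\<close> and \<open>x\<close> is the condition
  over \<open>S\<close> for their images.\<close>

lemma flasque_restrict_scalars: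
  assumes "cring R" "noetherian_ring S" "f \<in> ring_hom R S" "baer S E"
  shows "flasque R (restrict_scalars f E) (carrier E)"
  unfolding flasque_def
proof (intro allI impI)
  interpret E: module S E using assms(4) by (simp add: baer_def)
  fix Y x m
  assume Y: "finite Y" "Y \<subseteq> carrier R" and x: "x \<in> carrier R"
    and m: "m \<in> carrier E \<inter> gam R Y (restrict_scalars f E)"
  note g = gam_restrict_scalars[OF assms(1) E.R.is_cring assms(3) Y(2), of E]
  have fp: "f (x [^]\<^bsub>R\<^esub> n) = f x [^]\<^bsub>S\<^esub> n" for n :: nat
    by (rule ring_hom_nat_pow[OF assms(1,3) x])
  have fx: "f x \<in> carrier S" "f ` Y \<subseteq> carrier S"
    using ring_hom_closed[OF assms(3)] x Y by auto
  obtain m' and k :: nat where "m' \<in> gam S (f ` Y) E"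
    "(f x [^]\<^bsub>S\<^esub> Suc k) \<odot>\<^bsub>E\<^esub> m' = (f x [^]\<^bsub>S\<^esub> k) \<odot>\<^bsub>E\<^esub> m"
    by (rule baer_divisible_mod_torsion[OF assms(2,4), of "f ` Y" "f x" m])
      (use fx m g in auto)
  then show "\<exists>m'\<in>carrier E \<inter> gam R Y (restrict_scalars f E). \<exists>k.
      (x [^]\<^bsub>R\<^esub> Suc k) \<odot>\<^bsub>restrict_scalars f E\<^esub> m' = (x [^]\<^bsub>R\<^esub> k) \<odot>\<^bsub>restrict_scalars f E\<^esub> m"
    using g gam_subset[of S "f ` Y" E]
    by (intro bexI[of _ m'] exI[of _ k]) (auto simp: fp simp del: nat_pow_Suc Group.nat_pow_Suc)
qed

lemma baer_imp_flasque:
  assumes "noetherian_ring R" "baer R E"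
  shows "flasque R E (carrier E)"
  unfolding flasque_def
proof (intro allI impI)
  fix Y x m
  assume Y: "finite Y" "Y \<subseteq> carrier R" and x: "x \<in> carrier R"
    and m: "m \<in> carrier E \<inter> gam R Y E"
  then obtain m' and k :: nat where "m' \<in> gam R Y E"
    "(x [^]\<^bsub>R\<^esub> Suc k) \<odot>\<^bsub>E\<^esub> m' = (x [^]\<^bsub>R\<^esub> k) \<odot>\<^bsub>E\<^esub> m"
    using baer_divisible_mod_torsion[OF assms Y(2) x] by blast
  then show "\<exists>m'\<in>carrier E \<inter> gam R Y E. \<exists>k. (x [^]\<^bsub>R\<^esub> Suc k) \<odot>\<^bsub>E\<^esub> m' = (x [^]\<^bsub>R\<^esub> k) \<odot>\<^bsub>E\<^esub> m"
    using gam_subset[of R Y E] by blast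
qed

text \<open>Division by \<open>x\<close> is iterated; the powers of \<open>x\<close> that have to be
  multiplied in at each step accumulate in \<open>k\<close>.\<close>

lemma flasque_power:
  assumes "module R M" "K \<subseteq> carrier M" "flasque R M K" "finite Y" "Y \<subseteq> carrier R" "x \<in> carrier R"
    and "m \<in> K \<inter> gam R Y M"
  shows "\<exists>m'\<in>K \<inter> gam R Y M. \<exists>k::nat. (x [^]\<^bsub>R\<^esub> (n + k)) \<odot>\<^bsub>M\<^esub> m' = (x [^]\<^bsub>R\<^esub> k) \<odot>\<^bsub>M\<^esub> m"
proof (induction n)
  case 0
  then show ?case using assms(7) by auto
next
  case (Suc n)
  interpret M: module R M by fact
  obtain m1 and k :: nat where m1: "m1 \<in> K \<inter> gam R Y M"
    "(x [^]\<^bsub>R\<^esub> (n + k)) \<odot>\<^bsub>M\<^esub> m1 = (x [^]\<^bsub>R\<^esub> k) \<odot>\<^bsub>M\<^esub> m"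
    using Suc by blast
  obtain m2 and j :: nat where m2: "m2 \<in> K \<inter> gam R Y M"
    "(x [^]\<^bsub>R\<^esub> Suc j) \<odot>\<^bsub>M\<^esub> m2 = (x [^]\<^bsub>R\<^esub> j) \<odot>\<^bsub>M\<^esub> m1"
    using assms(3-6) m1(1) unfolding flasque_def by blast
  have c: "m \<in> carrier M" "m1 \<in> carrier M" "m2 \<in> carrier M" using assms(2,7) m1 m2 by auto
  have split: "(x [^]\<^bsub>R\<^esub> (a + b)) \<odot>\<^bsub>M\<^esub> u = (x [^]\<^bsub>R\<^esub> a) \<odot>\<^bsub>M\<^esub> ((x [^]\<^bsub>R\<^esub> b) \<odot>\<^bsub>M\<^esub> u)"
    if "u \<in> carrier M" for a b :: nat and u
    using that assms(6) by (simp add: M.R.nat_pow_mult[symmetric] M.smult_assoc1)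
  have "(x [^]\<^bsub>R\<^esub> (Suc n + (k + j))) \<odot>\<^bsub>M\<^esub> m2 = (x [^]\<^bsub>R\<^esub> ((n + k) + Suc j)) \<odot>\<^bsub>M\<^esub> m2"
    by (simp only: add_Suc add_Suc_right add.assoc)
  also have "\<dots> = (x [^]\<^bsub>R\<^esub> (n + k)) \<odot>\<^bsub>M\<^esub> ((x [^]\<^bsub>R\<^esub> j) \<odot>\<^bsub>M\<^esub> m1)"
    by (simp only: split[OF c(3)] m2(2))
  also have "\<dots> = (x [^]\<^bsub>R\<^esub> j) \<odot>\<^bsub>M\<^esub> ((x [^]\<^bsub>R\<^esub> (n + k)) \<odot>\<^bsub>M\<^esub> m1)"
    by (simp only: split[OF c(2), symmetric] add.commute)
  also have "\<dots> = (x [^]\<^bsub>R\<^esub> (k + j)) \<odot>\<^bsub>M\<^esub> m"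
    unfolding m1(2) split[OF c(1), symmetric] by (simp only: add.commute)
  finally show ?case using m2(1) by blast
qed

lemma gam_empty [simp]: "gam R {} M = carrier M"
  by (auto simp: gam_def)

lemma gam_insert: "gam R (insert x Y) M = gam R Y M \<inter> gam R {x} M"
  by (auto simp: gam_def)

text \<open>Induction over the generators. Let \<open>b\<close> be a lift that is torsion for
  \<open>Y\<close>, and \<open>x^n c = 0\<close> for a new generator \<open>x\<close>. Then
  \<open>x^n b\<close> lies in the kernel, flasqueness of the kernel divides it by
  \<open>x^n\<close> up to a power of \<open>x\<close>, and subtracting the quotient
  \<open>a'\<close> from \<open>b\<close> makes the lift torsion for \<open>x\<close> too.\<close>

lemma flasque_kernel_lift:
  assumes B: "module R B" and C: "module R C" and h: "h \<in> module_hom R B C"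
    and K: "flasque R B {x \<in> carrier B. h x = \<zero>\<^bsub>C\<^esub>}"
    and Y: "finite Y" "Y \<subseteq> carrier R" and c: "c \<in> gam R Y C" "c \<in> h ` carrier B"
  shows "\<exists>b\<in>gam R Y B. h b = c"
  using Y c(1)
proof (induction Y)
  case empty
  then show ?case using c(2) by auto
next
  case (insert x Y)
  interpret B: module R B by fact
  interpret C: module R C by fact
  let ?K = "{x \<in> carrier B. h x = \<zero>\<^bsub>C\<^esub>}"
  note hD = module_homD[OF h]
  have Y: "Y \<subseteq> carrier R" and x: "x \<in> carrier R" using insert by auto
  have cY: "c \<in> gam R Y C" "c \<in> gam R {x} C" using insert.prems(2) gam_insert[of R x Y C] by auto
  then obtain b where b: "b \<in> gam R Y B" "h b = c" using insert.IH Y by blast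
  have bc: "b \<in> carrier B" using b gam_subset[of R Y B] by blast
  obtain n :: nat where n: "(x [^]\<^bsub>R\<^esub> n) \<odot>\<^bsub>C\<^esub> c = \<zero>\<^bsub>C\<^esub>" using cY(2) by (auto simp: gam_def)
  define a where "a = (x [^]\<^bsub>R\<^esub> n) \<odot>\<^bsub>B\<^esub> b"
  have "a \<in> ?K \<inter> gam R Y B"
    using bc x n b hD(3)[of "x [^]\<^bsub>R\<^esub> n" b] B.submoduleE(4)[OF submodule_gam[OF B Y]]
    by (auto simp: a_def)
  then obtain a' and k :: nat where a': "a' \<in> ?K \<inter> gam R Y B"
    "(x [^]\<^bsub>R\<^esub> (n + k)) \<odot>\<^bsub>B\<^esub> a' = (x [^]\<^bsub>R\<^esub> k) \<odot>\<^bsub>B\<^esub> a"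
    using flasque_power[OF B _ K insert(1) Y x] by blast
  have a'c: "a' \<in> carrier B" using a' by auto
  have "(x [^]\<^bsub>R\<^esub> (n + k)) \<odot>\<^bsub>B\<^esub> b = (x [^]\<^bsub>R\<^esub> k) \<odot>\<^bsub>B\<^esub> a"
    using bc x by (simp add: a_def B.smult_assoc1[symmetric] B.R.nat_pow_mult add.commute)
  then have "(x [^]\<^bsub>R\<^esub> (n + k)) \<odot>\<^bsub>B\<^esub> (b \<ominus>\<^bsub>B\<^esub> a') = \<zero>\<^bsub>B\<^esub>"
    using a'(2) bc a'c x by (metis B.smult_minus B.M.minus_arith(2) B.smult_closed B.R.nat_pow_closed)
  then have "b \<ominus>\<^bsub>B\<^esub> a' \<in> gam R {x} B" using bc a'c by (auto simp: gam_def)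
  moreover have "b \<ominus>\<^bsub>B\<^esub> a' \<in> gam R Y B"
    using submodule_minus[OF B submodule_gam[OF B Y] b(1)] a' by blast
  moreover have "h (b \<ominus>\<^bsub>B\<^esub> a') = c"
    using module_hom_minus[OF B C h bc a'c] a' b hD(1)[OF bc] by (simp add: C.M.minus_arith)
  ultimately show ?case using gam_insert[of R x Y B] by blast
qed

text \<open>As the kernel is flasque, torsion elements of the image lift to torsion elements of
  \<open>B\<close>, and the division by \<open>x\<close> is carried out there.\<close>

lemma flasque_image:
  assumes B: "module R B" and C: "module R C" and h: "h \<in> module_hom R B C"
    and K: "flasque R B {x \<in> carrier B. h x = \<zero>\<^bsub>C\<^esub>}" and fB: "flasque R B (carrier B)"
  shows "flasque R C (h ` carrier B)"
  unfolding flasque_def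
proof (intro allI impI)
  note hD = module_homD[OF h]
  interpret B: module R B by fact
  fix Y x m
  assume Y: "finite Y" "Y \<subseteq> carrier R" and x: "x \<in> carrier R" and m: "m \<in> h ` carrier B \<inter> gam R Y C"
  then obtain b where b: "b \<in> gam R Y B" "h b = m" using flasque_kernel_lift[OF B C h K Y] by blast
  then have "b \<in> carrier B \<inter> gam R Y B" using gam_subset[of R Y B] by blast
  then obtain b' and k :: nat where b': "b' \<in> carrier B \<inter> gam R Y B"
    "(x [^]\<^bsub>R\<^esub> Suc k) \<odot>\<^bsub>B\<^esub> b' = (x [^]\<^bsub>R\<^esub> k) \<odot>\<^bsub>B\<^esub> b"
    using fB Y x unfolding flasque_def by blast
  have p: "x [^]\<^bsub>R\<^esub> j \<in> carrier R" for j :: nat using x by simp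
  have "(x [^]\<^bsub>R\<^esub> Suc k) \<odot>\<^bsub>C\<^esub> h b' = (x [^]\<^bsub>R\<^esub> k) \<odot>\<^bsub>C\<^esub> m"
    using arg_cong[OF b'(2), of h] hD(3)[OF p, of b'] hD(3)[OF p, of b] b b' gam_subset[of R Y B]
    by (metis IntD1 subsetD)
  moreover have "h b' \<in> h ` carrier B \<inter> gam R Y C" using b' gam_hom[OF B C h Y(2)] by blast
  ultimately show "\<exists>m'\<in>h ` carrier B \<inter> gam R Y C. \<exists>k. (x [^]\<^bsub>R\<^esub> Suc k) \<odot>\<^bsub>C\<^esub> m' = (x [^]\<^bsub>R\<^esub> k) \<odot>\<^bsub>C\<^esub> m"
    by blast
qed

text \<open>Boundedness below starts an induction showing that every kernel is flasque: the first
  one is zero, and each later one is the image of a map with flasque kernel. Then torsion cocycles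
  have torsion preimages.\<close>

lemma flasque_exact_gam:
  fixes C :: "nat \<Rightarrow> ('a, 'm) module"
  assumes m: "\<And>i. module R (C i)" and fl: "\<And>i. flasque R (C i) (carrier (C i))"
    and d: "\<And>i. d i \<in> module_hom R (C i) (C (Suc i))"
    and inj: "\<And>x. x \<in> carrier (C 0) \<Longrightarrow> d 0 x = \<zero>\<^bsub>C (Suc 0)\<^esub> \<Longrightarrow> x = \<zero>\<^bsub>C 0\<^esub>"
    and ex: "\<And>i. {x \<in> carrier (C (Suc i)). d (Suc i) x = \<zero>\<^bsub>C (Suc (Suc i))\<^esub>} = d i ` carrier (C i)"
    and Y: "finite Y" "Y \<subseteq> carrier R"
    and c: "c \<in> gam R Y (C (Suc i))" "d (Suc i) c = \<zero>\<^bsub>C (Suc (Suc i))\<^esub>"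
  shows "\<exists>b\<in>gam R Y (C i). d i b = c"
proof -
  interpret C0: module R "C 0" by (rule m)
  have K: "flasque R (C i) {x \<in> carrier (C i). d i x = \<zero>\<^bsub>C (Suc i)\<^esub>}" for i
  proof (induction i)
    case 0
    have "{x \<in> carrier (C 0). d 0 x = \<zero>\<^bsub>C (Suc 0)\<^esub>} = {\<zero>\<^bsub>C 0\<^esub>}"
      using inj module_hom_zero[OF m m d] by auto
    moreover have "flasque R (C 0) {\<zero>\<^bsub>C 0\<^esub>}"
      unfolding flasque_def by auto
    ultimately show ?case by simp
  next
    case (Suc i)
    show ?case unfolding ex by (rule flasque_image[OF m m d Suc fl])
  qed
  have "c \<in> d i ` carrier (C i)" using c ex[of i] gam_subset[of R Y "C (Suc i)"] by blast
  then show ?thesis by (rule flasque_kernel_lift[OF m m d K Y c(1)])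
qed

text \<open>Only exactness is demanded, so that injective resolutions over \<open>R\<close> and
  restrictions of injective resolutions over \<open>S\<close> are both covered.\<close>

definition resolution ::
    "('a, 'x) ring_scheme \<Rightarrow> ('a, 'm) module \<Rightarrow> ('a, 'e) cochain \<Rightarrow> ('m \<Rightarrow> 'e) \<Rightarrow> bool" where
  "resolution R M E \<epsilon> \<longleftrightarrow>
     module R M \<and> (\<forall>i. module R (obj E i)) \<and>
     (\<forall>i. dmap E i \<in> module_hom R (obj E i) (obj E (Suc i))) \<and>
     \<epsilon> \<in> module_hom R M (obj E 0) \<and> inj_on \<epsilon> (carrier M) \<and>
     \<epsilon> ` carrier M = {x \<in> carrier (obj E 0). dmap E 0 x = \<zero>\<^bsub>obj E (Suc 0)\<^esub>} \<and>
     (\<forall>i. dmap E i ` carrier (obj E i) =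
        {x \<in> carrier (obj E (Suc i)). dmap E (Suc i) x = \<zero>\<^bsub>obj E (Suc (Suc i))\<^esub>})"

lemma resolutionD:
  assumes "resolution R M E \<epsilon>"
  shows "module R M" "\<And>i. module R (obj E i)"
    "\<And>i. dmap E i \<in> module_hom R (obj E i) (obj E (Suc i))"
    "\<epsilon> \<in> module_hom R M (obj E 0)" "inj_on \<epsilon> (carrier M)"
    "\<epsilon> ` carrier M = {x \<in> carrier (obj E 0). dmap E 0 x = \<zero>\<^bsub>obj E (Suc 0)\<^esub>}"
    "\<And>i. dmap E i ` carrier (obj E i) =
      {x \<in> carrier (obj E (Suc i)). dmap E (Suc i) x = \<zero>\<^bsub>obj E (Suc (Suc i))\<^esub>}"
    "\<And>i x. x \<in> carrier (obj E i) \<Longrightarrow> dmap E (Suc i) (dmap E i x) = \<zero>\<^bsub>obj E (Suc (Suc i))\<^esub>"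
proof -
  show r: "module R M" "\<And>i. module R (obj E i)"
    "\<And>i. dmap E i \<in> module_hom R (obj E i) (obj E (Suc i))"
    "\<epsilon> \<in> module_hom R M (obj E 0)" "inj_on \<epsilon> (carrier M)"
    "\<epsilon> ` carrier M = {x \<in> carrier (obj E 0). dmap E 0 x = \<zero>\<^bsub>obj E (Suc 0)\<^esub>}"
    "\<And>i. dmap E i ` carrier (obj E i) =
      {x \<in> carrier (obj E (Suc i)). dmap E (Suc i) x = \<zero>\<^bsub>obj E (Suc (Suc i))\<^esub>}"
    using assms by (auto simp: resolution_def)
  show "dmap E (Suc i) (dmap E i x) = \<zero>\<^bsub>obj E (Suc (Suc i))\<^esub>" if "x \<in> carrier (obj E i)" for i x
    using r(7)[of i] that by blast
qed

section \<open>Chain maps and mapping cones\<close>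

definition chain_map ::
    "('a, 'x) ring_scheme \<Rightarrow> ('a, 'e) cochain \<Rightarrow> ('a, 'g) cochain \<Rightarrow> (nat \<Rightarrow> 'e \<Rightarrow> 'g) \<Rightarrow> bool" where
  "chain_map R E G \<phi> \<longleftrightarrow> (\<forall>i. \<phi> i \<in> module_hom R (obj E i) (obj G i)) \<and>
     (\<forall>i. \<forall>x\<in>carrier (obj E i). \<phi> (Suc i) (dmap E i x) = dmap G i (\<phi> i x))"

lemma chain_mapD:
  assumes "chain_map R E G \<phi>"
  shows "\<And>i. \<phi> i \<in> module_hom R (obj E i) (obj G i)"
    "\<And>i x. x \<in> carrier (obj E i) \<Longrightarrow> \<phi> (Suc i) (dmap E i x) = dmap G i (\<phi> i x)"
  using assms by (auto simp: chain_map_def)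

lemma chain_map_comp:
  assumes "chain_map R E G \<phi>" "chain_map R G H \<psi>"
  shows "chain_map R E H (\<lambda>i x. \<psi> i (\<phi> i x))"
  using module_hom_comp[OF chain_mapD(1)[OF assms(1)] chain_mapD(1)[OF assms(2)]]
    chain_mapD(2)[OF assms(1)] chain_mapD(2)[OF assms(2)] module_homD(1)[OF chain_mapD(1)[OF assms(1)]]
  by (simp add: chain_map_def)

text \<open>The term of degree \<open>i - 1\<close> and the differential leaving it, with \<open>0\<close> in degree \<open>-1\<close>, so that
  coboundaries need no case distinction in degree \<open>0\<close>.\<close>

definition shift_obj :: "('a, 'g) cochain \<Rightarrow> nat \<Rightarrow> ('a, 'g) module" where
  "shift_obj G i = (case i of 0 \<Rightarrow> (obj G 0)\<lparr>carrier := {\<zero>\<^bsub>obj G 0\<^esub>}\<rparr> | Suc j \<Rightarrow> obj G j)"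

definition shift_dmap :: "('a, 'g) cochain \<Rightarrow> nat \<Rightarrow> 'g \<Rightarrow> 'g" where
  "shift_dmap G i = (case i of 0 \<Rightarrow> (\<lambda>x. x) | Suc j \<Rightarrow> dmap G j)"

lemma shift_simps [simp]:
  "shift_obj G 0 = (obj G 0)\<lparr>carrier := {\<zero>\<^bsub>obj G 0\<^esub>}\<rparr>" "shift_obj G (Suc i) = obj G i"
  "shift_dmap G 0 = (\<lambda>x. x)" "shift_dmap G (Suc i) = dmap G i"
  by (simp_all add: shift_obj_def shift_dmap_def)

lemma shift_properties:
  assumes "resolution R L G \<epsilon>'"
  shows "module R (shift_obj G i)" "shift_dmap G i \<in> module_hom R (shift_obj G i) (obj G i)"
    "\<And>x. x \<in> carrier (shift_obj G i) \<Longrightarrow> dmap G i (shift_dmap G i x) = \<zero>\<^bsub>obj G (Suc i)\<^esub>"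
    "flasque R (obj G (i - 1)) (carrier (obj G (i - 1))) \<Longrightarrow> flasque R (shift_obj G i) (carrier (shift_obj G i))"
proof -
  note r = resolutionD[OF assms]
  interpret G0: module R "obj G 0" by (rule r(2))
  have s: "submodule {\<zero>\<^bsub>obj G 0\<^esub>} R (obj G 0)" by (rule submoduleI'[OF r(2)]) auto
  note m0 = submodule.submodule_is_module[OF s r(2)]
  show "module R (shift_obj G i)" using r(2) m0 by (cases i) auto
  show "shift_dmap G i \<in> module_hom R (shift_obj G i) (obj G i)"
    using r(3) by (cases i) (auto intro: module_homI)
  show "dmap G i (shift_dmap G i x) = \<zero>\<^bsub>obj G (Suc i)\<^esub>" if "x \<in> carrier (shift_obj G i)" for x
    using r(8) that module_hom_zero[OF r(2) r(2) r(3)] by (cases i) auto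
  \<comment> \<open>For \<open>i = 0\<close> the truncated difference \<open>i - 1\<close> is again
    \<open>0\<close>, and the claim is that the zero module is flasque.\<close>
  show "flasque R (obj G (i - 1)) (carrier (obj G (i - 1))) \<Longrightarrow> flasque R (shift_obj G i) (carrier (shift_obj G i))"
    by (cases i) (auto simp: flasque_def gam_def)
qed

lemma gam_dprod:
  assumes "module R M" "module R N" "Y \<subseteq> carrier R"
  shows "gam R Y (dprod M N) = gam R Y M \<times> gam R Y N"
proof -
  interpret M: module R M by fact
  interpret N: module R N by fact
  have "\<exists>n::nat. (y [^]\<^bsub>R\<^esub> n) \<odot>\<^bsub>M\<^esub> a = \<zero>\<^bsub>M\<^esub> \<and> (y [^]\<^bsub>R\<^esub> n) \<odot>\<^bsub>N\<^esub> b = \<zero>\<^bsub>N\<^esub>"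
    if y: "y \<in> Y" and a: "a \<in> gam R Y M" and b: "b \<in> gam R Y N" for y a b
  proof -
    obtain n k :: nat where "(y [^]\<^bsub>R\<^esub> n) \<odot>\<^bsub>M\<^esub> a = \<zero>\<^bsub>M\<^esub>" "(y [^]\<^bsub>R\<^esub> k) \<odot>\<^bsub>N\<^esub> b = \<zero>\<^bsub>N\<^esub>"
      using y a b unfolding gam_def by blast
    then have "(y [^]\<^bsub>R\<^esub> max n k) \<odot>\<^bsub>M\<^esub> a = \<zero>\<^bsub>M\<^esub>" "(y [^]\<^bsub>R\<^esub> max n k) \<odot>\<^bsub>N\<^esub> b = \<zero>\<^bsub>N\<^esub>"
      using M.smult_pow_mono N.smult_pow_mono y assms(3) a b by (auto simp: gam_def)
    then show ?thesis by blast
  qed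
  moreover have "a \<in> gam R Y M \<and> b \<in> gam R Y N" if "(a, b) \<in> gam R Y (dprod M N)" for a b
    using that by (fastforce simp: gam_def)
  ultimately show ?thesis by (fastforce simp: gam_def)
qed

lemma flasque_dprod:
  assumes M: "module R M" and N: "module R N"
    and fM: "flasque R M (carrier M)" and fN: "flasque R N (carrier N)"
  shows "flasque R (dprod M N) (carrier (dprod M N))"
  unfolding flasque_def
proof (intro allI impI)
  interpret M: module R M by fact
  interpret N: module R N by fact
  fix Y x m
  assume Y: "finite Y" "Y \<subseteq> carrier R" and x: "x \<in> carrier R"
    and m: "m \<in> carrier (dprod M N) \<inter> gam R Y (dprod M N)"
  note g = gam_dprod[OF M N Y(2)]
  obtain a b where ab: "m = (a, b)" "a \<in> carrier M \<inter> gam R Y M" "b \<in> carrier N \<inter> gam R Y N"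
    using m g by (cases m) auto
  obtain a' and k :: nat where a': "a' \<in> carrier M \<inter> gam R Y M"
    "(x [^]\<^bsub>R\<^esub> Suc k) \<odot>\<^bsub>M\<^esub> a' = (x [^]\<^bsub>R\<^esub> k) \<odot>\<^bsub>M\<^esub> a"
    using fM Y x ab(2) unfolding flasque_def by blast
  obtain b' and j :: nat where b': "b' \<in> carrier N \<inter> gam R Y N"
    "(x [^]\<^bsub>R\<^esub> Suc j) \<odot>\<^bsub>N\<^esub> b' = (x [^]\<^bsub>R\<^esub> j) \<odot>\<^bsub>N\<^esub> b"
    using fN Y x ab(3) unfolding flasque_def by blast
  have p: "x [^]\<^bsub>R\<^esub> i \<in> carrier R" for i :: nat using x by simp
  have 1: "(x [^]\<^bsub>R\<^esub> (Suc (k + j))) \<odot>\<^bsub>M\<^esub> a' = (x [^]\<^bsub>R\<^esub> (k + j)) \<odot>\<^bsub>M\<^esub> a"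
  proof -
    have "(x [^]\<^bsub>R\<^esub> (j + Suc k)) \<odot>\<^bsub>M\<^esub> a' = (x [^]\<^bsub>R\<^esub> j) \<odot>\<^bsub>M\<^esub> ((x [^]\<^bsub>R\<^esub> Suc k) \<odot>\<^bsub>M\<^esub> a')"
      using M.smult_assoc1[OF p[of j] p[of "Suc k"], of a'] a' M.R.nat_pow_mult[OF x, of j "Suc k"] by simp
    also have "\<dots> = (x [^]\<^bsub>R\<^esub> (j + k)) \<odot>\<^bsub>M\<^esub> a"
      using M.smult_assoc1[OF p[of j] p[of k], of a] ab M.R.nat_pow_mult[OF x, of j k]
      by (simp only: a'(2)) simp
    finally show ?thesis by (simp only: add_Suc_right add.commute)
  qed
  have 2: "(x [^]\<^bsub>R\<^esub> (Suc (k + j))) \<odot>\<^bsub>N\<^esub> b' = (x [^]\<^bsub>R\<^esub> (k + j)) \<odot>\<^bsub>N\<^esub> b"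
  proof -
    have "(x [^]\<^bsub>R\<^esub> (k + Suc j)) \<odot>\<^bsub>N\<^esub> b' = (x [^]\<^bsub>R\<^esub> k) \<odot>\<^bsub>N\<^esub> ((x [^]\<^bsub>R\<^esub> Suc j) \<odot>\<^bsub>N\<^esub> b')"
      using N.smult_assoc1[OF p[of k] p[of "Suc j"], of b'] b' M.R.nat_pow_mult[OF x, of k "Suc j"] by simp
    also have "\<dots> = (x [^]\<^bsub>R\<^esub> (k + j)) \<odot>\<^bsub>N\<^esub> b"
      using N.smult_assoc1[OF p[of k] p[of j], of b] ab M.R.nat_pow_mult[OF x, of k j]
      by (simp only: b'(2)) simp
    finally show ?thesis by (simp only: add_Suc_right)
  qed
  show "\<exists>m'\<in>carrier (dprod M N) \<inter> gam R Y (dprod M N). \<exists>k.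
      (x [^]\<^bsub>R\<^esub> Suc k) \<odot>\<^bsub>dprod M N\<^esub> m' = (x [^]\<^bsub>R\<^esub> k) \<odot>\<^bsub>dprod M N\<^esub> m"
    using a' b' 1 2 g ab(1)
    by (intro bexI[of _ "(a', b')"] exI[of _ "k + j"]) (simp_all only: dprod_simps Int_iff mem_Times_iff fst_conv snd_conv)
qed

text \<open>The mapping cone of a quasi-isomorphism between flasque resolutions is an exact complex of
  flasque modules, hence stays exact when sections with support are taken.\<close>

lemma cone_gam_exact:
  fixes E :: "('a, 'e) cochain" and G :: "('a, 'g) cochain"
  assumes rE: "resolution R K E \<epsilon>" and rG: "resolution R L G \<epsilon>'"
    and fE: "\<And>i. flasque R (obj E i) (carrier (obj E i))"
    and fG: "\<And>i. flasque R (obj G i) (carrier (obj G i))"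
    and \<phi>: "chain_map R E G \<phi>" and \<alpha>: "bij_betw \<alpha> (carrier K) (carrier L)"
    and \<phi>\<epsilon>: "\<And>x. x \<in> carrier K \<Longrightarrow> \<phi> 0 (\<epsilon> x) = \<epsilon>' (\<alpha> x)"
    and Y: "finite Y" "Y \<subseteq> carrier R"
  shows "\<And>i e g. e \<in> gam R Y (obj E (Suc i)) \<Longrightarrow> g \<in> gam R Y (obj G i) \<Longrightarrow>
      dmap E (Suc i) e = \<zero>\<^bsub>obj E (Suc (Suc i))\<^esub> \<Longrightarrow> \<phi> (Suc i) e = dmap G i g \<Longrightarrow>
      \<exists>e'\<in>gam R Y (obj E i). \<exists>g'\<in>gam R Y (shift_obj G i).
        dmap E i e' = e \<and> \<phi> i e' \<ominus>\<^bsub>obj G i\<^esub> shift_dmap G i g' = g"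
    and "\<And>e. e \<in> carrier (obj E 0) \<Longrightarrow> dmap E 0 e = \<zero>\<^bsub>obj E (Suc 0)\<^esub> \<Longrightarrow> \<phi> 0 e = \<zero>\<^bsub>obj G 0\<^esub> \<Longrightarrow>
      e = \<zero>\<^bsub>obj E 0\<^esub>"
proof -
  note E = resolutionD[OF rE] and G = resolutionD[OF rG] and c = chain_mapD[OF \<phi>]
  note sh = shift_properties[OF rG]
  note d = module_homD[OF E(3)] and dG = module_homD[OF G(3)] and p = module_homD[OF c(1)]
    and s = module_homD[OF sh(2)]
  have z: "\<zero>\<^bsub>obj E i\<^esub> \<in> carrier (obj E i)" "\<zero>\<^bsub>obj G i\<^esub> \<in> carrier (obj G i)" for i
    using submodule_zero[OF submodule_self[OF E(2)]] submodule_zero[OF submodule_self[OF G(2)]] by auto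
  \<comment> \<open>The cone starts in degree zero, so exactness there means injectivity, which
    comes from that of \<open>\<epsilon>'\<close> and \<open>\<alpha>\<close>.\<close>
  show e0: "e = \<zero>\<^bsub>obj E 0\<^esub>" if e: "e \<in> carrier (obj E 0)" "dmap E 0 e = \<zero>\<^bsub>obj E (Suc 0)\<^esub>"
    "\<phi> 0 e = \<zero>\<^bsub>obj G 0\<^esub>" for e
  proof -
    obtain k where k: "k \<in> carrier K" "e = \<epsilon> k" using E(6) e by blast
    interpret K: module R K by (rule E(1))
    have "\<epsilon>' (\<alpha> k) = \<epsilon>' (\<alpha> \<zero>\<^bsub>K\<^esub>)"
      using \<phi>\<epsilon>[OF k(1)] \<phi>\<epsilon>[of "\<zero>\<^bsub>K\<^esub>"] e k module_hom_zero[OF E(1) E(2) E(4)]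
        module_hom_zero[OF E(2) G(2) c(1)] by simp
    then have "\<alpha> k = \<alpha> \<zero>\<^bsub>K\<^esub>"
      by (rule inj_onD[OF G(5)]) (use \<alpha> k(1) in \<open>auto simp: bij_betw_def\<close>)
    then have "k = \<zero>\<^bsub>K\<^esub>"
      by (rule inj_onD[OF bij_betw_imp_inj_on[OF \<alpha>]]) (use k(1) in auto)
    then show ?thesis using k module_hom_zero[OF E(1) E(2) E(4)] by simp
  qed
  \<comment> \<open>The cone of \<open>\<phi>\<close>, indexed so that \<open>G\<close> enters one
    degree lower than \<open>E\<close>. With a difference in its second component, \<open>cd\<close>
    squares to zero because \<open>\<phi>\<close> commutes with the differentials.\<close>
  define C where "C i = dprod (obj E i) (shift_obj G i)" for i
  define cd where "cd i = (\<lambda>(e, g). (dmap E i e, \<phi> i e \<ominus>\<^bsub>obj G i\<^esub> shift_dmap G i g))" for i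
  have mC: "module R (C i)" for i unfolding C_def by (rule dprod_is_module[OF E(2) sh(1)])
  have fC: "flasque R (C i) (carrier (C i))" for i
    unfolding C_def by (rule flasque_dprod[OF E(2) sh(1) fE sh(4)[OF fG]])
  have cdh: "cd i \<in> module_hom R (C i) (C (Suc i))" for i
  proof -
    interpret Gi: module R "obj G i" by (rule G(2))
    have "(a \<oplus>\<^bsub>obj G i\<^esub> b) \<ominus>\<^bsub>obj G i\<^esub> (u \<oplus>\<^bsub>obj G i\<^esub> v) = (a \<ominus>\<^bsub>obj G i\<^esub> u) \<oplus>\<^bsub>obj G i\<^esub> (b \<ominus>\<^bsub>obj G i\<^esub> v)"
      if "a \<in> carrier (obj G i)" "b \<in> carrier (obj G i)" "u \<in> carrier (obj G i)" "v \<in> carrier (obj G i)"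
      for a b u v
      using that by (simp add: Gi.minus_eq Gi.minus_add Gi.a_ac)
    then show ?thesis
      by (intro module_homI) (auto simp: C_def cd_def d p s Gi.smult_minus)
  qed
  have inj: "x = \<zero>\<^bsub>C 0\<^esub>" if x: "x \<in> carrier (C 0)" "cd 0 x = \<zero>\<^bsub>C (Suc 0)\<^esub>" for x
  proof -
    interpret G0: module R "obj G 0" by (rule G(2))
    obtain e where "x = (e, \<zero>\<^bsub>obj G 0\<^esub>)" "e \<in> carrier (obj E 0)" using x by (auto simp: C_def)
    then show ?thesis using e0[of e] x p(1)[of e 0] by (auto simp: C_def cd_def G0.M.minus_arith)
  qed
  have ex: "{x \<in> carrier (C (Suc i)). cd (Suc i) x = \<zero>\<^bsub>C (Suc (Suc i))\<^esub>} = cd i ` carrier (C i)" for i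
  proof -
    interpret Gi: module R "obj G i" by (rule G(2))
    interpret Gs: module R "obj G (Suc i)" by (rule G(2))
    have "cd i x \<in> {x \<in> carrier (C (Suc i)). cd (Suc i) x = \<zero>\<^bsub>C (Suc (Suc i))\<^esub>}"
      if x: "x \<in> carrier (C i)" for x
    proof -
      obtain e g where eg: "x = (e, g)" "e \<in> carrier (obj E i)" "g \<in> carrier (shift_obj G i)"
        using x by (auto simp: C_def)
      have "dmap G i (\<phi> i e \<ominus>\<^bsub>obj G i\<^esub> shift_dmap G i g) = dmap G i (\<phi> i e)"
        using module_hom_minus[OF G(2) G(2) G(3)[of i] p(1)[OF eg(2)] s(1)[OF eg(3)]] sh(3)[OF eg(3)]
          dG(1)[OF p(1)[OF eg(2)]] by (simp add: Gs.M.minus_arith)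
      then have "cd (Suc i) (cd i x) = \<zero>\<^bsub>C (Suc (Suc i))\<^esub>"
        using eg c(2)[OF eg(2)] E(8)[OF eg(2)] dG(1)[OF p(1)[OF eg(2)]]
        by (simp add: C_def cd_def Gs.M.minus_arith)
      then show ?thesis using module_homD(1)[OF cdh x] by simp
    qed
    moreover have "x \<in> cd i ` carrier (C i)"
      if x: "x \<in> carrier (C (Suc i))" "cd (Suc i) x = \<zero>\<^bsub>C (Suc (Suc i))\<^esub>" for x
    proof -
      obtain e g where eg: "x = (e, g)" "e \<in> carrier (obj E (Suc i))" "g \<in> carrier (obj G i)"
        using x by (auto simp: C_def)
      have de: "dmap E (Suc i) e = \<zero>\<^bsub>obj E (Suc (Suc i))\<^esub>" and
        pe: "\<phi> (Suc i) e = dmap G i g"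
        using x eg Gs.M.minus_arith(6)[OF p(1)[OF eg(2)] dG(1)[OF eg(3)]] by (auto simp: C_def cd_def)
      obtain e0 where e0: "e0 \<in> carrier (obj E i)" "e = dmap E i e0" using E(7) de eg(2) by blast
      \<comment> \<open>The amount by which \<open>(e0, 0)\<close> fails to be a preimage of
        \<open>(e, g)\<close>; it is a cocycle of \<open>G\<close>. In degree zero it comes from
        \<open>L\<close>, hence through \<open>\<alpha>\<close> from \<open>K\<close>, and
        \<open>e0\<close> is modified accordingly. In higher degrees it is a coboundary and supplies
        the second component.\<close>
      define w where "w = \<phi> i e0 \<ominus>\<^bsub>obj G i\<^esub> g"
      have w: "w \<in> carrier (obj G i)" using p(1)[OF e0(1)] eg(3) by (simp add: w_def)
      have "dmap G i w = \<zero>\<^bsub>obj G (Suc i)\<^esub>"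
        using module_hom_minus[OF G(2) G(2) G(3)[of i] p(1)[OF e0(1)] eg(3)] c(2)[OF e0(1)] e0 pe
          dG(1)[OF eg(3)] by (simp add: w_def Gs.M.minus_arith)
      then have "\<exists>e1\<in>carrier (obj E i). \<exists>g'\<in>carrier (shift_obj G i).
          dmap E i e1 = e \<and> \<phi> i e1 \<ominus>\<^bsub>obj G i\<^esub> shift_dmap G i g' = g"
      proof (cases i)
        case 0
        interpret E0: module R "obj E 0" by (rule E(2))
        interpret E1: module R "obj E (Suc 0)" by (rule E(2))
        obtain l where "l \<in> carrier L" "w = \<epsilon>' l"
          using G(6) w \<open>dmap G i w = _\<close> 0 by blast
        moreover obtain k where k': "k \<in> carrier K" "l = \<alpha> k"
          using calculation(1) \<alpha> unfolding bij_betw_def by blast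
        ultimately have k: "k \<in> carrier K" "w = \<phi> 0 (\<epsilon> k)" using \<phi>\<epsilon> by auto
        have ek: "\<epsilon> k \<in> carrier (obj E 0)" "dmap E 0 (\<epsilon> k) = \<zero>\<^bsub>obj E (Suc 0)\<^esub>" using E(6) k by blast+
        have e0': "e0 \<in> carrier (obj E 0)" using e0 0 by simp
        let ?e1 = "e0 \<ominus>\<^bsub>obj E 0\<^esub> \<epsilon> k"
        have "dmap E 0 ?e1 = e"
          using module_hom_minus[OF E(2) E(2) E(3)[of 0] e0' ek(1)] ek e0 0 d(1)[OF e0']
          by (simp add: E1.M.minus_arith)
        moreover have "\<phi> 0 ?e1 = g"
          using module_hom_minus[OF E(2) G(2) c(1)[of 0] e0' ek(1)] k 0 p(1)[OF e0(1)] eg(3)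
            Gi.M.minus_arith(7)[OF p(1)[OF e0(1)] eg(3)] by (simp add: w_def)
        ultimately show ?thesis
          using 0 e0' ek Gi.M.minus_arith(1)[OF eg(3)] eg(3) by (intro bexI[of _ ?e1]) auto
      next
        case (Suc j)
        obtain g' where g': "g' \<in> carrier (obj G j)" "w = dmap G j g'"
          using G(7)[of j] w \<open>dmap G i w = _\<close> Suc by blast
        have "\<phi> i e0 \<ominus>\<^bsub>obj G i\<^esub> w = g"
          using Gi.M.minus_arith(7) p(1)[OF e0(1)] eg(3) by (simp add: w_def)
        then show ?thesis using e0 g' Suc by (intro bexI[of _ e0] bexI[of _ g']) auto
      qed
      then show ?thesis unfolding eg(1) by (force simp: C_def cd_def)
    qed
    ultimately show ?thesis by blast
  qed
  fix i e g
  assume e: "e \<in> gam R Y (obj E (Suc i))" and g: "g \<in> gam R Y (obj G i)" and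
    de: "dmap E (Suc i) e = \<zero>\<^bsub>obj E (Suc (Suc i))\<^esub>" and pe: "\<phi> (Suc i) e = dmap G i g"
  interpret Gs: module R "obj G (Suc i)" by (rule G(2))
  have "(e, g) \<in> gam R Y (C (Suc i))"
    unfolding C_def gam_dprod[OF E(2) sh(1) Y(2)] using e g by simp
  moreover have "cd (Suc i) (e, g) = \<zero>\<^bsub>C (Suc (Suc i))\<^esub>"
    using de pe dG(1)[of g i] g gam_subset[of R Y "obj G i"]
    by (auto simp: C_def cd_def Gs.M.minus_arith)
  ultimately obtain b where "b \<in> gam R Y (C i)" "cd i b = (e, g)"
    using flasque_exact_gam[OF mC fC cdh inj ex Y] by blast
  then show "\<exists>e'\<in>gam R Y (obj E i). \<exists>g'\<in>gam R Y (shift_obj G i).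
        dmap E i e' = e \<and> \<phi> i e' \<ominus>\<^bsub>obj G i\<^esub> shift_dmap G i g' = g"
    unfolding C_def gam_dprod[OF E(2) sh(1) Y(2)] by (auto simp: cd_def)
qed

section \<open>Characters of abelian groups\<close>

lemma int_ideal_multiples:
  fixes J :: "int set"
  assumes "0 \<in> J" "\<And>a b. a \<in> J \<Longrightarrow> b \<in> J \<Longrightarrow> a + b \<in> J" "\<And>a k. a \<in> J \<Longrightarrow> k * a \<in> J"
  obtains n where "n \<ge> 0" "\<And>a. a \<in> J \<longleftrightarrow> n dvd a"
proof (cases "J = {0}")
  case True
  then show ?thesis using that[of 0] by auto
next
  case False
  then obtain a where a: "a \<in> J" "a \<noteq> 0" using assms(1) by auto
  then have "\<bar>a\<bar> \<in> J" using assms(3)[of a "sgn a"] by (simp add: abs_sgn mult.commute)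
  then have ex: "\<exists>m. m > 0 \<and> int m \<in> J" using a by (intro exI[of _ "nat \<bar>a\<bar>"]) auto
  define m where "m = (LEAST m. m > 0 \<and> int m \<in> J)"
  have m: "m > 0" "int m \<in> J" using LeastI_ex[OF ex] by (auto simp: m_def)
  have "int m dvd b" if b: "b \<in> J" for b
  proof (rule ccontr)
    assume "\<not> int m dvd b"
    then have "b mod int m \<noteq> 0" by (metis dvd_eq_mod_eq_0)
    then have p: "b mod int m > 0" using pos_mod_sign[of "int m" b] m(1) by linarith
    have "b + (- (b div int m)) * int m \<in> J" by (rule assms(2)[OF b assms(3)[OF m(2)]])
    then have "b mod int m \<in> J" by (simp add: minus_div_mult_eq_mod[symmetric])
    then have "m \<le> nat (b mod int m)" using p unfolding m_def by (intro Least_le) auto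
    then show False using m(1) by (metis nat_mono_iff p pos_mod_bound nat_int not_le of_nat_0_less_iff)
  qed
  then show ?thesis using that[of "int m"] assms(3) m by (metis dvdE mult.commute of_nat_0_le_iff)
qed

text \<open>The group \<real>/\<int> in multiplicative form. It is divisible and contains elements
  of every finite order, which gives injectivity over \<int> and the separation of points by
  characters.\<close>

definition circle :: "(int, complex) module" where
  "circle = \<lparr>carrier = {z. cmod z = 1}, mult = undefined, one = undefined, zero = 1, add = (*),
     smult = (\<lambda>k z. z powi k)\<rparr>"

lemma circle_simps [simp]:
  "carrier circle = {z. cmod z = 1}" "\<zero>\<^bsub>circle\<^esub> = 1" "x \<oplus>\<^bsub>circle\<^esub> y = x * y" "k \<odot>\<^bsub>circle\<^esub> z = z powi k"
  by (simp_all add: circle_def)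

lemma circle_is_module: "module int_ring circle"
proof (rule moduleI[OF int_is_cring])
  show "abelian_group circle"
    by (rule abelian_groupI)
      (auto simp: norm_mult norm_inverse intro!: exI[of _ "inverse _"] left_inverse)
next
  fix a b :: int and x
  show "(a \<otimes>\<^bsub>int_ring\<^esub> b) \<odot>\<^bsub>circle\<^esub> x = a \<odot>\<^bsub>circle\<^esub> (b \<odot>\<^bsub>circle\<^esub> x)"
    by (simp add: power_int_mult[symmetric] mult.commute)
qed (auto simp: norm_power_int power_int_mult_distrib intro!: power_int_add)

text \<open>An ideal of \<int> is generated by some \<open>n \<ge> 0\<close>. For
  \<open>n \<noteq> 0\<close>, extending \<open>g\<close> amounts to finding an \<open>n\<close>-th
  root of \<open>g n\<close>, which is done by dividing the argument by \<open>n\<close>.\<close>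

lemma baer_circle: "baer int_ring circle"
  unfolding baer_def
proof (intro conjI allI impI circle_is_module)
  fix J g
  assume J: "ideal J int_ring" and g: "g \<in> module_hom int_ring ((ring_module int_ring)\<lparr>carrier := J\<rparr>) circle"
  note JD = idealD[OF J]
  obtain n where n: "n \<ge> 0" "\<And>a. a \<in> J \<longleftrightarrow> n dvd a"
    by (rule int_ideal_multiples[of J]) (use JD in auto)
  have gk: "g (k * n) = g n powi k" "cmod (g n) = 1" for k
    using module_homD[OF g] n by auto
  show "\<exists>y\<in>carrier circle. \<forall>a\<in>J. g a = a \<odot>\<^bsub>circle\<^esub> y"
  proof (cases "n = 0")
    case True
    then show ?thesis using gk(1)[of 0] n by (intro bexI[of _ 1]) auto
  next
    case False
    define y where "y = cis (Arg (g n) / of_int n)"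
    have "y powi n = cis (Arg (g n))" using False by (simp add: y_def cis_power_int)
    also have "\<dots> = g n" using gk(2) by (subst cis_Arg) (auto simp: sgn_div_norm)
    finally have y: "y powi n = g n" .
    have "g a = y powi a" if a: "a \<in> J" for a
    proof -
      obtain k where "a = n * k" using n(2)[of a] a by auto
      then have "g a = (y powi n) powi k" using gk(1)[of k] y by (simp add: mult.commute)
      then show ?thesis using \<open>a = n * k\<close> by (simp only: power_int_mult)
    qed
    then show ?thesis by (intro bexI[of _ y]) (auto simp: y_def)
  qed
qed

definition int_module :: "('b, 'x) ring_scheme \<Rightarrow> (int, 'b) module" where
  "int_module A = \<lparr>carrier = carrier A, mult = undefined, one = undefined, zero = \<zero>\<^bsub>A\<^esub>, add = add A,
     smult = add_pow A\<rparr>"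

lemma int_module_simps [simp]:
  "carrier (int_module A) = carrier A" "zero (int_module A) = \<zero>\<^bsub>A\<^esub>" "add (int_module A) = add A"
  "smult (int_module A) = add_pow A"
  by (simp_all add: int_module_def)

lemma int_module_is_module:
  assumes "abelian_group A"
  shows "module int_ring (int_module A)"
proof -
  interpret abelian_group A by fact
  show ?thesis
    by (rule moduleI[OF int_is_cring abelian_group_cong[OF assms]])
      (auto simp: add.int_pow_mult add.int_pow_pow add.int_pow_mult_distrib a_comm mult.commute)
qed

definition character :: "('b, 'x) ring_scheme \<Rightarrow> ('b \<Rightarrow> complex) \<Rightarrow> bool" where
  "character A \<chi> \<longleftrightarrow> (\<forall>x\<in>carrier A. cmod (\<chi> x) = 1) \<and>
     (\<forall>x\<in>carrier A. \<forall>y\<in>carrier A. \<chi> (x \<oplus>\<^bsub>A\<^esub> y) = \<chi> x * \<chi> y)"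

lemma character_iff_module_hom:
  assumes "abelian_group A"
  shows "character A \<chi> \<longleftrightarrow> \<chi> \<in> module_hom int_ring (int_module A) circle"
proof
  interpret A: abelian_group A by fact
  assume c: "character A \<chi>"
  have nz: "\<chi> x \<noteq> 0" if "x \<in> carrier A" for x using c that unfolding character_def by fastforce
  have z: "\<chi> \<zero>\<^bsub>A\<^esub> = 1"
    using c nz[of "\<zero>\<^bsub>A\<^esub>"] unfolding character_def by (metis A.l_zero A.zero_closed mult_cancel_right1)
  have pn: "\<chi> (add_pow A (int n) x) = \<chi> x powi int n" if x: "x \<in> carrier A" for n x
  proof (induction n)
    case 0
    then show ?case using z by (simp add: add_pow_int_ge)
  next
    case (Suc n)
    have "add_pow A (int (Suc n)) x = add_pow A (int n) x \<oplus>\<^bsub>A\<^esub> x"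
      using A.add.int_pow_mult[OF x, of "int n" 1] x by (simp add: add.commute)
    then show ?case using Suc c x nz[OF x] unfolding character_def
      by (simp add: power_int_add add.commute)
  qed
  have "\<chi> (add_pow A k x) = \<chi> x powi k" if x: "x \<in> carrier A" for k x
  proof (cases "k \<ge> 0")
    case True
    then show ?thesis using pn[OF x, of "nat k"] by simp
  next
    case False
    have "\<chi> (add_pow A k x) * \<chi> (add_pow A (- k) x) = \<chi> (add_pow A k x \<oplus>\<^bsub>A\<^esub> add_pow A (- k) x)"
      using c x unfolding character_def by simp
    also have "\<dots> = 1" using A.add.int_pow_mult[OF x, of k "- k"] z x by (simp add: add_pow_int_ge)
    finally have "\<chi> (add_pow A k x) * \<chi> x powi (- k) = 1" using pn[OF x, of "nat (- k)"] False by simp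
    then show ?thesis using nz[OF x] by (simp add: power_int_minus field_simps)
  qed
  then show "\<chi> \<in> module_hom int_ring (int_module A) circle"
    using c by (intro module_homI) (auto simp: character_def)
next
  assume "\<chi> \<in> module_hom int_ring (int_module A) circle"
  from module_homD[OF this] show "character A \<chi>" by (simp add: character_def)
qed

text \<open>Injectivity of the circle over \<int>, applied to the inclusion of
  \<open>H\<close>.\<close>

lemma character_extend:
  assumes "abelian_group A" "subgroup H (add_monoid A)" "character (A\<lparr>carrier := H\<rparr>) \<psi>"
  obtains \<chi> where "character A \<chi>" "\<And>x. x \<in> H \<Longrightarrow> \<chi> x = \<psi> x"
proof -
  interpret A: abelian_group A by fact
  have Hc: "x \<in> carrier A" if "x \<in> H" for x using subgroup.subset[OF assms(2)] that by auto
  have H: "abelian_group (A\<lparr>carrier := H\<rparr>)"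
  proof (rule abelian_groupI, goal_cases)
    case (6 x)
    then show ?case
      using subgroup.m_inv_closed[OF assms(2)] Hc
      by (intro bexI[of _ "\<ominus>\<^bsub>A\<^esub> x"]) (auto simp: A.l_neg a_inv_def[symmetric])
  qed (auto simp: Hc A.a_ac subgroup.m_closed[OF assms(2), simplified] subgroup.one_closed[OF assms(2), simplified])
  have k: "add_pow (A\<lparr>carrier := H\<rparr>) k x = add_pow A k x" if "x \<in> H" for x and k :: int
    using A.add.int_pow_consistent[OF assms(2) that, of k] by (simp add: add_pow_def)
  have "(\<lambda>x. x) \<in> module_hom int_ring (int_module (A\<lparr>carrier := H\<rparr>)) (int_module A)"
    using subgroup.subset[OF assms(2)] by (intro module_homI) (auto simp: k)
  from baer_extend[OF baer_circle int_module_is_module[OF H] int_module_is_module[OF assms(1)] this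
      assms(3)[unfolded character_iff_module_hom[OF H]]]
    module_hom_zero[OF int_module_is_module[OF H] circle_is_module assms(3)[unfolded character_iff_module_hom[OF H]]]
  show thesis using that character_iff_module_hom[OF assms(1)] by auto
qed

text \<open>A suitable character is found on the cyclic subgroup generated by \<open>m\<close> and
  extended. It sends \<open>m\<close> to some \<open>w \<noteq> 1\<close> subject to
  \<open>w^n = 1\<close>, where \<open>n\<close> generates the annihilator of \<open>m\<close>: for
  infinite order, \<open>n = 0\<close> and \<open>w = -1\<close> will do; otherwise
  \<open>n \<ge> 2\<close>, and \<open>w\<close> is the first \<open>n\<close>-th root of unity
  after one.\<close>

lemma character_separates:
  assumes "abelian_group A" "m \<in> carrier A" "m \<noteq> \<zero>\<^bsub>A\<^esub>"
  obtains \<chi> where "character A \<chi>" "\<chi> m \<noteq> 1"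
proof -
  interpret A: abelian_group A by fact
  note ZA = int_module_is_module[OF assms(1)]
  interpret ZA: module int_ring "int_module A" by (rule ZA)
  have mc: "m \<in> carrier (int_module A)" using assms by simp
  obtain n :: int where n: "n \<ge> 0" "\<And>k. add_pow A k m = \<zero>\<^bsub>A\<^esub> \<longleftrightarrow> n dvd k"
  proof -
    note I = idealD[OF ZA.ideal_annihilator[OF mc]]
    show thesis
      by (rule int_ideal_multiples[of "{k. add_pow A k m = \<zero>\<^bsub>A\<^esub>}"]) (use I that in auto)
  qed
  have n1: "n \<noteq> 1" using n(2)[of 1] assms by auto
  obtain w where w: "cmod w = 1" "w \<noteq> 1" "w powi n = 1"
  proof (cases "n = 0")
    case True
    then show thesis using that[of "-1"] by simp
  next
    case False
    then have n2: "real_of_int n \<ge> 2" using n(1) n1 by linarith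
    have "cos (2 * pi / real_of_int n) < cos 0"
      using n2 by (intro cos_monotone_0_pi) (auto simp: field_simps)
    then have "cis (2 * pi / real_of_int n) \<noteq> 1" by (auto simp: complex_eq_iff)
    moreover have "cis (2 * pi / real_of_int n) powi n = 1"
      using False by (simp add: cis_power_int cis_2pi)
    ultimately show thesis using that[of "cis (2 * pi / real_of_int n)"] by simp
  qed
  have wn: "w powi (n * k) = 1" for k using w(3) by (simp add: power_int_mult)
  interpret ZR: module int_ring "ring_module int_ring"
    by (rule cring.ring_module_is_module[OF int_is_cring])
  have h: "(\<lambda>k. add_pow A k m) \<in> module_hom int_ring (ring_module int_ring) (int_module A)"
    using assms(2) by (intro module_homI) (auto simp: A.add.int_pow_mult A.add.int_pow_pow mult.commute)
  have w0: "w \<noteq> 0" using w(1) by auto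
  have g0: "(\<lambda>k. w powi k) \<in> module_hom int_ring (ring_module int_ring) circle"
    using w w0 by (intro module_homI) (auto simp: norm_power_int power_int_add power_int_mult[symmetric] mult.commute)
  \<comment> \<open>The map \<open>k \<mapsto> k m\<close> from \<int> may have a kernel; its
    elements are multiples of \<open>n\<close>, on which powers of \<open>w\<close> are
    trivial.\<close>
  obtain \<chi> where \<chi>: "\<chi> \<in> module_hom int_ring (int_module A) circle" "\<And>k. \<chi> (add_pow A k m) = w powi k"
    by (rule baer_extend[OF baer_circle ZR.module_axioms ZA h g0])
      (use wn n(2) in \<open>auto elim!: dvdE\<close>)
  then have "\<chi> m = w" using \<chi>(2)[of 1] assms(2) by simp
  then show thesis using that[of \<chi>] \<chi>(1) w(2) character_iff_module_hom[OF assms(1)] by auto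
qed

section \<open>Enough injectives\<close>

text \<open>\<open>cofree R\<close> is a power of \<open>Hom\<^sub>\<int>(R, \<real>/\<int>)\<close>; the value \<open>1\<close> outside \<open>carrier R\<close> makes equality of
  functions equality in the module.\<close>

definition cofree :: "('a, 'x) ring_scheme \<Rightarrow> ('a, 'i \<Rightarrow> 'a \<Rightarrow> complex) module" where
  "cofree R = \<lparr>carrier = {F. \<forall>i. character R (F i) \<and> (\<forall>r. r \<notin> carrier R \<longrightarrow> F i r = 1)},
     mult = undefined, one = undefined, zero = (\<lambda>i r. 1), add = (\<lambda>F G i r. F i r * G i r),
     smult = (\<lambda>a F i r. if r \<in> carrier R then F i (r \<otimes>\<^bsub>R\<^esub> a) else 1)\<rparr>"

lemma cofree_simps [simp]:
  "F \<in> carrier (cofree R) \<longleftrightarrow> (\<forall>i. character R (F i) \<and> (\<forall>r. r \<notin> carrier R \<longrightarrow> F i r = 1))"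
  "\<zero>\<^bsub>cofree R\<^esub> = (\<lambda>i r. 1)" "F \<oplus>\<^bsub>cofree R\<^esub> G = (\<lambda>i r. F i r * G i r)"
  "a \<odot>\<^bsub>cofree R\<^esub> F = (\<lambda>i r. if r \<in> carrier R then F i (r \<otimes>\<^bsub>R\<^esub> a) else 1)"
  by (simp_all add: cofree_def)

lemma (in cring) cofree_is_module: "module R (cofree R)"
proof (rule moduleI[OF is_cring])
  show "abelian_group (cofree R)"
  proof (rule abelian_groupI, goal_cases)
    case (6 F)
    have nz: "F i r \<noteq> 0" for i r
    proof -
      have "cmod (F i r) = 1" using 6 by (cases "r \<in> carrier R") (auto simp: character_def)
      then show ?thesis by auto
    qed
    show ?case
      by (rule bexI[of _ "\<lambda>i r. inverse (F i r)"])
        (use 6 nz in \<open>auto simp: character_def norm_inverse fun_eq_iff\<close>)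
  qed (auto simp: character_def norm_mult fun_eq_iff)
qed (auto simp: character_def norm_mult fun_eq_iff r_distr l_distr m_ac)

text \<open>Coinduction: evaluation at one turns a linear map from \<open>J\<close> into characters
  of \<open>J\<close>, one for each coordinate \<open>i\<close>. These extend to the additive group
  of the ring, and linearity recovers the value of \<open>g a i\<close> at \<open>r\<close> from
  that of \<open>g (r \<otimes> a) i\<close> at one.\<close>

lemma (in cring) baer_cofree: "baer R (cofree R)"
  unfolding baer_def
proof (intro conjI allI impI cofree_is_module)
  fix J g
  assume J: "ideal J R" and g: "g \<in> module_hom R ((ring_module R)\<lparr>carrier := J\<rparr>) (cofree R)"
  note JD = idealD[OF J] and gD = module_homD[OF g, simplified]
  have sub: "subgroup J (add_monoid R)" using J by (simp add: ideal_def additive_subgroup_def)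
  have "\<exists>\<chi>. character R \<chi> \<and> (\<forall>a\<in>J. \<chi> a = g a i \<one>)" for i
  proof -
    have "character (R\<lparr>carrier := J\<rparr>) (\<lambda>a. g a i \<one>)"
      using gD by (auto simp: character_def)
    from character_extend[OF abelian_group_axioms sub this] show ?thesis by metis
  qed
  then obtain \<chi> where \<chi>: "\<And>i. character R (\<chi> i)" "\<And>i a. a \<in> J \<Longrightarrow> \<chi> i a = g a i \<one>" by metis
  define y where "y = (\<lambda>i r. if r \<in> carrier R then \<chi> i r else 1)"
  have "y \<in> carrier (cofree R)" using \<chi>(1) by (auto simp: y_def character_def)
  moreover have "g a = a \<odot>\<^bsub>cofree R\<^esub> y" if a: "a \<in> J" for a
  proof (intro ext)
    fix i r
    show "g a i r = (a \<odot>\<^bsub>cofree R\<^esub> y) i r"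
    proof (cases "r \<in> carrier R")
      case True
      have "\<chi> i (r \<otimes> a) = g a i r"
        using \<chi>(2)[of "r \<otimes> a" i] gD(3)[OF True a] JD(4)[OF a True] True by simp
      then show ?thesis using True a JD(1) by (auto simp: y_def)
    next
      case False
      then show ?thesis using gD(1)[OF a] by simp
    qed
  qed
  ultimately show "\<exists>y\<in>carrier (cofree R). \<forall>a\<in>J. g a = a \<odot>\<^bsub>cofree R\<^esub> y" by blast
qed

text \<open>The index set is the type of elements of \<open>M\<close>: coordinate \<open>i\<close>
  is built from a character that detects the element \<open>i\<close>. The coordinate
  \<open>x - y\<close>, evaluated at one, separates \<open>x\<close> from \<open>y\<close>.\<close>

lemma embed_cofree:
  fixes M :: "('a, 'm) module"
  assumes "module R M"
  obtains j :: "'m \<Rightarrow> 'm \<Rightarrow> 'a \<Rightarrow> complex"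
    where "j \<in> module_hom R M (cofree R)" "inj_on j (carrier M)"
proof -
  interpret M: module R M by fact
  have "\<exists>\<chi>. character M \<chi> \<and> (i \<in> carrier M \<longrightarrow> i \<noteq> \<zero>\<^bsub>M\<^esub> \<longrightarrow> \<chi> i \<noteq> 1)" for i
  proof (cases "i \<in> carrier M \<and> i \<noteq> \<zero>\<^bsub>M\<^esub>")
    case True
    then show ?thesis using character_separates[OF M.M.abelian_group_axioms] by metis
  next
    case False
    have "character M (\<lambda>x. 1)" by (simp add: character_def)
    then show ?thesis using False by blast
  qed
  then obtain \<chi> where \<chi>: "\<And>i. character M (\<chi> i)" "\<And>i. i \<in> carrier M \<Longrightarrow> i \<noteq> \<zero>\<^bsub>M\<^esub> \<Longrightarrow> \<chi> i i \<noteq> 1" by metis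
  define j where "j = (\<lambda>m i r. if r \<in> carrier R then \<chi> i (r \<odot>\<^bsub>M\<^esub> m) else 1)"
  have "j \<in> module_hom R M (cofree R)"
  proof (rule module_homI)
    show "j x \<in> carrier (cofree R)" if "x \<in> carrier M" for x
      using \<chi>(1) that by (auto simp: j_def character_def M.smult_l_distr)
    show "j (x \<oplus>\<^bsub>M\<^esub> y) = j x \<oplus>\<^bsub>cofree R\<^esub> j y" if "x \<in> carrier M" "y \<in> carrier M" for x y
      using \<chi>(1) that by (auto simp: j_def character_def M.smult_r_distr fun_eq_iff)
    show "j (a \<odot>\<^bsub>M\<^esub> x) = a \<odot>\<^bsub>cofree R\<^esub> j x" if "a \<in> carrier R" "x \<in> carrier M" for a x
      using that by (auto simp: j_def M.smult_assoc1 fun_eq_iff)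
  qed
  moreover have "inj_on j (carrier M)"
  proof (rule inj_onI, rule ccontr)
    fix x y assume xy: "x \<in> carrier M" "y \<in> carrier M" "j x = j y" "x \<noteq> y"
    define i where "i = x \<ominus>\<^bsub>M\<^esub> y"
    have i: "i \<in> carrier M" "i \<noteq> \<zero>\<^bsub>M\<^esub>" using xy M.M.minus_arith(6) by (auto simp: i_def)
    have "x = i \<oplus>\<^bsub>M\<^esub> y" using xy M.M.minus_arith(3) by (simp add: i_def)
    then have "\<chi> i x = \<chi> i i * \<chi> i y" using \<chi>(1)[of i] i xy unfolding character_def by metis
    moreover have "\<chi> i x = \<chi> i y" using fun_cong[OF fun_cong[OF xy(3), of i], of "\<one>\<^bsub>R\<^esub>"] xy by (simp add: j_def)
    moreover have "\<chi> i y \<noteq> 0" using \<chi>(1)[of i] xy(2) unfolding character_def by fastforce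
    ultimately have "\<chi> i i = 1" by simp
    then show False using \<chi>(2) i by blast
  qed
  ultimately show thesis using that by blast
qed

section \<open>Injective resolutions within one type of terms\<close>

text \<open>Injective resolutions have to live in a single type. The elements of a submodule of an
  injective module that contains a given submodule and is closed under solving systems
  \<open>a\<^sub>i y = t\<^sub>i\<close> are named by terms; over a Noetherian ring such a submodule is injective.\<close>

datatype ('a, 'v) tm =
    Base 'v
  | Const "('a, 'v) tm"
  | Add "('a, 'v) tm" "('a, 'v) tm"
  | Smul 'a "('a, 'v) tm"
  | Solve "('a \<times> ('a, 'v) tm) list"

definition solution :: "('a, 'g) module \<Rightarrow> ('a \<times> 'g) list \<Rightarrow> 'g" where
  "solution G ys = (if \<exists>y\<in>carrier G. \<forall>(a, t)\<in>set ys. a \<odot>\<^bsub>G\<^esub> y = t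
     then SOME y. y \<in> carrier G \<and> (\<forall>(a, t)\<in>set ys. a \<odot>\<^bsub>G\<^esub> y = t) else \<zero>\<^bsub>G\<^esub>)"

text \<open>\<open>Base\<close> only supplies names for elements of type \<open>'v\<close> and has
  the dummy value zero. \<open>Const t\<close> stands for the element that carries the name
  \<open>t\<close>; since \<open>t\<close> is itself a term, the elements of a module built from
  terms can be named again. The default for scalars outside the ring keeps all values in the
  carrier.\<close>

primrec tm_eval ::
    "('a, 'x) ring_scheme \<Rightarrow> ('a, 'g) module \<Rightarrow> (('a, 'v) tm \<Rightarrow> 'g) \<Rightarrow> ('a, 'v) tm \<Rightarrow> 'g" where
  "tm_eval R G b (Base v) = \<zero>\<^bsub>G\<^esub>"
| "tm_eval R G b (Const t) = b t"
| "tm_eval R G b (Add s t) = tm_eval R G b s \<oplus>\<^bsub>G\<^esub> tm_eval R G b t"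
| "tm_eval R G b (Smul a t) = (if a \<in> carrier R then a \<odot>\<^bsub>G\<^esub> tm_eval R G b t else \<zero>\<^bsub>G\<^esub>)"
| "tm_eval R G b (Solve xs) = solution G (map (map_prod id (tm_eval R G b)) xs)"

lemma solution_closed:
  assumes "module R G"
  shows "solution G ys \<in> carrier G"
proof -
  interpret G: module R G by fact
  show ?thesis
  proof (cases "\<exists>y\<in>carrier G. \<forall>(a, t)\<in>set ys. a \<odot>\<^bsub>G\<^esub> y = t")
    case True
    then have "\<exists>y. y \<in> carrier G \<and> (\<forall>(a, t)\<in>set ys. a \<odot>\<^bsub>G\<^esub> y = t)" by blast
    from someI_ex[OF this] show ?thesis using True by (simp add: solution_def)
  qed (auto simp: solution_def)
qed

lemma solution_solves:
  assumes "y \<in> carrier G" "\<And>a t. (a, t) \<in> set ys \<Longrightarrow> a \<odot>\<^bsub>G\<^esub> y = t" "(a, t) \<in> set ys"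
  shows "a \<odot>\<^bsub>G\<^esub> solution G ys = t"
proof -
  let ?P = "\<lambda>y. y \<in> carrier G \<and> (\<forall>(a, t)\<in>set ys. a \<odot>\<^bsub>G\<^esub> y = t)"
  have P: "?P y" using assms(1,2) by auto
  then have "solution G ys = (SOME y. ?P y)" unfolding solution_def by auto
  moreover have "?P (SOME y. ?P y)" using P by (rule someI)
  ultimately show ?thesis using assms(3) by auto
qed

lemma module_transport:
  fixes N :: "('a, 'n) module" and \<rho> :: "'n \<Rightarrow> 'm"
  assumes "module R N" "inj_on \<rho> (carrier N)"
  obtains G where "module R G" "\<rho> \<in> module_hom R N G" "bij_betw \<rho> (carrier N) (carrier G)"
proof -
  interpret N: module R N by fact
  define e where "e = inv_into (carrier N) \<rho>"
  have e: "e (\<rho> x) = x" if "x \<in> carrier N" for x using that assms(2) by (simp add: e_def)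
  define G :: "('a, 'm) module" where "G = \<lparr>carrier = \<rho> ` carrier N, mult = undefined, one = undefined,
    zero = \<rho> \<zero>\<^bsub>N\<^esub>, add = (\<lambda>s t. \<rho> (e s \<oplus>\<^bsub>N\<^esub> e t)), smult = (\<lambda>a t. \<rho> (a \<odot>\<^bsub>N\<^esub> e t))\<rparr>"
  have G: "carrier G = \<rho> ` carrier N" "\<zero>\<^bsub>G\<^esub> = \<rho> \<zero>\<^bsub>N\<^esub>" "s \<oplus>\<^bsub>G\<^esub> t = \<rho> (e s \<oplus>\<^bsub>N\<^esub> e t)"
    "a \<odot>\<^bsub>G\<^esub> t = \<rho> (a \<odot>\<^bsub>N\<^esub> e t)" for s t a by (simp_all add: G_def)
  have "module R G"
  proof (rule moduleI[OF N.R.is_cring])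
    show "abelian_group G"
    proof (rule abelian_groupI, goal_cases)
      case (6 x)
      then obtain u where "u \<in> carrier N" "x = \<rho> u" by (auto simp: G)
      then show ?case by (intro bexI[of _ "\<rho> (\<ominus>\<^bsub>N\<^esub> u)"]) (auto simp: G e N.l_neg)
    qed (auto simp: G e N.a_ac)
  qed (auto simp: G e N.smult_l_distr N.smult_r_distr N.smult_assoc1)
  moreover have "\<rho> \<in> module_hom R N G" by (rule module_homI) (auto simp: G e)
  moreover have "bij_betw \<rho> (carrier N) (carrier G)" using assms(2) by (simp add: bij_betw_def G)
  ultimately show thesis using that by blast
qed

lemma baer_transport:
  assumes "baer R N" "module R G" "\<rho> \<in> module_hom R N G" "bij_betw \<rho> (carrier N) (carrier G)"
  shows "baer R G"
  unfolding baer_def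
proof (intro conjI allI impI assms(2))
  have N: "module R N" using assms(1) by (simp add: baer_def)
  fix J g
  assume J: "ideal J R" and g: "g \<in> module_hom R ((ring_module R)\<lparr>carrier := J\<rparr>) G"
  have "(\<lambda>x. inv_into (carrier N) \<rho> (g x)) \<in> module_hom R ((ring_module R)\<lparr>carrier := J\<rparr>) N"
    by (rule module_hom_comp[OF g module_hom_inv[OF N assms(2-4)]])
  then obtain y where y: "y \<in> carrier N" "\<And>a. a \<in> J \<Longrightarrow> inv_into (carrier N) \<rho> (g a) = a \<odot>\<^bsub>N\<^esub> y"
    using assms(1) J unfolding baer_def by meson
  have "g a = a \<odot>\<^bsub>G\<^esub> \<rho> y" if a: "a \<in> J" for a
  proof -
    have "g a \<in> \<rho> ` carrier N" using module_homD(1)[OF g] a assms(4) by (auto simp: bij_betw_def)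
    then have "g a = \<rho> (inv_into (carrier N) \<rho> (g a))" by (simp add: f_inv_into_f)
    then show ?thesis using y a module_homD(3)[OF assms(3)] idealD(1)[OF J] by auto
  qed
  then show "\<exists>y\<in>carrier G. \<forall>a\<in>J. g a = a \<odot>\<^bsub>G\<^esub> y"
    using module_homD(1)[OF assms(3) y(1)] by blast
qed

text \<open>The values of all terms form a submodule \<open>N\<close> of a cofree module that
  contains the image of \<open>M\<close>. It is injective because a homomorphism from a finitely
  generated ideal into \<open>N\<close> amounts to a finite system with a solution in the cofree
  module, and the chosen solution is again the value of a term. Choosing one term per element moves
  \<open>N\<close> into the type of terms.\<close>

lemma exists_injective_extension:
  fixes M :: "('a, 'm) module" and c :: "'m \<Rightarrow> ('a, 'v) tm"
  assumes R: "noetherian_ring R" and M: "module R M" and c: "inj_on c (carrier M)"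
  obtains G :: "('a, ('a, 'v) tm) module" and j
  where "baer R G" "j \<in> module_hom R M G" "inj_on j (carrier M)"
proof -
  interpret M: module R M by fact
  interpret NR: noetherian_ring R by fact
  obtain j0 :: "'m \<Rightarrow> 'm \<Rightarrow> 'a \<Rightarrow> complex" where
    j0: "j0 \<in> module_hom R M (cofree R)" "inj_on j0 (carrier M)" by (rule embed_cofree[OF M])
  define C :: "('a, 'm \<Rightarrow> 'a \<Rightarrow> complex) module" where "C = cofree R"
  have bC: "baer R C" unfolding C_def by (rule M.R.baer_cofree)
  have j0C: "j0 \<in> module_hom R M C" using j0 by (simp add: C_def)
  interpret C: module R C using bC by (simp add: baer_def)
  define b where "b t = (if t \<in> c ` carrier M then j0 (inv_into (carrier M) c t) else \<zero>\<^bsub>C\<^esub>)" for t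
  define ev where "ev = tm_eval R C b"
  have evc: "ev t \<in> carrier C" for t
  proof (induction t)
    case (Const t)
    then show ?case using module_homD(1)[OF j0C] c by (auto simp: ev_def b_def)
  next
    case (Solve xs)
    then show ?case using solution_closed[OF C.module_axioms] by (simp add: ev_def)
  qed (auto simp: ev_def)
  define N where "N = range ev"
  have N: "submodule N R C"
  proof (rule submoduleI'[OF C.module_axioms])
    show "N \<subseteq> carrier C" using evc by (auto simp: N_def)
    have "ev (Base undefined) = \<zero>\<^bsub>C\<^esub>" by (simp add: ev_def)
    then show "\<zero>\<^bsub>C\<^esub> \<in> N" unfolding N_def by (metis rangeI)
    show "x \<oplus>\<^bsub>C\<^esub> y \<in> N" if "x \<in> N" "y \<in> N" for x y
    proof -
      obtain s t where "x = ev s" "y = ev t" using \<open>x \<in> N\<close> \<open>y \<in> N\<close> by (auto simp: N_def)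
      then have "x \<oplus>\<^bsub>C\<^esub> y = ev (Add s t)" by (simp add: ev_def)
      then show ?thesis by (simp add: N_def)
    qed
    show "a \<odot>\<^bsub>C\<^esub> y \<in> N" if "a \<in> carrier R" "y \<in> N" for a y
    proof -
      obtain t where "y = ev t" using \<open>y \<in> N\<close> by (auto simp: N_def)
      then have "a \<odot>\<^bsub>C\<^esub> y = ev (Smul a t)" using \<open>a \<in> carrier R\<close> by (simp add: ev_def)
      then show ?thesis by (simp add: N_def)
    qed
  qed
  let ?N = "C\<lparr>carrier := N\<rparr>"
  have Nm: "module R ?N" by (rule submodule.submodule_is_module[OF N C.module_axioms])
  have bN: "baer R ?N"
    unfolding baer_def
  proof (intro conjI allI impI Nm)
    fix J g
    assume J: "ideal J R" and g: "g \<in> module_hom R ((ring_module R)\<lparr>carrier := J\<rparr>) ?N"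
    note gD = module_homD[OF g, simplified] and JD = idealD[OF J]
    have "g \<in> module_hom R ((ring_module R)\<lparr>carrier := J\<rparr>) C"
      using gD C.submoduleE(1)[OF N] by (intro module_homI) auto
    then obtain y where y: "y \<in> carrier C" "\<And>a. a \<in> J \<Longrightarrow> g a = a \<odot>\<^bsub>C\<^esub> y"
      using bC J unfolding baer_def by meson
    obtain A where A: "A \<subseteq> carrier R" "finite A" "J = genideal R A" using NR.finetely_gen[OF J] by blast
    obtain as where as: "set as = A" using finite_list[OF A(2)] by blast
    have AJ: "A \<subseteq> J" using A M.R.genideal_self by simp
    have "\<exists>t. ev t = g a" if "a \<in> J" for a using gD(1)[OF that] by (auto simp: N_def)
    then obtain \<tau> where \<tau>: "\<And>a. a \<in> J \<Longrightarrow> ev (\<tau> a) = g a" by metis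
    \<comment> \<open>One equation for each generator of \<open>J\<close>, with right-hand sides
      named by terms. The element \<open>y\<close> solves the system but may lie outside
      \<open>N\<close>, whereas the value of \<open>Solve xs\<close> lies in
      \<open>N\<close>.\<close>
    define xs where "xs = map (\<lambda>a. (a, \<tau> a)) as"
    define y' where "y' = ev (Solve xs)"
    have y'N: "y' \<in> N" by (simp add: y'_def N_def)
    have y'C: "y' \<in> carrier C" using evc by (simp add: y'_def)
    have gen: "g a = a \<odot>\<^bsub>C\<^esub> y'" if a: "a \<in> A" for a
    proof -
      have "a \<odot>\<^bsub>C\<^esub> solution C (map (map_prod id ev) xs) = g a"
      proof (rule solution_solves[OF y(1)])
        show "(a, g a) \<in> set (map (map_prod id ev) xs)"
          using a as \<tau> AJ by (force simp: xs_def)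
        fix a' t assume "(a', t) \<in> set (map (map_prod id ev) xs)"
        then show "a' \<odot>\<^bsub>C\<^esub> y = t" using \<tau> AJ y(2) as by (auto simp: xs_def)
      qed
      then show ?thesis by (simp add: y'_def ev_def)
    qed
    \<comment> \<open>Agreement on the generators spreads to \<open>J\<close> because the places of
      agreement form an ideal.\<close>
    have "ideal {a \<in> J. g a = a \<odot>\<^bsub>C\<^esub> y'} R"
    proof (rule M.R.idealI')
      show "\<zero>\<^bsub>R\<^esub> \<in> {a \<in> J. g a = a \<odot>\<^bsub>C\<^esub> y'}" using JD(2) y(2)[of "\<zero>\<^bsub>R\<^esub>"] y(1) y'C by simp
    qed (use JD gD y'C in \<open>auto simp: C.smult_l_distr C.smult_assoc1 subset_iff\<close>)
    then have "J \<subseteq> {a \<in> J. g a = a \<odot>\<^bsub>C\<^esub> y'}"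
      unfolding A(3) by (rule M.R.genideal_minimal) (use gen AJ A(3) in auto)
    then show "\<exists>y\<in>carrier ?N. \<forall>a\<in>J. g a = a \<odot>\<^bsub>?N\<^esub> y" using y'N by auto
  qed
  define \<rho> where "\<rho> n = (SOME t. ev t = n)" for n
  have \<rho>: "ev (\<rho> n) = n" if "n \<in> N" for n
    using that unfolding \<rho>_def N_def by (metis (mono_tags, lifting) rangeE someI_ex)
  have "inj_on \<rho> (carrier ?N)" by (rule inj_on_inverseI[of _ ev]) (use \<rho> in simp)
  then obtain G where G: "module R G" "\<rho> \<in> module_hom R ?N G" "bij_betw \<rho> (carrier ?N) (carrier G)"
    by (rule module_transport[OF Nm])
  have jN: "j0 m \<in> N" if "m \<in> carrier M" for m
  proof -
    have "ev (Const (c m)) = j0 m" using that c by (simp add: ev_def b_def)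
    then show ?thesis unfolding N_def by (metis rangeI)
  qed
  have "j0 \<in> module_hom R M ?N" using module_homD[OF j0C] jN by (intro module_homI) auto
  from module_hom_comp[OF this G(2)] have "(\<lambda>x. \<rho> (j0 x)) \<in> module_hom R M G" .
  moreover have "inj_on (\<lambda>x. \<rho> (j0 x)) (carrier M)"
    using j0(2) jN G(3) by (auto simp: inj_on_def bij_betw_def)
  ultimately show thesis using that baer_transport[OF bN G] by blast
qed

text \<open>The quotient of \<open>G\<close> by \<open>Z\<close> is embedded into an injective
  module. Its elements are sets of terms, but a representative serves as the name of a coset, so the
  new module has the same type as \<open>G\<close>.\<close>

lemma exists_injective_with_kernel:
  fixes G :: "('a, ('a, 'v) tm) module"
  assumes R: "noetherian_ring R" and G: "module R G" and Z: "submodule Z R G"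
  obtains G' :: "('a, ('a, 'v) tm) module" and d
  where "baer R G'" "d \<in> module_hom R G G'" "{x \<in> carrier G. d x = \<zero>\<^bsub>G'\<^esub>} = Z"
proof -
  interpret G: module R G by fact
  have ZG: "Z \<subseteq> carrier G" by (rule G.submoduleE(1)[OF Z])
  define Q where "Q = quotient_module (G\<lparr>carrier := carrier G\<rparr>) Z"
  have s: "subq R G (carrier G) Z Q (\<lambda>x. Z +>\<^bsub>G\<^esub> x)"
    unfolding Q_def by (rule subq_quotient[OF G submodule_self[OF G] Z ZG])
  note sD = subqD[OF s]
  define c :: "('a, 'v) tm set \<Rightarrow> ('a, 'v) tm" where "c X = (SOME t. t \<in> carrier G \<and> X = Z +>\<^bsub>G\<^esub> t)" for X
  have c: "X = Z +>\<^bsub>G\<^esub> c X" if "X \<in> carrier Q" for X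
    using someI_ex[of "\<lambda>t. t \<in> carrier G \<and> X = Z +>\<^bsub>G\<^esub> t"] sD(11)[OF that] unfolding c_def by blast
  have "inj_on c (carrier Q)" by (rule inj_on_inverseI[of _ "\<lambda>t. Z +>\<^bsub>G\<^esub> t"]) (use c in simp)
  then obtain G' :: "('a, ('a, 'v) tm) module" and j where
    G': "baer R G'" "j \<in> module_hom R Q G'" "inj_on j (carrier Q)"
    by (rule exists_injective_extension[OF R sD(2)])
  have Gm: "module R G'" using G'(1) by (simp add: baer_def)
  have k: "(\<lambda>x. Z +>\<^bsub>G\<^esub> x) \<in> module_hom R G Q" using s unfolding subq_def by simp
  have "j (Z +>\<^bsub>G\<^esub> x) = \<zero>\<^bsub>G'\<^esub> \<longleftrightarrow> x \<in> Z" if x: "x \<in> carrier G" for x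
  proof -
    have z: "j \<zero>\<^bsub>Q\<^esub> = \<zero>\<^bsub>G'\<^esub>" "\<zero>\<^bsub>Q\<^esub> \<in> carrier Q"
      using module_hom_zero[OF sD(2) Gm G'(2)] submodule_zero[OF submodule_self[OF sD(2)]] by auto
    have "j (Z +>\<^bsub>G\<^esub> x) = \<zero>\<^bsub>G'\<^esub> \<longleftrightarrow> Z +>\<^bsub>G\<^esub> x = \<zero>\<^bsub>Q\<^esub>"
      using z sD(7)[OF x] G'(3) by (metis inj_onD)
    then show ?thesis using sD(12)[OF x] by simp
  qed
  then show thesis using that[OF G'(1) module_hom_comp[OF k G'(2)]] ZG by blast
qed

lemma exists_injective_resolution:
  fixes M :: "('a, 'v) module"
  assumes R: "noetherian_ring R" and M: "module R M"
  obtains G :: "('a, ('a, 'v) tm) cochain" and \<epsilon>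
  where "resolution R M G \<epsilon>" "\<And>i. baer R (obj G i)"
proof -
  obtain G0 :: "('a, ('a, 'v) tm) module" and j where
    G0: "baer R G0" "j \<in> module_hom R M G0" "inj_on j (carrier M)"
    by (rule exists_injective_extension[OF R M, of Base]) (auto simp: inj_on_def)
  have b: "baer R A \<Longrightarrow> module R A" for A :: "('a, ('a, 'v) tm) module" by (simp add: baer_def)
  \<comment> \<open>A state consists of a module and the submodule that has to become the kernel of
    the next differential. In degree zero it is pinned to the embedding of \<open>M\<close>.\<close>
  define P where "P n X \<longleftrightarrow> baer R (fst X) \<and> submodule (snd X) R (fst X) \<and>
    (n = (0 :: nat) \<longrightarrow> X = (G0, j ` carrier M))" for n and X :: "('a, ('a, 'v) tm) module \<times> ('a, 'v) tm set"
  define Q where "Q X X' \<longleftrightarrow> (\<exists>d\<in>module_hom R (fst X) (fst X').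
      {x \<in> carrier (fst X). d x = \<zero>\<^bsub>fst X'\<^esub>} = snd X \<and> snd X' = d ` carrier (fst X))"
    for X X' :: "('a, ('a, 'v) tm) module \<times> ('a, 'v) tm set"
  have "\<exists>F. \<forall>n. P n (F n) \<and> Q (F n) (F (Suc n))"
  proof (rule dependent_nat_choice)
    show "\<exists>X. P 0 X"
      using submodule_image[OF M b[OF G0(1)] G0(2) submodule_self[OF M]] G0(1)
      by (intro exI[of _ "(G0, j ` carrier M)"]) (simp add: P_def)
    fix X n assume X: "P n X"
    then have X': "baer R (fst X)" "submodule (snd X) R (fst X)" by (simp_all add: P_def)
    obtain G' :: "('a, ('a, 'v) tm) module" and d where
      G': "baer R G'" "d \<in> module_hom R (fst X) G'" "{x \<in> carrier (fst X). d x = \<zero>\<^bsub>G'\<^esub>} = snd X"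
      by (rule exists_injective_with_kernel[OF R b[OF X'(1)] X'(2)])
    have "submodule (d ` carrier (fst X)) R G'"
      by (rule submodule_image[OF b[OF X'(1)] b[OF G'(1)] G'(2) submodule_self[OF b[OF X'(1)]]])
    then show "\<exists>Y. P (Suc n) Y \<and> Q X Y"
      using G' by (intro exI[of _ "(G', d ` carrier (fst X))"]) (auto simp: P_def Q_def)
  qed
  then obtain F where F: "\<And>n. P n (F n)" "\<And>n. Q (F n) (F (Suc n))" by blast
  have "\<forall>n. \<exists>d. d \<in> module_hom R (fst (F n)) (fst (F (Suc n))) \<and>
      {x \<in> carrier (fst (F n)). d x = \<zero>\<^bsub>fst (F (Suc n))\<^esub>} = snd (F n) \<and>
      snd (F (Suc n)) = d ` carrier (fst (F n))"
    using F(2) unfolding Q_def by blast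
  from choice[OF this] obtain d where "\<forall>n. d n \<in> module_hom R (fst (F n)) (fst (F (Suc n))) \<and>
      {x \<in> carrier (fst (F n)). d n x = \<zero>\<^bsub>fst (F (Suc n))\<^esub>} = snd (F n) \<and>
      snd (F (Suc n)) = d n ` carrier (fst (F n))" ..
  then have d: "\<And>n. d n \<in> module_hom R (fst (F n)) (fst (F (Suc n)))"
    "\<And>n. {x \<in> carrier (fst (F n)). d n x = \<zero>\<^bsub>fst (F (Suc n))\<^esub>} = snd (F n)"
    "\<And>n. snd (F (Suc n)) = d n ` carrier (fst (F n))"
    by simp_all
  define G where "G = \<lparr>obj = (\<lambda>n. fst (F n)), dmap = d\<rparr>"
  have F0: "fst (F 0) = G0" "snd (F 0) = j ` carrier M" using F(1)[of 0] by (auto simp: P_def)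
  have bF: "baer R (fst (F n))" for n using F(1)[of n] by (simp add: P_def)
  have "resolution R M G j"
    unfolding resolution_def G_def using M b[OF bF] d(1) G0 F0 d(2)[of 0] d(2) d(3) by simp
  then show thesis using that bF by (simp add: G_def)
qed

section \<open>Chain maps and retracts\<close>

text \<open>The comparison theorem. The predicate \<open>P\<close> records that cocycles go to
  cocycles, since this is the kernel condition under which \<open>baer_extend\<close> yields the
  next component. Injectivity is asked of the target, which dictates the direction of the maps
  between resolutions later on.\<close>

lemma exists_chain_map:
  fixes E :: "('a, 'e) cochain" and G :: "('a, 'g) cochain"
  assumes rE: "resolution R K E \<epsilon>" and rG: "resolution R L G \<epsilon>'" and bG: "\<And>i. baer R (obj G i)"
    and \<alpha>: "\<alpha> \<in> module_hom R K L"
  obtains \<phi> where "chain_map R E G \<phi>" "\<And>x. x \<in> carrier K \<Longrightarrow> \<phi> 0 (\<epsilon> x) = \<epsilon>' (\<alpha> x)"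
proof -
  note E = resolutionD[OF rE] and G = resolutionD[OF rG]
  define P where "P n f \<longleftrightarrow> f \<in> module_hom R (obj E n) (obj G n) \<and>
    (\<forall>x\<in>carrier (obj E n). dmap E n x = \<zero>\<^bsub>obj E (Suc n)\<^esub> \<longrightarrow> dmap G n (f x) = \<zero>\<^bsub>obj G (Suc n)\<^esub>) \<and>
    (n = 0 \<longrightarrow> (\<forall>x\<in>carrier K. f (\<epsilon> x) = \<epsilon>' (\<alpha> x)))" for n f
  define Q where "Q n f f' \<longleftrightarrow> (\<forall>x\<in>carrier (obj E n). f' (dmap E n x) = dmap G n (f x))" for n f f'
  have "\<exists>F. \<forall>n. P n (F n) \<and> Q n (F n) (F (Suc n))"
  proof (rule dependent_nat_choice)
    have "\<epsilon>' (\<alpha> x) = \<zero>\<^bsub>obj G 0\<^esub>" if x: "x \<in> carrier K" "\<epsilon> x = \<zero>\<^bsub>obj E 0\<^esub>" for x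
    proof -
      have "x = \<zero>\<^bsub>K\<^esub>"
        using x E(5) module_hom_zero[OF E(1,2,4)] submodule_zero[OF submodule_self[OF E(1)]]
        by (metis inj_onD)
      then show ?thesis
        using module_hom_zero[OF E(1) G(1) \<alpha>] module_hom_zero[OF G(1,2,4)] by simp
    qed
    then obtain f where f: "f \<in> module_hom R (obj E 0) (obj G 0)"
      "\<And>x. x \<in> carrier K \<Longrightarrow> f (\<epsilon> x) = \<epsilon>' (\<alpha> x)"
      using baer_extend[OF bG E(1) E(2) E(4) module_hom_comp[OF \<alpha> G(4)]] by metis
    have "dmap G 0 (f x) = \<zero>\<^bsub>obj G (Suc 0)\<^esub>"
      if x: "x \<in> carrier (obj E 0)" "dmap E 0 x = \<zero>\<^bsub>obj E (Suc 0)\<^esub>" for x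
    proof -
      obtain k where "k \<in> carrier K" "x = \<epsilon> k" using E(6) x by blast
      then have "f x \<in> \<epsilon>' ` carrier L" using f(2) module_homD(1)[OF \<alpha>] by auto
      then show ?thesis using G(6) by blast
    qed
    then show "\<exists>f. P 0 f" using f unfolding P_def by blast
    fix f n assume P: "P n f"
    then have f: "f \<in> module_hom R (obj E n) (obj G n)"
      "\<And>x. x \<in> carrier (obj E n) \<Longrightarrow> dmap E n x = \<zero>\<^bsub>obj E (Suc n)\<^esub> \<Longrightarrow> dmap G n (f x) = \<zero>\<^bsub>obj G (Suc n)\<^esub>"
      by (auto simp: P_def)
    obtain f' where f': "f' \<in> module_hom R (obj E (Suc n)) (obj G (Suc n))"
      "\<And>x. x \<in> carrier (obj E n) \<Longrightarrow> f' (dmap E n x) = dmap G n (f x)"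
      by (rule baer_extend[OF bG E(2) E(2) E(3) module_hom_comp[OF f(1) G(3)] f(2)]) auto
    have "dmap G (Suc n) (f' x) = \<zero>\<^bsub>obj G (Suc (Suc n))\<^esub>"
      if x: "x \<in> carrier (obj E (Suc n))" "dmap E (Suc n) x = \<zero>\<^bsub>obj E (Suc (Suc n))\<^esub>" for x
    proof -
      obtain y where "y \<in> carrier (obj E n)" "x = dmap E n y" using E(7) x by blast
      then show ?thesis using f'(2) G(8) module_homD(1)[OF f(1)] by simp
    qed
    then show "\<exists>f'. P (Suc n) f' \<and> Q n f f'" using f' unfolding P_def Q_def by blast
  qed
  then obtain F where F: "\<forall>n. P n (F n) \<and> Q n (F n) (F (Suc n))" ..
  have "chain_map R E G F" using F unfolding chain_map_def P_def Q_def by blast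
  moreover have "F 0 (\<epsilon> x) = \<epsilon>' (\<alpha> x)" if "x \<in> carrier K" for x using F that unfolding P_def by blast
  ultimately show thesis using that by blast
qed

text \<open>Direct summands up to isomorphism. A splitting is inherited by cohomology, kernels,
  images and cokernels, whereas an injection alone need not stay injective on cohomology.\<close>

definition mod_retract :: "('a, 'x) ring_scheme \<Rightarrow> ('a, 'm) module \<Rightarrow> ('a, 'n) module \<Rightarrow> bool" where
  "mod_retract R M N \<longleftrightarrow> module R M \<and> module R N \<and>
     (\<exists>u\<in>module_hom R M N. \<exists>v\<in>module_hom R N M. \<forall>x\<in>carrier M. v (u x) = x)"

lemma mod_retract_trans:
  assumes "mod_retract R L M" "mod_retract R M N"
  shows "mod_retract R L N"
proof -
  obtain u v where u: "u \<in> module_hom R L M" "v \<in> module_hom R M L" "\<And>x. x \<in> carrier L \<Longrightarrow> v (u x) = x"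
    using assms(1) by (auto simp: mod_retract_def)
  obtain u' v' where u': "u' \<in> module_hom R M N" "v' \<in> module_hom R N M" "\<And>x. x \<in> carrier M \<Longrightarrow> v' (u' x) = x"
    using assms(2) by (auto simp: mod_retract_def)
  have "v (v' (u' (u x))) = x" if "x \<in> carrier L" for x
    using u(3) u'(3) module_homD(1)[OF u(1)] that by simp
  then show ?thesis
    using assms module_hom_comp[OF u(1) u'(1)] module_hom_comp[OF u'(2) u(2)]
    unfolding mod_retract_def
    by (intro conjI bexI[of _ "\<lambda>x. u' (u x)"] bexI[of _ "\<lambda>x. v (v' x)"]) simp_all
qed

lemma module_iso_imp_retract:
  assumes "module_iso R M N"
  shows "mod_retract R M N" "mod_retract R N M"
proof -
  obtain h where h: "h \<in> module_hom R M N" "bij_betw h (carrier M) (carrier N)"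
    and m: "module R M" "module R N" using assms by (auto simp: module_iso_def)
  note i = module_hom_inv[OF m h]
  have "inv_into (carrier M) h (h x) = x" if "x \<in> carrier M" for x
    using h(2) that by (simp add: bij_betw_def)
  then show "mod_retract R M N" unfolding mod_retract_def using m h(1) i by blast
  have "h (inv_into (carrier M) h y) = y" if "y \<in> carrier N" for y
    using h(2) that by (simp add: bij_betw_def f_inv_into_f)
  then show "mod_retract R N M" unfolding mod_retract_def using m h(1) i by blast
qed

lemma mod_retract_iso:
  assumes "mod_retract R M M'" "module_iso R M N" "module_iso R M' N'"
  shows "mod_retract R N N'"
  using mod_retract_trans[OF mod_retract_trans[OF module_iso_imp_retract(2)[OF assms(2)] assms(1)]
      module_iso_imp_retract(1)[OF assms(3)]] .

definition arrow_map ::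
    "('a, 'x) ring_scheme \<Rightarrow> ('a, 'm) module \<Rightarrow> ('a, 'n) module \<Rightarrow> ('m \<Rightarrow> 'n) \<Rightarrow>
     ('a, 'p) module \<Rightarrow> ('a, 'q) module \<Rightarrow> ('p \<Rightarrow> 'q) \<Rightarrow> ('m \<Rightarrow> 'p) \<Rightarrow> ('n \<Rightarrow> 'q) \<Rightarrow> bool" where
  "arrow_map R A B h A' B' h' a b \<longleftrightarrow> a \<in> module_hom R A A' \<and> b \<in> module_hom R B B' \<and>
     (\<forall>x\<in>carrier A. h' (a x) = b (h x))"

text \<open>A retract in the category of arrows. Kernels, images and cokernels are functors on that
  category, so all three are handled by the same notion.\<close>

definition arrow_retract ::
    "('a, 'x) ring_scheme \<Rightarrow> ('a, 'm) module \<Rightarrow> ('a, 'n) module \<Rightarrow> ('m \<Rightarrow> 'n) \<Rightarrow>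
     ('a, 'p) module \<Rightarrow> ('a, 'q) module \<Rightarrow> ('p \<Rightarrow> 'q) \<Rightarrow> bool" where
  "arrow_retract R A B h A' B' h' \<longleftrightarrow> module R A \<and> module R B \<and> module R A' \<and> module R B' \<and>
     h \<in> module_hom R A B \<and> h' \<in> module_hom R A' B' \<and>
     (\<exists>a b a' b'. arrow_map R A B h A' B' h' a b \<and> arrow_map R A' B' h' A B h a' b' \<and>
        (\<forall>x\<in>carrier A. a' (a x) = x) \<and> (\<forall>y\<in>carrier B. b' (b y) = y))"

lemma arrow_map_comp:
  assumes "arrow_map R A B h A' B' h' a b" "arrow_map R A' B' h' A'' B'' h'' a' b'"
  shows "arrow_map R A B h A'' B'' h'' (\<lambda>x. a' (a x)) (\<lambda>x. b' (b x))"
  using assms module_homD(1)[of a R A A'] by (auto simp: arrow_map_def intro: module_hom_comp)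

lemma arrow_map_inv:
  assumes "arrow_map R A B h A' B' h' a b" "module R A" "module R B" "module R A'" "module R B'"
    and "h \<in> module_hom R A B"
    and "bij_betw a (carrier A) (carrier A')" "bij_betw b (carrier B) (carrier B')"
  shows "arrow_map R A' B' h' A B h (inv_into (carrier A) a) (inv_into (carrier B) b)"
  unfolding arrow_map_def
proof (intro conjI ballI)
  have ab: "a \<in> module_hom R A A'" "b \<in> module_hom R B B'" "\<And>x. x \<in> carrier A \<Longrightarrow> h' (a x) = b (h x)"
    using assms(1) by (auto simp: arrow_map_def)
  show "inv_into (carrier A) a \<in> module_hom R A' A" "inv_into (carrier B) b \<in> module_hom R B' B"
    by (rule module_hom_inv; use assms ab in blast)+
  fix y assume y: "y \<in> carrier A'"
  then obtain x where x: "x \<in> carrier A" "y = a x" using assms(7) by (auto simp: bij_betw_def)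
  have "inv_into (carrier B) b (b (h x)) = h x"
    using assms(8) module_homD(1)[OF assms(6) x(1)] by (simp add: bij_betw_def)
  then show "h (inv_into (carrier A) a y) = inv_into (carrier B) b (h' y)"
    using x assms(7) ab(3) by (simp add: bij_betw_def)
qed

text \<open>The third arrow maps to the second one by a bijection, against the direction of the
  desired section, and the composite on the first arrow is a bijection that may differ from the
  identity. Inverting both repairs this: the section is \<open>c^(-1) a\<close> and the retraction
  is \<open>(a' a)^(-1) a' c\<close>, and likewise for the targets.\<close>

lemma arrow_retract_zigzag:
  assumes m: "module R A1" "module R B1" "module R A3" "module R B3"
      "module R A2" "module R B2" "h1 \<in> module_hom R A1 B1" "h3 \<in> module_hom R A3 B3"
    and f: "arrow_map R A1 B1 h1 A2 B2 h2 a b" and g: "arrow_map R A2 B2 h2 A1 B1 h1 a' b'"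
    and c: "arrow_map R A3 B3 h3 A2 B2 h2 c d"
    and bij: "bij_betw (\<lambda>x. a' (a x)) (carrier A1) (carrier A1)"
      "bij_betw (\<lambda>x. b' (b x)) (carrier B1) (carrier B1)"
      "bij_betw c (carrier A3) (carrier A2)" "bij_betw d (carrier B3) (carrier B2)"
  shows "arrow_retract R A1 B1 h1 A3 B3 h3"
proof -
  let ?ci = "inv_into (carrier A3) c" and ?di = "inv_into (carrier B3) d"
  let ?ai = "inv_into (carrier A1) (\<lambda>x. a' (a x))" and ?bi = "inv_into (carrier B1) (\<lambda>x. b' (b x))"
  have 1: "arrow_map R A1 B1 h1 A3 B3 h3 (\<lambda>x. ?ci (a x)) (\<lambda>x. ?di (b x))"
    by (rule arrow_map_comp[OF f arrow_map_inv[OF c m(3,4,5,6,8) bij(3,4)]])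
  have 2: "arrow_map R A3 B3 h3 A1 B1 h1 (\<lambda>x. ?ai (a' (c x))) (\<lambda>x. ?bi (b' (d x)))"
    by (rule arrow_map_comp[OF arrow_map_comp[OF c g]
          arrow_map_inv[OF arrow_map_comp[OF f g] m(1,2,1,2,7) bij(1,2)]])
  have "?ai (a' (c (?ci (a x)))) = x" if x: "x \<in> carrier A1" for x
  proof -
    have "a x \<in> carrier A2" using f module_homD(1) x by (fastforce simp: arrow_map_def)
    then have "c (?ci (a x)) = a x" using bij(3) by (simp add: bij_betw_def f_inv_into_f)
    then show ?thesis using inv_into_f_f[OF bij_betw_imp_inj_on[OF bij(1)] x] by simp
  qed
  moreover have "?bi (b' (d (?di (b x)))) = x" if x: "x \<in> carrier B1" for x
  proof -
    have "b x \<in> carrier B2" using f module_homD(1) x by (fastforce simp: arrow_map_def)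
    then have "d (?di (b x)) = b x" using bij(4) by (simp add: bij_betw_def f_inv_into_f)
    then show ?thesis using inv_into_f_f[OF bij_betw_imp_inj_on[OF bij(2)] x] by simp
  qed
  ultimately show ?thesis unfolding arrow_retract_def using m 1 2 by blast
qed

text \<open>A commuting square restricts \<open>a\<close> to the kernels, restricts \<open>b\<close>
  to the images and lets \<open>b\<close> descend to the cokernels; the retraction identities are
  inherited.\<close>

lemma arrow_retract_hom_part:
  assumes r: "arrow_retract R A B h A' B' h'"
    and N: "is_hom_part R p A B h N" and N': "is_hom_part R p A' B' h' N'"
  shows "mod_retract R N N'"
proof -
  obtain a b a' b' where m: "module R A" "module R B" "module R A'" "module R B'"
    "h \<in> module_hom R A B" "h' \<in> module_hom R A' B'"
    and a: "a \<in> module_hom R A A'" "b \<in> module_hom R B B'" "\<And>x. x \<in> carrier A \<Longrightarrow> h' (a x) = b (h x)"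
    and a': "a' \<in> module_hom R A' A" "b' \<in> module_hom R B' B" "\<And>x. x \<in> carrier A' \<Longrightarrow> h (a' x) = b' (h' x)"
    and id: "\<And>x. x \<in> carrier A \<Longrightarrow> a' (a x) = x" "\<And>y. y \<in> carrier B \<Longrightarrow> b' (b y) = y"
    using r unfolding arrow_retract_def arrow_map_def by blast
  note aD = module_homD[OF a(1)] and bD = module_homD[OF a(2)]
    and a'D = module_homD[OF a'(1)] and b'D = module_homD[OF a'(2)]
    and hD = module_homD[OF m(5)] and h'D = module_homD[OF m(6)]
  have K: "a_kernel U V k = {x \<in> carrier U. k x = \<zero>\<^bsub>V\<^esub>}"
    for U :: "('r, 's) module" and V :: "('r, 't) module" and k
    by (simp add: a_kernel_def kernel_def)
  show ?thesis
  proof (cases p)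
    case Kernel
    then have i: "module_iso R (kernel_module A B h) N" "module_iso R (kernel_module A' B' h') N'"
      using N N' by (auto simp: is_hom_part_def)
    have "a \<in> module_hom R (kernel_module A B h) (kernel_module A' B' h')"
      "a' \<in> module_hom R (kernel_module A' B' h') (kernel_module A B h)"
      using aD a(3) a'D a'(3) module_hom_zero[OF m(2,4) a(2)] module_hom_zero[OF m(4,2) a'(2)]
      by (auto intro!: module_homI simp: kernel_module_def K)
    then have "mod_retract R (kernel_module A B h) (kernel_module A' B' h')"
      using i id(1) unfolding mod_retract_def module_iso_def by (auto simp: kernel_module_def K intro!: bexI[of _ a] bexI[of _ a'])
    then show ?thesis using mod_retract_iso i by blast
  next
    case Image
    then have i: "module_iso R (image_module A B h) N" "module_iso R (image_module A' B' h') N'"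
      using N N' by (auto simp: is_hom_part_def)
    have "b \<in> module_hom R (image_module A B h) (image_module A' B' h')"
      using aD a(3)[symmetric] bD hD by (intro module_homI) (auto simp: image_module_def)
    moreover have "b' \<in> module_hom R (image_module A' B' h') (image_module A B h)"
      using a'D a'(3)[symmetric] b'D h'D by (intro module_homI) (auto simp: image_module_def)
    ultimately have "mod_retract R (image_module A B h) (image_module A' B' h')"
      using i id(2) hD unfolding mod_retract_def module_iso_def
      by (auto simp: image_module_def intro!: bexI[of _ b] bexI[of _ b'])
    then show ?thesis using mod_retract_iso i by blast
  next
    case Cokernel
    then have i: "module_iso R (cokernel_module A B h) N" "module_iso R (cokernel_module A' B' h') N'"
      using N N' by (auto simp: is_hom_part_def)
    have s: "subq R B (carrier B) (h ` carrier A) (cokernel_module A B h) (\<lambda>x. h ` carrier A +>\<^bsub>B\<^esub> x)"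
      using subq_quotient[OF m(2) submodule_self[OF m(2)] submodule_image[OF m(1,2,5) submodule_self[OF m(1)]]] hD(1)
      by (auto simp: cokernel_module_def)
    have s': "subq R B' (carrier B') (h' ` carrier A') (cokernel_module A' B' h') (\<lambda>x. h' ` carrier A' +>\<^bsub>B'\<^esub> x)"
      using subq_quotient[OF m(4) submodule_self[OF m(4)] submodule_image[OF m(3,4,6) submodule_self[OF m(3)]]] h'D(1)
      by (auto simp: cokernel_module_def)
    have "b ` carrier B \<subseteq> carrier B'" "b ` h ` carrier A \<subseteq> h' ` carrier A'"
      "b' ` carrier B' \<subseteq> carrier B" "b' ` h' ` carrier A' \<subseteq> h ` carrier A"
      using bD(1) b'D(1) a(3)[symmetric] a'(3)[symmetric] aD(1) a'D(1) by auto
    then obtain u v where u: "u \<in> module_hom R (cokernel_module A B h) (cokernel_module A' B' h')"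
        "\<And>x. x \<in> carrier B \<Longrightarrow> u (h ` carrier A +>\<^bsub>B\<^esub> x) = h' ` carrier A' +>\<^bsub>B'\<^esub> b x"
      and v: "v \<in> module_hom R (cokernel_module A' B' h') (cokernel_module A B h)"
        "\<And>x. x \<in> carrier B' \<Longrightarrow> v (h' ` carrier A' +>\<^bsub>B'\<^esub> x) = h ` carrier A +>\<^bsub>B\<^esub> b' x"
      using subq_map[OF s s' a(2)] subq_map[OF s' s a'(2)] by metis
    have "v (u q) = q" if q: "q \<in> carrier (cokernel_module A B h)" for q
    proof -
      obtain x where "x \<in> carrier B" "q = h ` carrier A +>\<^bsub>B\<^esub> x" using subqD(11)[OF s q] by blast
      then show ?thesis using u(2) v(2) bD(1) id(2) by simp
    qed
    then have "mod_retract R (cokernel_module A B h) (cokernel_module A' B' h')"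
      using i u(1) v(1) unfolding mod_retract_def module_iso_def by blast
    then show ?thesis using mod_retract_iso i by blast
  qed
qed

lemma arrow_retract_source: "arrow_retract R A B h A' B' h' \<Longrightarrow> mod_retract R A A'"
  unfolding arrow_retract_def arrow_map_def mod_retract_def by blast

section \<open>Maps between subquotients given on representatives\<close>

definition sub_map :: "('a, 'x) ring_scheme \<Rightarrow> ('a, 'm) module \<Rightarrow> 'm set \<Rightarrow> 'm set \<Rightarrow>
    ('a, 'n) module \<Rightarrow> 'n set \<Rightarrow> 'n set \<Rightarrow> ('m \<Rightarrow> 'n) \<Rightarrow> bool" where
  "sub_map R M Z B M' Z' B' \<phi> \<longleftrightarrow> \<phi> \<in> module_hom R M M' \<and> \<phi> ` Z \<subseteq> Z' \<and> \<phi> ` B \<subseteq> B'"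

text \<open>The two clauses added to \<open>sub_map\<close> express injectivity and surjectivity of
  the induced map from \<open>Z / B\<close> to \<open>Z' / B'\<close> without forming the
  quotients.\<close>

definition sub_iso :: "('a, 'x) ring_scheme \<Rightarrow> ('a, 'm) module \<Rightarrow> 'm set \<Rightarrow> 'm set \<Rightarrow>
    ('a, 'n) module \<Rightarrow> 'n set \<Rightarrow> 'n set \<Rightarrow> ('m \<Rightarrow> 'n) \<Rightarrow> bool" where
  "sub_iso R M Z B M' Z' B' \<phi> \<longleftrightarrow> sub_map R M Z B M' Z' B' \<phi> \<and>
     (\<forall>x\<in>Z. \<phi> x \<in> B' \<longrightarrow> x \<in> B) \<and> (\<forall>y\<in>Z'. \<exists>x\<in>Z. \<phi> x \<ominus>\<^bsub>M'\<^esub> y \<in> B')"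

text \<open>A map \<open>h\<close> between subquotients that is induced by a map \<open>k\<close> of
  the ambient modules. For the long exact sequence \<open>k\<close> is an identity or a
  differential, so squares of cohomology modules commute because squares of complexes do.\<close>

definition presented ::
    "('a, 'x) ring_scheme \<Rightarrow> ('a, 'm) module \<Rightarrow> 'm set \<Rightarrow> 'm set \<Rightarrow> ('a, 'p) module \<Rightarrow> ('m \<Rightarrow> 'p) \<Rightarrow>
     ('a, 'm) module \<Rightarrow> 'm set \<Rightarrow> 'm set \<Rightarrow> ('a, 'q) module \<Rightarrow> ('m \<Rightarrow> 'q) \<Rightarrow> ('p \<Rightarrow> 'q) \<Rightarrow> ('m \<Rightarrow> 'm) \<Rightarrow> bool"
  where "presented R M Z B A \<kappa> M' Z' B' A' \<kappa>' h k \<longleftrightarrow> subq R M Z B A \<kappa> \<and> subq R M' Z' B' A' \<kappa>' \<and>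
     k \<in> module_hom R M M' \<and> k ` Z \<subseteq> Z' \<and> k ` B \<subseteq> B' \<and> (\<forall>x\<in>Z. h (\<kappa> x) = \<kappa>' (k x))"

lemma presented_hom:
  assumes "presented R M Z B A \<kappa> M' Z' B' A' \<kappa>' h k"
  shows "h \<in> module_hom R A A'"
proof -
  have p: "subq R M Z B A \<kappa>" "subq R M' Z' B' A' \<kappa>'" "k \<in> module_hom R M M'" "k ` Z \<subseteq> Z'" "k ` B \<subseteq> B'"
    "\<And>x. x \<in> Z \<Longrightarrow> h (\<kappa> x) = \<kappa>' (k x)" using assms by (auto simp: presented_def)
  obtain a where a: "a \<in> module_hom R A A'" "\<And>x. x \<in> Z \<Longrightarrow> a (\<kappa> x) = \<kappa>' (k x)"
    using subq_map[OF p(1-5)] by blast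
  have "h q = a q" if "q \<in> carrier A" for q
    using subqD(11)[OF p(1) that] a(2) p(6) by metis
  then show ?thesis by (rule module_hom_cong[OF a(1) _ subqD(2)[OF p(1)]])
qed

lemma presented_arrow_map:
  assumes 1: "presented R M Z B A \<kappa> M' Z' B' A' \<kappa>' h k"
    and 2: "presented R N U C D \<nu> N' U' C' D' \<nu>' h' k'"
    and f: "sub_map R M Z B N U C f" and f': "sub_map R M' Z' B' N' U' C' f'"
    and comm: "\<And>x. x \<in> Z \<Longrightarrow> f' (k x) = k' (f x)"
  obtains a b where "arrow_map R A A' h D D' h' a b" "\<And>x. x \<in> Z \<Longrightarrow> a (\<kappa> x) = \<nu> (f x)"
    "\<And>x. x \<in> Z' \<Longrightarrow> b (\<kappa>' x) = \<nu>' (f' x)"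
proof -
  have p: "subq R M Z B A \<kappa>" "subq R M' Z' B' A' \<kappa>'" "k ` Z \<subseteq> Z'"
    "\<And>x. x \<in> Z \<Longrightarrow> h (\<kappa> x) = \<kappa>' (k x)" using 1 by (auto simp: presented_def)
  have q: "subq R N U C D \<nu>" "subq R N' U' C' D' \<nu>'"
    "\<And>x. x \<in> U \<Longrightarrow> h' (\<nu> x) = \<nu>' (k' x)" using 2 by (auto simp: presented_def)
  have fD: "f \<in> module_hom R M N" "f ` Z \<subseteq> U" "f ` B \<subseteq> C"
    "f' \<in> module_hom R M' N'" "f' ` Z' \<subseteq> U'" "f' ` B' \<subseteq> C'" using f f' by (auto simp: sub_map_def)
  obtain a where a: "a \<in> module_hom R A D" "\<And>x. x \<in> Z \<Longrightarrow> a (\<kappa> x) = \<nu> (f x)"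
    using subq_map[OF p(1) q(1) fD(1-3)] by blast
  obtain b where b: "b \<in> module_hom R A' D'" "\<And>x. x \<in> Z' \<Longrightarrow> b (\<kappa>' x) = \<nu>' (f' x)"
    using subq_map[OF p(2) q(2) fD(4-6)] by blast
  have "h' (a q) = b (h q)" if qA: "q \<in> carrier A" for q
  proof -
    obtain x where x: "x \<in> Z" "q = \<kappa> x" using subqD(11)[OF p(1) qA] by blast
    then have "f x \<in> U" "k x \<in> Z'" using fD(2) p(3) by auto
    then show ?thesis using x a(2) b(2) p(4) q(3) comm by simp
  qed
  then show thesis using that[of a b] a b by (simp add: arrow_map_def)
qed

text \<open>The zigzag in terms of representatives. The three presented maps belong, in this order,
  to a resolution, an intermediate injective resolution, and the flasque resolution to be compared
  with it.\<close>

lemma presented_retract: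
  assumes 1: "presented R M Z B A \<kappa> M' Z' B' A' \<kappa>' h k"
    and 2: "presented R N U C D \<nu> N' U' C' D' \<nu>' h2 k2"
    and 3: "presented R P V F G \<mu> P' V' F' G' \<mu>' h3 k3"
    and f: "sub_map R M Z B N U C f" "sub_map R M' Z' B' N' U' C' f'" "\<And>x. x \<in> Z \<Longrightarrow> f' (k x) = k2 (f x)"
    and g: "sub_map R N U C M Z B g" "sub_map R N' U' C' M' Z' B' g'" "\<And>x. x \<in> U \<Longrightarrow> g' (k2 x) = k (g x)"
    and c: "sub_iso R P V F N U C c" "sub_iso R P' V' F' N' U' C' c'" "\<And>x. x \<in> V \<Longrightarrow> c' (k3 x) = k2 (c x)"
    and gf: "sub_iso R M Z B M Z B (\<lambda>x. g (f x))" "sub_iso R M' Z' B' M' Z' B' (\<lambda>x. g' (f' x))"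
  shows "arrow_retract R A A' h G G' h3"
proof -
  have s: "subq R M Z B A \<kappa>" "subq R M' Z' B' A' \<kappa>'" "subq R N U C D \<nu>" "subq R N' U' C' D' \<nu>'"
    "subq R P V F G \<mu>" "subq R P' V' F' G' \<mu>'"
    using 1 2 3 by (auto simp: presented_def)
  obtain a b where a: "arrow_map R A A' h D D' h2 a b" "\<And>x. x \<in> Z \<Longrightarrow> a (\<kappa> x) = \<nu> (f x)"
    "\<And>x. x \<in> Z' \<Longrightarrow> b (\<kappa>' x) = \<nu>' (f' x)"
    using presented_arrow_map[OF 1 2 f] by blast
  obtain a' b' where a': "arrow_map R D D' h2 A A' h a' b'" "\<And>x. x \<in> U \<Longrightarrow> a' (\<nu> x) = \<kappa> (g x)"
    "\<And>x. x \<in> U' \<Longrightarrow> b' (\<nu>' x) = \<kappa>' (g' x)"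
    using presented_arrow_map[OF 2 1 g] by blast
  have cm: "sub_map R P V F N U C c" "sub_map R P' V' F' N' U' C' c'" using c by (auto simp: sub_iso_def)
  obtain e d where e: "arrow_map R G G' h3 D D' h2 e d" "\<And>x. x \<in> V \<Longrightarrow> e (\<mu> x) = \<nu> (c x)"
    "\<And>x. x \<in> V' \<Longrightarrow> d (\<mu>' x) = \<nu>' (c' x)"
    using presented_arrow_map[OF 3 2 cm c(3)] by blast
  have bij: "bij_betw q (carrier X) (carrier Y)"
    if "subq R X0 Z0 B0 X \<xi>" "subq R Y0 Z1 B1 Y \<eta>" "sub_iso R X0 Z0 B0 Y0 Z1 B1 t"
      "q \<in> module_hom R X Y" "\<And>x. x \<in> Z0 \<Longrightarrow> q (\<xi> x) = \<eta> (t x)"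
    for X0 :: "('a, 's) module" and Z0 B0 and X :: "('a, 't) module" and \<xi>
      and Y0 :: "('a, 'v) module" and Z1 B1 and Y :: "('a, 'w) module" and \<eta> t q
    using that(3) subq_map_bij[OF that(1,2) _ that(4,5)] unfolding sub_iso_def sub_map_def by blast
  have fU: "f x \<in> U" if "x \<in> Z" for x using f(1) that by (auto simp: sub_map_def)
  have fU': "f' x \<in> U'" if "x \<in> Z'" for x using f(2) that by (auto simp: sub_map_def)
  have h: "a \<in> module_hom R A D" "b \<in> module_hom R A' D'" "a' \<in> module_hom R D A" "b' \<in> module_hom R D' A'"
    "e \<in> module_hom R G D" "d \<in> module_hom R G' D'"
    using a(1) a'(1) e(1) by (auto simp: arrow_map_def)
  show ?thesis
  proof (rule arrow_retract_zigzag[OF subqD(2)[OF s(1)] subqD(2)[OF s(2)] subqD(2)[OF s(5)]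
        subqD(2)[OF s(6)] subqD(2)[OF s(3)] subqD(2)[OF s(4)] presented_hom[OF 1] presented_hom[OF 3] a(1) a'(1) e(1)])
    show "bij_betw (\<lambda>x. a' (a x)) (carrier A) (carrier A)"
      by (rule bij[OF s(1) s(1) gf(1) module_hom_comp[OF h(1,3)]]) (simp add: a a' fU)
    show "bij_betw (\<lambda>x. b' (b x)) (carrier A') (carrier A')"
      by (rule bij[OF s(2) s(2) gf(2) module_hom_comp[OF h(2,4)]]) (simp add: a a' fU')
    show "bij_betw e (carrier G) (carrier D)" by (rule bij[OF s(5) s(3) c(1) h(5) e(2)])
    show "bij_betw d (carrier G') (carrier D')" by (rule bij[OF s(6) s(4) c(2) h(6) e(3)])
  qed
qed

section \<open>Cohomology of sections with support\<close>

definition sec_Z where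
  "sec_Z R I E i = {x \<in> gam R I (obj E i). dmap E i x = \<zero>\<^bsub>obj E (Suc i)\<^esub>}"

definition sec_B where
  "sec_B R I E i = shift_dmap E i ` gam R I (shift_obj E i)"

text \<open>Together with \<open>rel_B\<close>, these are the preimages in \<Gamma>_I2 of the
  cocycles and coboundaries of the quotient complex. Relative cohomology becomes a subquotient of
  the term of \<open>E\<close> itself, and cosets of cosets disappear from the comparisons.\<close>

definition rel_Z where
  "rel_Z R I1 I2 E i = {x \<in> gam R I2 (obj E i). dmap E i x \<in> gam R I1 (obj E (Suc i))}"

definition rel_B where
  "rel_B R I1 I2 E i = {x \<in> gam R I2 (obj E i).
     \<exists>b\<in>gam R I2 (shift_obj E i). x \<ominus>\<^bsub>obj E i\<^esub> shift_dmap E i b \<in> gam R I1 (obj E i)}"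

lemma subq_minus:
  assumes "subq R M Z B A \<kappa>" "x \<in> Z" "y \<in> Z"
  shows "\<kappa> (x \<ominus>\<^bsub>M\<^esub> y) = \<kappa> x \<ominus>\<^bsub>A\<^esub> \<kappa> y"
proof -
  note s = subqD[OF assms(1)]
  interpret M: module R M by (rule s(1))
  interpret A: module R A by (rule s(2))
  have xy: "x \<ominus>\<^bsub>M\<^esub> y \<in> Z" by (rule submodule_minus[OF s(1,3) assms(2,3)])
  have "(x \<ominus>\<^bsub>M\<^esub> y) \<oplus>\<^bsub>M\<^esub> y = x" using assms s(6) by (intro M.M.minus_arith(3)) auto
  then have "\<kappa> (x \<ominus>\<^bsub>M\<^esub> y) \<oplus>\<^bsub>A\<^esub> \<kappa> y = \<kappa> x" using s(8)[OF xy assms(3)] by simp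
  then show ?thesis using A.M.minus_arith(5)[OF s(7)[OF xy] s(7)[OF assms(3)]] by simp
qed

text \<open>A subquotient of a subquotient is a single subquotient, with preimages under
  \<open>\<kappa>\<close> as numerator and denominator.\<close>

lemma subq_comp:
  assumes 1: "subq R M Z B A \<kappa>" and 2: "subq R A Z' B' A' \<kappa>'"
  shows "subq R M {x \<in> Z. \<kappa> x \<in> Z'} {x \<in> Z. \<kappa> x \<in> B'} A' (\<lambda>x. \<kappa>' (\<kappa> x))"
proof -
  note s = subqD[OF 1] and s' = subqD[OF 2]
  interpret M: module R M by (rule s(1))
  interpret A: module R A by (rule s(2))
  have k0: "\<kappa> \<zero>\<^bsub>M\<^esub> = \<zero>\<^bsub>A\<^esub>" using s(12) submodule_zero[OF s(3)] submodule_zero[OF s(4)] by blast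
  have sub: "submodule {x \<in> Z. \<kappa> x \<in> W} R M" if W: "submodule W R A" for W
  proof (rule submoduleI'[OF s(1)])
    show "\<zero>\<^bsub>M\<^esub> \<in> {x \<in> Z. \<kappa> x \<in> W}" using k0 submodule_zero[OF s(3)] submodule_zero[OF W] by simp
  qed (use s(6,8,9) M.submoduleE(4,5)[OF s(3)] A.submoduleE(4,5)[OF W] in auto)
  have "(\<lambda>x. \<kappa>' (\<kappa> x)) \<in> module_hom R (M\<lparr>carrier := {x \<in> Z. \<kappa> x \<in> Z'}\<rparr>) A'"
    using s s' by (intro module_homI) auto
  moreover have "(\<lambda>x. \<kappa>' (\<kappa> x)) ` {x \<in> Z. \<kappa> x \<in> Z'} = carrier A'"
  proof (intro equalityI subsetI)
    fix q assume "q \<in> carrier A'"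
    then obtain y where y: "y \<in> Z'" "q = \<kappa>' y" using s'(11) by blast
    then obtain x where "x \<in> Z" "y = \<kappa> x" using s(11) s'(6) by blast
    then show "q \<in> (\<lambda>x. \<kappa>' (\<kappa> x)) ` {x \<in> Z. \<kappa> x \<in> Z'}" using y by blast
  qed (use s' in auto)
  moreover have "\<kappa>' (\<kappa> x) = \<kappa>' (\<kappa> y) \<longleftrightarrow> x \<ominus>\<^bsub>M\<^esub> y \<in> {x \<in> Z. \<kappa> x \<in> B'}"
    if "x \<in> {x \<in> Z. \<kappa> x \<in> Z'}" "y \<in> {x \<in> Z. \<kappa> x \<in> Z'}" for x y
    using that s'(10) subq_minus[OF 1, of x y] submodule_minus[OF s(1,3), of x y] by simp
  ultimately show ?thesis
    unfolding subq_def using s(1) s'(2) sub[OF s'(3)] sub[OF s'(4)] s'(5) by blast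
qed

lemma a_r_coset_mem:
  assumes "module R M" "submodule H R M" "x \<in> carrier M" "y \<in> carrier M"
  shows "y \<in> H +>\<^bsub>M\<^esub> x \<longleftrightarrow> y \<ominus>\<^bsub>M\<^esub> x \<in> H"
proof -
  interpret M: module R M by fact
  have "y = (y \<ominus>\<^bsub>M\<^esub> x) \<oplus>\<^bsub>M\<^esub> x" using M.M.minus_arith(3)[OF assms(4,3)] by simp
  then have "y \<ominus>\<^bsub>M\<^esub> x \<in> H \<Longrightarrow> y \<in> H +>\<^bsub>M\<^esub> x" unfolding a_r_coset_def' by blast
  moreover have "y \<ominus>\<^bsub>M\<^esub> x \<in> H" if "y \<in> H +>\<^bsub>M\<^esub> x"
  proof -
    obtain h where "h \<in> H" "y = h \<oplus>\<^bsub>M\<^esub> x" using \<open>y \<in> H +>\<^bsub>M\<^esub> x\<close> by (auto simp: a_r_coset_def')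
    then show ?thesis using M.M.minus_arith(5)[of h x] M.submoduleE(1)[OF assms(2)] assms(3) by auto
  qed
  ultimately show ?thesis by blast
qed

section \<open>The long exact sequence of a pair as maps of subquotients\<close>

locale closed_pair =
  fixes R :: "('a, 'x) ring_scheme" (structure) and I1 I2 :: "'a set"
  assumes is_cring: "cring R" and noetherian: "noetherian_ring R"
    and ideal1: "ideal I1 R" and ideal2: "ideal I2 R"
    and closed_set_subset: "closed_set R I1 \<subseteq> closed_set R I2"
begin

lemma I_subset: "I1 \<subseteq> carrier R" "I2 \<subseteq> carrier R"
  using idealD(1) ideal1 ideal2 by auto

lemma gam_mono: "module R M \<Longrightarrow> gam R I1 M \<subseteq> gam R I2 M"
  using gam_mono_closed_set[OF noetherian _ ideal1 ideal2 closed_set_subset] .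

lemma supp:
  "module R M \<Longrightarrow> sections_supp R I1 M = gam R I1 M"
  "module R M \<Longrightarrow> sections_supp R I2 M = gam R I2 M"
  using sections_supp_eq_gam[OF noetherian] ideal1 ideal2 by auto

lemma subq_sections:
  fixes E :: "('a, 'e) cochain"
  assumes rE: "resolution R K E \<epsilon>" and I: "ideal I R"
  shows "subq R (obj E i) (sec_Z R I E i) (sec_B R I E i) (cohomology (sections_complex R I E) i)
      (\<lambda>x. sec_B R I E i +>\<^bsub>obj E i\<^esub> x)"
    and "coboundaries (sections_complex R I E) i = sec_B R I E i"
proof -
  note E = resolutionD[OF rE] and sh = shift_properties[OF rE]
  have IR: "I \<subseteq> carrier R" using idealD(1)[OF I] .
  have S: "sections_supp R I (obj E i) = gam R I (obj E i)" for i
    by (rule sections_supp_eq_gam[OF noetherian E(2) I])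
  have Z: "cocycles (sections_complex R I E) i = sec_Z R I E i"
    by (auto simp: cocycles_def sections_complex_def a_kernel_def kernel_def sec_Z_def S)
  have "gam R I (shift_obj E 0) = {\<zero>\<^bsub>obj E 0\<^esub>}"
    using submodule_zero[OF submodule_gam[OF sh(1)[of 0] IR]] gam_subset[of R I "shift_obj E 0"] by auto
  then show B: "coboundaries (sections_complex R I E) i = sec_B R I E i"
    by (cases i) (auto simp: coboundaries_def sections_complex_def sec_B_def S)
  interpret Ei: module R "obj E i" by (rule E(2))
  have sZ: "submodule (sec_Z R I E i) R (obj E i)"
  proof (rule submoduleI'[OF E(2)])
    note k = submodule_kernel[OF E(2) E(2) E(3)[of i]]
    show "\<zero>\<^bsub>obj E i\<^esub> \<in> sec_Z R I E i"
      using submodule_zero[OF submodule_gam[OF E(2)[of i] IR]] submodule_zero[OF k] by (simp add: sec_Z_def)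
    show "a \<oplus>\<^bsub>obj E i\<^esub> b \<in> sec_Z R I E i" if "a \<in> sec_Z R I E i" "b \<in> sec_Z R I E i" for a b
      using that Ei.submoduleE(5)[OF submodule_gam[OF E(2)[of i] IR], of a b] Ei.submoduleE(5)[OF k, of a b]
      by (auto simp: sec_Z_def gam_def)
    show "r \<odot>\<^bsub>obj E i\<^esub> a \<in> sec_Z R I E i" if "r \<in> carrier R" "a \<in> sec_Z R I E i" for r a
      using that Ei.submoduleE(4)[OF submodule_gam[OF E(2)[of i] IR], of r a] Ei.submoduleE(4)[OF k, of r a]
      by (auto simp: sec_Z_def gam_def)
  qed (auto simp: sec_Z_def gam_def)
  have sB: "submodule (sec_B R I E i) R (obj E i)"
    unfolding sec_B_def by (rule submodule_image[OF sh(1) E(2) sh(2) submodule_gam[OF sh(1) IR]])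
  have BZ: "sec_B R I E i \<subseteq> sec_Z R I E i"
    using gam_hom[OF sh(1) E(2) sh(2) IR] sh(3) gam_subset[of R I "shift_obj E i"]
    by (auto simp: sec_B_def sec_Z_def)
  have "cohomology (sections_complex R I E) i = quotient_module ((obj E i)\<lparr>carrier := sec_Z R I E i\<rparr>) (sec_B R I E i)"
    unfolding cohomology_def Z B by (simp add: sections_complex_def)
  then show "subq R (obj E i) (sec_Z R I E i) (sec_B R I E i) (cohomology (sections_complex R I E) i)
      (\<lambda>x. sec_B R I E i +>\<^bsub>obj E i\<^esub> x)"
    using subq_quotient[OF E(2) sZ sB BZ] by simp
qed

definition rel_coset :: "('a, 'e) cochain \<Rightarrow> nat \<Rightarrow> 'e \<Rightarrow> 'e set" where
  "rel_coset E i x = gam R I1 (obj E i) +>\<^bsub>obj E i\<^esub> x"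

definition rel_class :: "('a, 'e) cochain \<Rightarrow> nat \<Rightarrow> 'e \<Rightarrow> 'e set set" where
  "rel_class E i x = coboundaries (relative_complex R I1 I2 E) i
     +>\<^bsub>obj (relative_complex R I1 I2 E) i\<^esub> rel_coset E i x"

lemma subq_relative_obj:
  assumes rE: "resolution R K E \<epsilon>"
  shows "subq R (obj E i) (gam R I2 (obj E i)) (gam R I1 (obj E i))
    (obj (relative_complex R I1 I2 E) i) (rel_coset E i)"
proof -
  note E = resolutionD[OF rE]
  show ?thesis
    using subq_quotient[OF E(2) submodule_gam[OF E(2) I_subset(2)] submodule_gam[OF E(2) I_subset(1)]
        gam_mono[OF E(2)], of i]
    by (simp add: relative_complex_def sections_complex_def supp[OF E(2)] rel_coset_def[abs_def])
qed

lemma relative_dmap: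
  assumes rE: "resolution R K E \<epsilon>"
  shows "presented R (obj E i) (gam R I2 (obj E i)) (gam R I1 (obj E i))
      (obj (relative_complex R I1 I2 E) i) (rel_coset E i)
      (obj E (Suc i)) (gam R I2 (obj E (Suc i))) (gam R I1 (obj E (Suc i)))
      (obj (relative_complex R I1 I2 E) (Suc i)) (rel_coset E (Suc i))
      (dmap (relative_complex R I1 I2 E) i) (dmap E i)"
proof -
  note E = resolutionD[OF rE]
  note g = gam_hom[OF E(2) E(2) E(3)[of i]]
  have "dmap (relative_complex R I1 I2 E) i (rel_coset E i x) = rel_coset E (Suc i) (dmap E i x)"
    if x: "x \<in> gam R I2 (obj E i)" for x
    unfolding relative_complex_def rel_coset_def supp[OF E(2)] cochain.simps
  proof (rule set_add_image_coset[OF E(2) submodule_gam[OF E(2) I_subset(1)]])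
    have xc: "x \<in> carrier (obj E i)" using x gam_subset[of R I2 "obj E i"] by blast
    show "gam R I1 (obj E i) \<noteq> {}" using submodule_zero[OF submodule_gam[OF E(2) I_subset(1)]] by blast
    show "dmap E i x \<in> carrier (obj E (Suc i))" using module_homD(1)[OF E(3) xc] .
    fix a assume a: "a \<in> gam R I1 (obj E i)"
    show "dmap E i a \<in> gam R I1 (obj E (Suc i))" by (rule g[OF I_subset(1) a])
    show "dmap E i (a \<oplus>\<^bsub>obj E i\<^esub> x) = dmap E i a \<oplus>\<^bsub>obj E (Suc i)\<^esub> dmap E i x"
      using module_homD(2)[OF E(3) _ xc] a gam_subset[of R I1 "obj E i"] by blast
  qed
  then show ?thesis
    unfolding presented_def
    using subq_relative_obj[OF rE] E(3) g[OF I_subset(1)] g[OF I_subset(2)] by blast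
qed

lemma relative_cocycles_coboundaries:
  assumes rE: "resolution R K E \<epsilon>" and x: "x \<in> gam R I2 (obj E i)"
  shows "rel_coset E i x \<in> cocycles (relative_complex R I1 I2 E) i \<longleftrightarrow> x \<in> rel_Z R I1 I2 E i"
    and "rel_coset E i x \<in> coboundaries (relative_complex R I1 I2 E) i \<longleftrightarrow> x \<in> rel_B R I1 I2 E i"
proof -
  note E = resolutionD[OF rE] and sh = shift_properties[OF rE]
  note s = subqD[OF subq_relative_obj[OF rE]]
  note p = relative_dmap[OF rE]
  have d: "dmap (relative_complex R I1 I2 E) i (rel_coset E i x) = rel_coset E (Suc i) (dmap E i x)"
    "dmap E i x \<in> gam R I2 (obj E (Suc i))" if "x \<in> gam R I2 (obj E i)" for i x
    using p[of i] that by (auto simp: presented_def)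
  show "rel_coset E i x \<in> cocycles (relative_complex R I1 I2 E) i \<longleftrightarrow> x \<in> rel_Z R I1 I2 E i"
    using s(7)[OF x] s(12)[OF d(2)[OF x]] d(1)[OF x] x
    by (simp add: cocycles_def a_kernel_def kernel_def rel_Z_def)
  show "rel_coset E i x \<in> coboundaries (relative_complex R I1 I2 E) i \<longleftrightarrow> x \<in> rel_B R I1 I2 E i"
  proof (cases i)
    case 0
    interpret E0: module R "obj E 0" by (rule E(2))
    have "gam R I2 (shift_obj E 0) = {\<zero>\<^bsub>obj E 0\<^esub>}"
      using submodule_zero[OF submodule_gam[OF sh(1)[of 0] I_subset(2)]] gam_subset[of R I2 "shift_obj E 0"] by auto
    \<comment> \<open>In degree zero the only boundary is zero, so the condition is that the coset
      of \<open>x\<close> vanishes.\<close>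
    then have "x \<in> rel_B R I1 I2 E 0 \<longleftrightarrow> x \<in> gam R I1 (obj E 0)"
      using x 0 gam_subset[of R I2 "obj E 0"] by (auto simp: rel_B_def E0.M.minus_arith subset_iff)
    then show ?thesis using s(12)[OF x] 0 by (simp add: coboundaries_def)
  next
    case (Suc j)
    have "rel_coset E i x \<in> coboundaries (relative_complex R I1 I2 E) i \<longleftrightarrow>
      (\<exists>b\<in>gam R I2 (obj E j). rel_coset E i x = rel_coset E i (dmap E j b))"
    proof -
      have "carrier (obj (relative_complex R I1 I2 E) j) = rel_coset E j ` gam R I2 (obj E j)"
        using subqD(7,11)[OF subq_relative_obj[OF rE, of j]] by blast
      moreover have "dmap (relative_complex R I1 I2 E) j ` rel_coset E j ` gam R I2 (obj E j) =
          (\<lambda>b. rel_coset E (Suc j) (dmap E j b)) ` gam R I2 (obj E j)"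
        using d(1)[of _ j] by (simp add: image_image)
      ultimately show ?thesis using Suc by (auto simp: coboundaries_def)
    qed
    also have "\<dots> \<longleftrightarrow> x \<in> rel_B R I1 I2 E i"
      using s(10)[OF x] d(2)[of _ j] x Suc by (auto simp: rel_B_def)
    finally show ?thesis .
  qed
qed

text \<open>The terms of \<open>relative_complex\<close> are subquotients of those of
  \<open>E\<close>, and cohomology is a subquotient of these terms; the two presentations are
  composed.\<close>

lemma subq_relative:
  assumes rE: "resolution R K E \<epsilon>"
  shows "subq R (obj E i) (rel_Z R I1 I2 E i) (rel_B R I1 I2 E i)
      (cohomology (relative_complex R I1 I2 E) i) (rel_class E i)"
    and "submodule (coboundaries (relative_complex R I1 I2 E) i) R (obj (relative_complex R I1 I2 E) i)"
proof -
  note E = resolutionD[OF rE]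
  let ?C = "relative_complex R I1 I2 E"
  note s = subq_relative_obj[OF rE] and p = relative_dmap[OF rE]
  have m: "module R (obj ?C i)" for i by (rule subqD(2)[OF s])
  have d: "dmap ?C i \<in> module_hom R (obj ?C i) (obj ?C (Suc i))" for i by (rule presented_hom[OF p])
  have Z: "submodule (cocycles ?C i) R (obj ?C i)"
    using submodule_kernel[OF m m d[of i]] by (simp add: cocycles_def a_kernel_def kernel_def)
  show B: "submodule (coboundaries ?C i) R (obj ?C i)"
  proof (cases i)
    case 0
    interpret C0: module R "obj ?C 0" by (rule m)
    show ?thesis using 0 by (auto simp: coboundaries_def intro!: submoduleI'[OF m])
  next
    case (Suc j)
    then show ?thesis using submodule_image[OF m m d submodule_self[OF m]] by (simp add: coboundaries_def)
  qed
  have eq: "{x \<in> gam R I2 (obj E i). rel_coset E i x \<in> cocycles ?C i} = rel_Z R I1 I2 E i"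
    "{x \<in> gam R I2 (obj E i). rel_coset E i x \<in> coboundaries ?C i} = rel_B R I1 I2 E i"
    using relative_cocycles_coboundaries[OF rE] by (auto simp: rel_Z_def rel_B_def)
  have BZ: "coboundaries ?C i \<subseteq> cocycles ?C i"
  proof
    fix X assume X: "X \<in> coboundaries ?C i"
    interpret Ci: module R "obj ?C i" by (rule m)
    have "X \<in> carrier (obj ?C i)" using X Ci.submoduleE(1)[OF B] by blast
    then obtain x where x: "x \<in> gam R I2 (obj E i)" "X = rel_coset E i x" using subqD(11)[OF s] by blast
    then have "x \<in> rel_B R I1 I2 E i" using X relative_cocycles_coboundaries(2)[OF rE] by blast
    then obtain b where b: "b \<in> gam R I2 (shift_obj E i)"
      "x \<ominus>\<^bsub>obj E i\<^esub> shift_dmap E i b \<in> gam R I1 (obj E i)" by (auto simp: rel_B_def)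
    note sh = shift_properties[OF rE]
    have bc: "b \<in> carrier (shift_obj E i)" using b(1) gam_subset[of R I2 "shift_obj E i"] by blast
    have xc: "x \<in> carrier (obj E i)" using x(1) gam_subset[of R I2 "obj E i"] by blast
    interpret Es: module R "obj E (Suc i)" by (rule E(2))
    have "dmap E i (x \<ominus>\<^bsub>obj E i\<^esub> shift_dmap E i b) = dmap E i x"
      using module_hom_minus[OF E(2) E(2) E(3)[of i] xc module_homD(1)[OF sh(2) bc]] sh(3)[OF bc]
        module_homD(1)[OF E(3) xc] by (simp add: Es.M.minus_arith)
    then have "dmap E i x \<in> gam R I1 (obj E (Suc i))" using gam_hom[OF E(2) E(2) E(3) I_subset(1) b(2)] by simp
    then have "x \<in> rel_Z R I1 I2 E i" using x by (simp add: rel_Z_def)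
    then show "X \<in> cocycles ?C i" using relative_cocycles_coboundaries(1)[OF rE x(1)] x(2) by blast
  qed
  from subq_comp[OF s subq_quotient[OF m Z B BZ]]
  show "subq R (obj E i) (rel_Z R I1 I2 E i) (rel_B R I1 I2 E i) (cohomology ?C i) (rel_class E i)"
    unfolding eq by (simp add: cohomology_def rel_class_def[abs_def])
qed

text \<open>On representatives this map is the identity of \<open>obj E i\<close>, as is the
  projection; only the connecting map involves the differential.\<close>

lemma presented_inclusion:
  assumes rE: "resolution R K E \<epsilon>"
  shows "presented R (obj E i) (sec_Z R I1 E i) (sec_B R I1 E i) (cohomology (sections_complex R I1 E) i)
      (\<lambda>x. sec_B R I1 E i +>\<^bsub>obj E i\<^esub> x)
      (obj E i) (sec_Z R I2 E i) (sec_B R I2 E i) (cohomology (sections_complex R I2 E) i)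
      (\<lambda>x. sec_B R I2 E i +>\<^bsub>obj E i\<^esub> x) (les_inclusion R I1 I2 E i) (\<lambda>x. x)"
proof -
  note E = resolutionD[OF rE] and sh = shift_properties[OF rE]
  note s1 = subq_sections[OF rE ideal1, of i] and s2 = subq_sections[OF rE ideal2, of i]
  have Z: "sec_Z R I1 E i \<subseteq> sec_Z R I2 E i" and B: "sec_B R I1 E i \<subseteq> sec_B R I2 E i"
    using gam_mono[OF E(2)] gam_mono[OF sh(1)] by (fastforce simp: sec_Z_def sec_B_def)+
  have "les_inclusion R I1 I2 E i (sec_B R I1 E i +>\<^bsub>obj E i\<^esub> x) = sec_B R I2 E i +>\<^bsub>obj E i\<^esub> x"
    if x: "x \<in> sec_Z R I1 E i" for x
  proof -
    have "sec_B R I2 E i <+>\<^bsub>obj E i\<^esub> (\<lambda>x. x) ` (sec_B R I1 E i +>\<^bsub>obj E i\<^esub> x) = sec_B R I2 E i +>\<^bsub>obj E i\<^esub> x"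
      by (rule set_add_image_coset[OF E(2) subqD(4)[OF s2(1)], where h = "\<lambda>x. x"])
        (use x subqD(6)[OF s1(1)] submodule_zero[OF subqD(4)[OF s1(1)]] B in auto)
    then show ?thesis by (simp add: les_inclusion_def cohomology_map_def s2(2)) (simp add: sections_complex_def)
  qed
  then show ?thesis
    unfolding presented_def using s1(1) s2(1) Z B module_hom_id by auto
qed

lemma presented_projection:
  assumes rE: "resolution R K E \<epsilon>"
  shows "presented R (obj E i) (sec_Z R I2 E i) (sec_B R I2 E i) (cohomology (sections_complex R I2 E) i)
      (\<lambda>x. sec_B R I2 E i +>\<^bsub>obj E i\<^esub> x)
      (obj E i) (rel_Z R I1 I2 E i) (rel_B R I1 I2 E i) (cohomology (relative_complex R I1 I2 E) i)
      (rel_class E i) (les_projection R I1 I2 E i) (\<lambda>x. x)"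
proof -
  note E = resolutionD[OF rE] and sh = shift_properties[OF rE]
  interpret Ei: module R "obj E i" by (rule E(2))
  note s2 = subq_sections[OF rE ideal2, of i] and r = subq_relative[OF rE, of i]
  note q = subq_relative_obj[OF rE, of i]
  have z: "\<zero>\<^bsub>obj E (Suc i)\<^esub> \<in> gam R I1 (obj E (Suc i))" "\<zero>\<^bsub>obj E i\<^esub> \<in> gam R I1 (obj E i)"
    using submodule_zero[OF submodule_gam[OF E(2) I_subset(1)]] by auto
  have Z: "sec_Z R I2 E i \<subseteq> rel_Z R I1 I2 E i" using z by (auto simp: sec_Z_def rel_Z_def)
  have B: "sec_B R I2 E i \<subseteq> rel_B R I1 I2 E i"
  proof
    fix x assume "x \<in> sec_B R I2 E i"
    then obtain b where b: "b \<in> gam R I2 (shift_obj E i)" "x = shift_dmap E i b" by (auto simp: sec_B_def)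
    then have "x \<in> gam R I2 (obj E i)" using gam_hom[OF sh(1) E(2) sh(2) I_subset(2)] by blast
    moreover have "x \<ominus>\<^bsub>obj E i\<^esub> x \<in> gam R I1 (obj E i)"
      using calculation gam_subset[of R I2 "obj E i"] z(2) by (auto simp: Ei.M.minus_arith)
    ultimately show "x \<in> rel_B R I1 I2 E i" using b by (auto simp: rel_B_def)
  qed
  have "les_projection R I1 I2 E i (sec_B R I2 E i +>\<^bsub>obj E i\<^esub> x) = rel_class E i x"
    if x: "x \<in> sec_Z R I2 E i" for x
  proof -
    have g: "y \<in> gam R I2 (obj E i)" if "y \<in> sec_Z R I2 E i \<or> y \<in> sec_B R I2 E i" for y
      using that B by (auto simp: sec_Z_def rel_B_def)
    have "coboundaries (relative_complex R I1 I2 E) i <+>\<^bsub>obj (relative_complex R I1 I2 E) i\<^esub>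
        rel_coset E i ` (sec_B R I2 E i +>\<^bsub>obj E i\<^esub> x) = rel_class E i x"
      unfolding rel_class_def
    proof (rule set_add_image_coset[OF subqD(2)[OF q] r(2)])
      show "sec_B R I2 E i \<noteq> {}" using submodule_zero[OF subqD(4)[OF s2(1)]] by blast
      show "rel_coset E i x \<in> carrier (obj (relative_complex R I1 I2 E) i)" using subqD(7)[OF q] g x by blast
      fix a assume a: "a \<in> sec_B R I2 E i"
      show "rel_coset E i a \<in> coboundaries (relative_complex R I1 I2 E) i"
        using relative_cocycles_coboundaries(2)[OF rE] g a B by blast
      show "rel_coset E i (a \<oplus>\<^bsub>obj E i\<^esub> x) = rel_coset E i a \<oplus>\<^bsub>obj (relative_complex R I1 I2 E) i\<^esub> rel_coset E i x"
        using subqD(8)[OF q] g a x by blast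
    qed
    then show ?thesis
      by (simp add: les_projection_def cohomology_map_def supp[OF E(2)] rel_coset_def[abs_def])
  qed
  then show ?thesis
    unfolding presented_def using s2(1) r(1) Z B module_hom_id by auto
qed

text \<open>The snake construction, where a relative cocycle \<open>x\<close> serves as its own
  lift. The set defining \<open>les_connecting\<close> is a full coset: lifts of representatives of
  one class differ by elements of \<open>rel_B\<close>, whose differentials lie in the image of
  \<Gamma>_I1, and all of that image is attained.\<close>

lemma presented_connecting:
  assumes rE: "resolution R K E \<epsilon>"
  shows "presented R (obj E i) (rel_Z R I1 I2 E i) (rel_B R I1 I2 E i)
      (cohomology (relative_complex R I1 I2 E) i) (rel_class E i)
      (obj E (Suc i)) (sec_Z R I1 E (Suc i)) (sec_B R I1 E (Suc i))
      (cohomology (sections_complex R I1 E) (Suc i)) (\<lambda>x. sec_B R I1 E (Suc i) +>\<^bsub>obj E (Suc i)\<^esub> x)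
      (les_connecting R I1 I2 E i) (dmap E i)"
proof -
  note E = resolutionD[OF rE] and sh = shift_properties[OF rE]
  interpret Ei: module R "obj E i" by (rule E(2))
  interpret Es: module R "obj E (Suc i)" by (rule E(2))
  note s1 = subq_sections[OF rE ideal1, of "Suc i"] and r = subq_relative[OF rE, of i]
  note q = subq_relative_obj[OF rE, of i]
  have g2: "x \<in> carrier (obj E i)" if "x \<in> gam R I2 (obj E i)" for x
    using that gam_subset[of R I2 "obj E i"] by blast
  have Z: "dmap E i ` rel_Z R I1 I2 E i \<subseteq> sec_Z R I1 E (Suc i)"
    using E(8) g2 by (auto simp: rel_Z_def sec_Z_def)
  have dB: "dmap E i x \<in> sec_B R I1 E (Suc i)" if x: "x \<in> rel_B R I1 I2 E i" for x
  proof -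
    obtain b where b: "b \<in> gam R I2 (shift_obj E i)" "x \<in> gam R I2 (obj E i)"
      "x \<ominus>\<^bsub>obj E i\<^esub> shift_dmap E i b \<in> gam R I1 (obj E i)" using x by (auto simp: rel_B_def)
    have bc: "b \<in> carrier (shift_obj E i)" using b(1) gam_subset[of R I2 "shift_obj E i"] by blast
    have xc: "x \<in> carrier (obj E i)" using g2[OF b(2)] .
    have "dmap E i (x \<ominus>\<^bsub>obj E i\<^esub> shift_dmap E i b) = dmap E i x"
      using module_hom_minus[OF E(2) E(2) E(3)[of i] xc module_homD(1)[OF sh(2) bc]] sh(3)[OF bc]
        module_homD(1)[OF E(3) xc] by (simp add: Es.M.minus_arith)
    then have "dmap E i x \<in> dmap E i ` gam R I1 (obj E i)" using b(3) by (metis image_eqI)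
    then show ?thesis by (simp add: sec_B_def)
  qed
  have "les_connecting R I1 I2 E i (rel_class E i x) = sec_B R I1 E (Suc i) +>\<^bsub>obj E (Suc i)\<^esub> dmap E i x"
    if x: "x \<in> rel_Z R I1 I2 E i" for x
  proof -
    let ?C = "relative_complex R I1 I2 E"
    have x2: "x \<in> gam R I2 (obj E i)" and dx: "dmap E i x \<in> gam R I1 (obj E (Suc i))"
      using x by (auto simp: rel_Z_def)
    have mem: "rel_coset E i b \<in> rel_class E i x \<longleftrightarrow> b \<ominus>\<^bsub>obj E i\<^esub> x \<in> rel_B R I1 I2 E i"
      if b: "b \<in> gam R I2 (obj E i)" for b
    proof -
      have "rel_coset E i b \<in> rel_class E i x \<longleftrightarrow>
        rel_coset E i b \<ominus>\<^bsub>obj ?C i\<^esub> rel_coset E i x \<in> coboundaries ?C i"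
        unfolding rel_class_def
        by (rule a_r_coset_mem[OF subqD(2)[OF q] r(2) subqD(7)[OF q x2] subqD(7)[OF q b]])
      also have "\<dots> \<longleftrightarrow> rel_coset E i (b \<ominus>\<^bsub>obj E i\<^esub> x) \<in> coboundaries ?C i"
        using subq_minus[OF q b x2] by simp
      also have "\<dots> \<longleftrightarrow> b \<ominus>\<^bsub>obj E i\<^esub> x \<in> rel_B R I1 I2 E i"
        by (rule relative_cocycles_coboundaries(2)[OF rE submodule_minus[OF E(2) subqD(3)[OF q] b x2]])
      finally show ?thesis .
    qed
    have mc: "a \<in> sec_B R I1 E (Suc i) +>\<^bsub>obj E (Suc i)\<^esub> dmap E i x \<longleftrightarrow>
        a \<ominus>\<^bsub>obj E (Suc i)\<^esub> dmap E i x \<in> sec_B R I1 E (Suc i)" if "a \<in> carrier (obj E (Suc i))" for a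
      by (rule a_r_coset_mem[OF E(2) subqD(4)[OF s1(1)] _ that]) (use dx gam_subset[of R I1 "obj E (Suc i)"] in blast)
    have min: "dmap E i (b \<ominus>\<^bsub>obj E i\<^esub> x) = dmap E i b \<ominus>\<^bsub>obj E (Suc i)\<^esub> dmap E i x"
      if "b \<in> gam R I2 (obj E i)" for b
      by (rule module_hom_minus[OF E(2) E(2) E(3) g2[OF that] g2[OF x2]])
    show ?thesis
    proof (intro equalityI subsetI)
      fix a assume "a \<in> les_connecting R I1 I2 E i (rel_class E i x)"
      then obtain b where b: "a \<in> gam R I1 (obj E (Suc i))" "b \<in> gam R I2 (obj E i)"
        "rel_coset E i b \<in> rel_class E i x" "a = dmap E i b"
        by (auto simp: les_connecting_def supp[OF E(2)] rel_coset_def)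
      then have "dmap E i (b \<ominus>\<^bsub>obj E i\<^esub> x) \<in> sec_B R I1 E (Suc i)" using mem dB by blast
      then show "a \<in> sec_B R I1 E (Suc i) +>\<^bsub>obj E (Suc i)\<^esub> dmap E i x"
        using mc[of a] min[OF b(2)] b(1,4) gam_subset[of R I1 "obj E (Suc i)"] by auto
    next
      fix a assume a: "a \<in> sec_B R I1 E (Suc i) +>\<^bsub>obj E (Suc i)\<^esub> dmap E i x"
      then obtain c where "c \<in> sec_B R I1 E (Suc i)" "a = c \<oplus>\<^bsub>obj E (Suc i)\<^esub> dmap E i x"
        by (auto simp: a_r_coset_def')
      then obtain w where w: "w \<in> gam R I1 (obj E i)" "a = dmap E i w \<oplus>\<^bsub>obj E (Suc i)\<^esub> dmap E i x"
        by (auto simp: sec_B_def)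
      have wc: "w \<in> carrier (obj E i)" using w(1) gam_subset[of R I1 "obj E i"] by blast
      have w2: "w \<in> gam R I2 (obj E i)" using w(1) gam_mono[OF E(2)] by blast
      \<comment> \<open>The lift that realises a prescribed element of the coset: adding
        \<open>w\<close> from \<Gamma>_I1 does not change the relative class of
        \<open>x\<close>.\<close>
      define b where "b = w \<oplus>\<^bsub>obj E i\<^esub> x"
      have b2: "b \<in> gam R I2 (obj E i)" using Ei.submoduleE(5)[OF subqD(3)[OF q] w2 x2] by (simp add: b_def)
      have bx: "b \<ominus>\<^bsub>obj E i\<^esub> x = w" using Ei.M.minus_arith(5)[OF wc g2[OF x2]] by (simp add: b_def)
      have z: "\<zero>\<^bsub>shift_obj E i\<^esub> \<in> gam R I2 (shift_obj E i)"
        by (rule submodule_zero[OF submodule_gam[OF sh(1) I_subset(2)]])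
      have "w \<ominus>\<^bsub>obj E i\<^esub> shift_dmap E i \<zero>\<^bsub>shift_obj E i\<^esub> = w"
        using module_hom_zero[OF sh(1) E(2) sh(2)] wc by (simp add: Ei.M.minus_arith)
      then have "w \<in> rel_B R I1 I2 E i"
        unfolding rel_B_def using w(1) w2 z by (intro CollectI conjI bexI[of _ "\<zero>\<^bsub>shift_obj E i\<^esub>"]) simp_all
      then have "rel_coset E i b \<in> rel_class E i x" using mem[OF b2] bx by simp
      moreover have "a = dmap E i b" using w(2) module_homD(2)[OF E(3) wc g2[OF x2]] by (simp add: b_def)
      moreover have "a \<in> gam R I1 (obj E (Suc i))"
        using w(2) Es.submoduleE(5)[OF submodule_gam[OF E(2) I_subset(1)] gam_hom[OF E(2) E(2) E(3) I_subset(1) w(1)] dx]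
        by simp
      ultimately show "a \<in> les_connecting R I1 I2 E i (rel_class E i x)"
        using b2 by (auto simp: les_connecting_def supp[OF E(2)] rel_coset_def)
    qed
  qed
  then show ?thesis
    unfolding presented_def using s1(1) r(1) Z dB E(3) by blast
qed

end

section \<open>Invariance under quasi-isomorphisms of flasque resolutions\<close>

lemma chain_map_shift:
  assumes rE: "resolution R K E \<epsilon>" and rG: "resolution R L G \<epsilon>'" and \<phi>: "chain_map R E G \<phi>"
    and I: "I \<subseteq> carrier R" and b: "b \<in> gam R I (shift_obj E i)"
  shows "\<exists>b'\<in>gam R I (shift_obj G i). \<phi> i (shift_dmap E i b) = shift_dmap G i b'"
proof (cases i)
  case 0
  note E = resolutionD[OF rE] and G = resolutionD[OF rG] and sh = shift_properties[OF rG]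
  have "b = \<zero>\<^bsub>obj E 0\<^esub>" using b gam_subset[of R I "shift_obj E 0"] 0 by auto
  moreover have "\<zero>\<^bsub>shift_obj G 0\<^esub> \<in> gam R I (shift_obj G 0)"
    by (rule submodule_zero[OF submodule_gam[OF sh(1) I]])
  ultimately show ?thesis
    using 0 module_hom_zero[OF E(2) G(2) chain_mapD(1)[OF \<phi>]] by auto
next
  case (Suc j)
  note E = resolutionD[OF rE] and G = resolutionD[OF rG]
  have "\<phi> j b \<in> gam R I (obj G j)"
    using gam_hom[OF E(2) G(2) chain_mapD(1)[OF \<phi>] I] b Suc by simp
  moreover have "b \<in> carrier (obj E j)" using b Suc gam_subset[of R I "obj E j"] by auto
  ultimately show ?thesis using Suc chain_mapD(2)[OF \<phi>] by auto
qed

lemma chain_map_sec: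
  assumes rE: "resolution R K E \<epsilon>" and rG: "resolution R L G \<epsilon>'" and \<phi>: "chain_map R E G \<phi>"
    and I: "I \<subseteq> carrier R"
  shows "sub_map R (obj E i) (sec_Z R I E i) (sec_B R I E i) (obj G i) (sec_Z R I G i) (sec_B R I G i) (\<phi> i)"
proof -
  note E = resolutionD[OF rE] and G = resolutionD[OF rG] and p = chain_mapD[OF \<phi>]
  have "\<phi> i x \<in> sec_Z R I G i" if x: "x \<in> sec_Z R I E i" for x
  proof -
    have "x \<in> carrier (obj E i)" using x gam_subset[of R I "obj E i"] by (auto simp: sec_Z_def)
    then show ?thesis
      using x gam_hom[OF E(2) G(2) p(1)[of i] I] p(2)[of x i] module_hom_zero[OF E(2) G(2) p(1)[of "Suc i"]]
      by (simp add: sec_Z_def)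
  qed
  moreover have "\<phi> i x \<in> sec_B R I G i" if "x \<in> sec_B R I E i" for x
    using that chain_map_shift[OF rE rG \<phi> I] by (fastforce simp: sec_B_def)
  ultimately show ?thesis unfolding sub_map_def using p(1) by blast
qed

lemma chain_map_rel:
  assumes rE: "resolution R K E \<epsilon>" and rG: "resolution R L G \<epsilon>'" and \<phi>: "chain_map R E G \<phi>"
    and I: "I1 \<subseteq> carrier R" "I2 \<subseteq> carrier R"
  shows "sub_map R (obj E i) (rel_Z R I1 I2 E i) (rel_B R I1 I2 E i)
    (obj G i) (rel_Z R I1 I2 G i) (rel_B R I1 I2 G i) (\<phi> i)"
proof -
  note E = resolutionD[OF rE] and G = resolutionD[OF rG] and p = chain_mapD[OF \<phi>]
  note sh = shift_properties[OF rE]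
  have "\<phi> i x \<in> rel_Z R I1 I2 G i" if x: "x \<in> rel_Z R I1 I2 E i" for x
  proof -
    have "x \<in> carrier (obj E i)" using x gam_subset[of R I2 "obj E i"] by (auto simp: rel_Z_def)
    then show ?thesis
      using x gam_hom[OF E(2) G(2) p(1)[of i] I(2), of x] p(2)[of x i]
        gam_hom[OF E(2) G(2) p(1)[of "Suc i"] I(1), of "dmap E i x"]
      by (simp add: rel_Z_def)
  qed
  moreover have "\<phi> i x \<in> rel_B R I1 I2 G i" if x: "x \<in> rel_B R I1 I2 E i" for x
  proof -
    obtain b where b: "x \<in> gam R I2 (obj E i)" "b \<in> gam R I2 (shift_obj E i)"
      "x \<ominus>\<^bsub>obj E i\<^esub> shift_dmap E i b \<in> gam R I1 (obj E i)" using x by (auto simp: rel_B_def)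
    have c: "x \<in> carrier (obj E i)" "b \<in> carrier (shift_obj E i)"
      using b gam_subset[of R I2 "obj E i"] gam_subset[of R I2 "shift_obj E i"] by auto
    obtain b' where b': "b' \<in> gam R I2 (shift_obj G i)" "\<phi> i (shift_dmap E i b) = shift_dmap G i b'"
      using chain_map_shift[OF rE rG \<phi> I(2) b(2)] by blast
    have "\<phi> i x \<ominus>\<^bsub>obj G i\<^esub> shift_dmap G i b' \<in> gam R I1 (obj G i)"
      using module_hom_minus[OF E(2) G(2) p(1)[of i] c(1) module_homD(1)[OF sh(2) c(2)]] b'(2)
        gam_hom[OF E(2) G(2) p(1)[of i] I(1) b(3)] by simp
    then show ?thesis unfolding rel_B_def using gam_hom[OF E(2) G(2) p(1)[of i] I(2) b(1)] b'(1) by blast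
  qed
  ultimately show ?thesis unfolding sub_map_def using p(1) by blast
qed

text \<open>It is instantiated twice: with a self-map of an injective resolution that lifts the
  identity, and with the comparison of a restricted resolution with an injective one.\<close>

locale flasque_qiso = closed_pair R I1 I2
  for R :: "('a, 'x) ring_scheme" (structure) and I1 I2 +
  fixes K :: "('a, 'k) module" and E :: "('a, 'e) cochain" and \<epsilon>
    and L :: "('a, 'l) module" and G :: "('a, 'g) cochain" and \<epsilon>' and \<phi> \<alpha>
  assumes rE: "resolution R K E \<epsilon>" and rG: "resolution R L G \<epsilon>'"
    and fE: "\<And>i. flasque R (obj E i) (carrier (obj E i))"
    and fG: "\<And>i. flasque R (obj G i) (carrier (obj G i))"
    and \<phi>: "chain_map R E G \<phi>" and \<alpha>: "bij_betw \<alpha> (carrier K) (carrier L)"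
    and \<phi>\<epsilon>: "\<And>x. x \<in> carrier K \<Longrightarrow> \<phi> 0 (\<epsilon> x) = \<epsilon>' (\<alpha> x)"
begin

text \<open>Exactness of the cone was shown for torsion with respect to finite sets, and a finite
  generating set of \<open>I\<close> has the same torsion.\<close>

lemma cone_ideal:
  assumes I: "ideal I R" and e: "e \<in> gam R I (obj E (Suc i))" and g: "g \<in> gam R I (obj G i)"
    and "dmap E (Suc i) e = \<zero>\<^bsub>obj E (Suc (Suc i))\<^esub>" "\<phi> (Suc i) e = dmap G i g"
  shows "\<exists>e'\<in>gam R I (obj E i). \<exists>g'\<in>gam R I (shift_obj G i).
        dmap E i e' = e \<and> \<phi> i e' \<ominus>\<^bsub>obj G i\<^esub> shift_dmap G i g' = g"
proof -
  obtain Y where Y: "Y \<subseteq> carrier R" "finite Y" "I = genideal R Y"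
    using noetherian_ring.finetely_gen[OF noetherian I] by blast
  note E = resolutionD[OF rE] and G = resolutionD[OF rG] and sh = shift_properties[OF rG]
  have g1: "gam R I (obj E i) = gam R Y (obj E i)" "gam R I (obj G i) = gam R Y (obj G i)"
    "gam R I (shift_obj G i) = gam R Y (shift_obj G i)" for i
    unfolding Y(3) by (rule gam_genideal[OF E(2) Y(1)] gam_genideal[OF G(2) Y(1)] gam_genideal[OF sh(1) Y(1)])+
  show ?thesis
    using cone_gam_exact(1)[OF rE rG fE fG \<phi> \<alpha> \<phi>\<epsilon> Y(2,1)] assms(2-5) unfolding g1 by blast
qed

lemma cone_zero:
  "e \<in> carrier (obj E 0) \<Longrightarrow> dmap E 0 e = \<zero>\<^bsub>obj E (Suc 0)\<^esub> \<Longrightarrow> \<phi> 0 e = \<zero>\<^bsub>obj G 0\<^esub> \<Longrightarrow> e = \<zero>\<^bsub>obj E 0\<^esub>"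
  using cone_gam_exact(2)[OF rE rG fE fG \<phi> \<alpha> \<phi>\<epsilon>, of "{}"] by blast

lemma shift_zero_gam: "ideal I R \<Longrightarrow> b \<in> gam R I (shift_obj G 0) \<Longrightarrow> b = \<zero>\<^bsub>obj G 0\<^esub>"
  using gam_subset[of R I "shift_obj G 0"] by auto

lemma zero_gam: "ideal I R \<Longrightarrow> \<zero>\<^bsub>obj E i\<^esub> \<in> gam R I (obj E i)" "ideal I R \<Longrightarrow> \<zero>\<^bsub>obj G i\<^esub> \<in> gam R I (obj G i)"
  "ideal I R \<Longrightarrow> \<zero>\<^bsub>shift_obj E i\<^esub> \<in> gam R I (shift_obj E i)"
  using submodule_zero[OF submodule_gam] resolutionD(2)[OF rE] resolutionD(2)[OF rG]
    shift_properties(1)[OF rE] idealD(1) by metis+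

text \<open>Both halves are exactness of the cone. If \<open>\<phi> x = d g\<close>, then
  \<open>(x, g)\<close> is a cone cocycle, which makes \<open>x\<close> a coboundary. For a cocycle
  \<open>y\<close> of \<open>G\<close>, so is \<open>(0, y)\<close>, which makes \<open>y\<close>
  cohomologous to the image of a cocycle of \<open>E\<close>.\<close>

lemma sec_iso:
  assumes I: "ideal I R"
  shows "sub_iso R (obj E i) (sec_Z R I E i) (sec_B R I E i) (obj G i) (sec_Z R I G i) (sec_B R I G i) (\<phi> i)"
proof -
  note E = resolutionD[OF rE] and G = resolutionD[OF rG] and p = chain_mapD[OF \<phi>]
  note shE = shift_properties[OF rE] and shG = shift_properties[OF rG]
  have IR: "I \<subseteq> carrier R" using idealD(1)[OF I] .
  have "x \<in> sec_B R I E i" if x: "x \<in> sec_Z R I E i" "\<phi> i x \<in> sec_B R I G i" for x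
  proof -
    obtain g where g: "g \<in> gam R I (shift_obj G i)" "\<phi> i x = shift_dmap G i g"
      using x(2) by (auto simp: sec_B_def)
    have xx: "x \<in> gam R I (obj E i)" "dmap E i x = \<zero>\<^bsub>obj E (Suc i)\<^esub>" using x(1) by (auto simp: sec_Z_def)
    show ?thesis
    proof (cases i)
      case 0
      then have "x = \<zero>\<^bsub>obj E 0\<^esub>"
        using cone_zero[of x] xx g shift_zero_gam[OF I, of g] gam_subset[of R I "obj E 0"] by auto
      then have "x = shift_dmap E i \<zero>\<^bsub>shift_obj E i\<^esub>" using 0 by simp
      then show ?thesis unfolding sec_B_def using zero_gam(3)[OF I] by blast
    next
      case (Suc j)
      then have "\<exists>e'\<in>gam R I (obj E j). \<exists>g'\<in>gam R I (shift_obj G j).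
          dmap E j e' = x \<and> \<phi> j e' \<ominus>\<^bsub>obj G j\<^esub> shift_dmap G j g' = g"
        using xx g by (intro cone_ideal[OF I]) auto
      then show ?thesis using Suc by (auto simp: sec_B_def)
    qed
  qed
  moreover have "\<exists>x\<in>sec_Z R I E i. \<phi> i x \<ominus>\<^bsub>obj G i\<^esub> y \<in> sec_B R I G i" if y: "y \<in> sec_Z R I G i" for y
  proof -
    interpret Gi: module R "obj G i" by (rule G(2))
    have yy: "y \<in> gam R I (obj G i)" "dmap G i y = \<zero>\<^bsub>obj G (Suc i)\<^esub>" using y by (auto simp: sec_Z_def)
    have "\<exists>e'\<in>gam R I (obj E i). \<exists>g'\<in>gam R I (shift_obj G i).
        dmap E i e' = \<zero>\<^bsub>obj E (Suc i)\<^esub> \<and> \<phi> i e' \<ominus>\<^bsub>obj G i\<^esub> shift_dmap G i g' = y"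
      using yy zero_gam[OF I] module_hom_zero[OF E(2) E(2) E(3)] module_hom_zero[OF E(2) G(2) p(1)]
      by (intro cone_ideal[OF I]) auto
    then obtain e' g' where e: "e' \<in> gam R I (obj E i)" "g' \<in> gam R I (shift_obj G i)"
      "dmap E i e' = \<zero>\<^bsub>obj E (Suc i)\<^esub>" "\<phi> i e' \<ominus>\<^bsub>obj G i\<^esub> shift_dmap G i g' = y" by blast
    have c: "\<phi> i e' \<in> carrier (obj G i)" "shift_dmap G i g' \<in> carrier (obj G i)"
      using e module_homD(1)[OF p(1)] module_homD(1)[OF shG(2)] gam_subset[of R I "obj E i"]
        gam_subset[of R I "shift_obj G i"] by blast+
    have "\<phi> i e' \<ominus>\<^bsub>obj G i\<^esub> y = shift_dmap G i g'"
      using Gi.M.minus_arith(7)[OF c] e(4) by simp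
    then show ?thesis using e by (auto simp: sec_Z_def sec_B_def)
  qed
  ultimately show ?thesis unfolding sub_iso_def using chain_map_sec[OF rE rG \<phi> IR] by blast
qed

text \<open>Exactness of \<open>\<Gamma>\<^bsub>Z2\<^esub>(C) / \<Gamma>\<^bsub>Z1\<^esub>(C)\<close> for the cone \<open>C\<close> follows from that of numerator and
  denominator.\<close>

lemma rel_cone:
  assumes e: "e \<in> gam R I2 (obj E (Suc i))" and g: "g \<in> gam R I2 (obj G i)"
    and de: "dmap E (Suc i) e \<in> gam R I1 (obj E (Suc (Suc i)))"
    and pe: "\<phi> (Suc i) e \<ominus>\<^bsub>obj G (Suc i)\<^esub> dmap G i g \<in> gam R I1 (obj G (Suc i))"
  shows "\<exists>e'\<in>gam R I2 (obj E i). \<exists>g'\<in>gam R I2 (shift_obj G i).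
    dmap E i e' \<ominus>\<^bsub>obj E (Suc i)\<^esub> e \<in> gam R I1 (obj E (Suc i)) \<and>
    (\<phi> i e' \<ominus>\<^bsub>obj G i\<^esub> shift_dmap G i g') \<ominus>\<^bsub>obj G i\<^esub> g \<in> gam R I1 (obj G i)"
proof -
  note E = resolutionD[OF rE] and G = resolutionD[OF rG] and p = chain_mapD[OF \<phi>]
  interpret Gi: module R "obj G i" by (rule G(2))
  interpret Gs: module R "obj G (Suc i)" by (rule G(2))
  interpret Gss: module R "obj G (Suc (Suc i))" by (rule G(2))
  interpret Es: module R "obj E (Suc i)" by (rule E(2))
  interpret Ess: module R "obj E (Suc (Suc i))" by (rule E(2))
  have ec: "e \<in> carrier (obj E (Suc i))" using e gam_subset[of R I2 "obj E (Suc i)"] by blast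
  have gc: "g \<in> carrier (obj G i)" using g gam_subset[of R I2 "obj G i"] by blast
  have pc: "\<phi> (Suc i) e \<in> carrier (obj G (Suc i))" "dmap G i g \<in> carrier (obj G (Suc i))"
    using module_homD(1)[OF p(1) ec] module_homD(1)[OF G(3) gc] .
  have "\<phi> (Suc (Suc i)) (dmap E (Suc i) e) = dmap G (Suc i) (\<phi> (Suc i) e \<ominus>\<^bsub>obj G (Suc i)\<^esub> dmap G i g)"
    using module_hom_minus[OF G(2) G(2) G(3)[of "Suc i"] pc] p(2)[OF ec] G(8)[OF gc]
      module_homD(1)[OF G(3) pc(1)] by (simp add: Gss.M.minus_arith)
  \<comment> \<open>The boundary of \<open>(e, g)\<close> in the cone is a cocycle with entries in
    \<Gamma>_I1, hence also the boundary of some \<open>(e1, g1)\<close> with entries in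
    \<Gamma>_I1. The difference of the two pairs is a cocycle in \<Gamma>_I2, to which exactness is
    applied again.\<close>
  then have "\<exists>e1\<in>gam R I1 (obj E (Suc i)). \<exists>g1\<in>gam R I1 (shift_obj G (Suc i)).
      dmap E (Suc i) e1 = dmap E (Suc i) e \<and>
      \<phi> (Suc i) e1 \<ominus>\<^bsub>obj G (Suc i)\<^esub> shift_dmap G (Suc i) g1 = \<phi> (Suc i) e \<ominus>\<^bsub>obj G (Suc i)\<^esub> dmap G i g"
    using de pe E(8)[OF ec] by (intro cone_ideal[OF ideal1]) auto
  then obtain e1 g1 where e1: "e1 \<in> gam R I1 (obj E (Suc i))" "g1 \<in> gam R I1 (obj G i)"
    "dmap E (Suc i) e1 = dmap E (Suc i) e"
    "\<phi> (Suc i) e1 \<ominus>\<^bsub>obj G (Suc i)\<^esub> dmap G i g1 = \<phi> (Suc i) e \<ominus>\<^bsub>obj G (Suc i)\<^esub> dmap G i g" by auto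
  have e1c: "e1 \<in> carrier (obj E (Suc i))" using e1(1) gam_subset[of R I1 "obj E (Suc i)"] by blast
  have g1c: "g1 \<in> carrier (obj G i)" using e1(2) gam_subset[of R I1 "obj G i"] by blast
  have p1c: "\<phi> (Suc i) e1 \<in> carrier (obj G (Suc i))" "dmap G i g1 \<in> carrier (obj G (Suc i))"
    using module_homD(1)[OF p(1) e1c] module_homD(1)[OF G(3) g1c] .
  let ?e = "e \<ominus>\<^bsub>obj E (Suc i)\<^esub> e1" and ?g = "g \<ominus>\<^bsub>obj G i\<^esub> g1"
  have e2: "?e \<in> gam R I2 (obj E (Suc i))"
    by (rule submodule_minus[OF E(2) submodule_gam[OF E(2) I_subset(2)] e]) (use e1(1) gam_mono[OF E(2)] in blast)
  have g2: "?g \<in> gam R I2 (obj G i)"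
    by (rule submodule_minus[OF G(2) submodule_gam[OF G(2) I_subset(2)] g]) (use e1(2) gam_mono[OF G(2)] in blast)
  have de2: "dmap E (Suc i) ?e = \<zero>\<^bsub>obj E (Suc (Suc i))\<^esub>"
    using module_hom_minus[OF E(2) E(2) E(3)[of "Suc i"] ec e1c] e1(3) module_homD(1)[OF E(3) ec]
    by (simp add: Ess.M.minus_arith)
  have swap: "a \<ominus>\<^bsub>obj G (Suc i)\<^esub> c = b \<ominus>\<^bsub>obj G (Suc i)\<^esub> d"
    if "a \<in> carrier (obj G (Suc i))" "b \<in> carrier (obj G (Suc i))" "c \<in> carrier (obj G (Suc i))"
      "d \<in> carrier (obj G (Suc i))" "c \<ominus>\<^bsub>obj G (Suc i)\<^esub> d = a \<ominus>\<^bsub>obj G (Suc i)\<^esub> b" for a b c d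
  proof -
    have "a = (c \<ominus>\<^bsub>obj G (Suc i)\<^esub> d) \<oplus>\<^bsub>obj G (Suc i)\<^esub> b" using that(5) Gs.M.minus_arith(3)[OF that(1,2)] by simp
    also have "\<dots> = c \<oplus>\<^bsub>obj G (Suc i)\<^esub> (b \<ominus>\<^bsub>obj G (Suc i)\<^esub> d)"
      using that by (simp add: Gs.minus_eq Gs.a_ac)
    finally show ?thesis using that Gs.M.minus_arith(5)[of "b \<ominus>\<^bsub>obj G (Suc i)\<^esub> d" c]
      by (simp add: Gs.a_comm)
  qed
  have "\<phi> (Suc i) ?e = dmap G i ?g"
    using module_hom_minus[OF E(2) G(2) p(1)[of "Suc i"] ec e1c] module_hom_minus[OF G(2) G(2) G(3)[of i] gc g1c]
      swap[OF pc(1) pc(2) p1c(1) p1c(2) e1(4)] by simp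
  then obtain e' g' where e': "e' \<in> gam R I2 (obj E i)" "g' \<in> gam R I2 (shift_obj G i)"
    "dmap E i e' = ?e" "\<phi> i e' \<ominus>\<^bsub>obj G i\<^esub> shift_dmap G i g' = ?g"
    using cone_ideal[OF ideal2 e2 g2 de2] by blast
  have "?e \<ominus>\<^bsub>obj E (Suc i)\<^esub> e = \<ominus>\<^bsub>obj E (Suc i)\<^esub> e1"
    using ec e1c by (simp add: Es.minus_eq Es.a_ac Es.r_neg Es.r_neg1 Es.r_neg2)
  moreover have "?g \<ominus>\<^bsub>obj G i\<^esub> g = \<ominus>\<^bsub>obj G i\<^esub> g1"
    using gc g1c by (simp add: Gi.minus_eq Gi.a_ac Gi.r_neg Gi.r_neg1 Gi.r_neg2)
  ultimately show ?thesis
    using e' Es.submoduleE(3)[OF submodule_gam[OF E(2) I_subset(1)] e1(1)]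
      Gi.submoduleE(3)[OF submodule_gam[OF G(2) I_subset(1)] e1(2)] by metis
qed

text \<open>The left end of \<open>rel_cone\<close>: exactness on \<Gamma>_I1 gives
  \<open>e'\<close> in \<Gamma>_I1 with the same boundary in the cone as \<open>e\<close>, and
  \<open>e' = e\<close> because the cone has no kernel in degree zero.\<close>

lemma rel_cone_zero:
  assumes e: "e \<in> gam R I2 (obj E 0)" and de: "dmap E 0 e \<in> gam R I1 (obj E (Suc 0))"
    and pe: "\<phi> 0 e \<in> gam R I1 (obj G 0)"
  shows "e \<in> gam R I1 (obj E 0)"
proof -
  note E = resolutionD[OF rE] and G = resolutionD[OF rG] and p = chain_mapD[OF \<phi>]
  interpret G0: module R "obj G 0" by (rule G(2))
  interpret E0: module R "obj E 0" by (rule E(2))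
  interpret E1: module R "obj E (Suc 0)" by (rule E(2))
  have ec: "e \<in> carrier (obj E 0)" using e gam_subset[of R I2 "obj E 0"] by blast
  have "\<exists>e'\<in>gam R I1 (obj E 0). \<exists>g'\<in>gam R I1 (shift_obj G 0).
        dmap E 0 e' = dmap E 0 e \<and> \<phi> 0 e' \<ominus>\<^bsub>obj G 0\<^esub> shift_dmap G 0 g' = \<phi> 0 e"
    using de pe E(8)[OF ec] p(2)[OF ec] by (intro cone_ideal[OF ideal1]) auto
  then obtain e' g' where e': "e' \<in> gam R I1 (obj E 0)" "g' \<in> gam R I1 (shift_obj G 0)" "dmap E 0 e' = dmap E 0 e"
    "\<phi> 0 e' \<ominus>\<^bsub>obj G 0\<^esub> shift_dmap G 0 g' = \<phi> 0 e" by blast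
  have e'c: "e' \<in> carrier (obj E 0)" using e'(1) gam_subset[of R I1 "obj E 0"] by blast
  have "\<phi> 0 e' = \<phi> 0 e"
    using e'(4) shift_zero_gam[OF ideal1 e'(2)] module_homD(1)[OF p(1) e'c] by (simp add: G0.M.minus_arith)
  then have "e' \<ominus>\<^bsub>obj E 0\<^esub> e = \<zero>\<^bsub>obj E 0\<^esub>"
    using module_hom_minus[OF E(2) E(2) E(3)[of 0] e'c ec] module_hom_minus[OF E(2) G(2) p(1)[of 0] e'c ec] e'(3)
      module_homD(1)[OF p(1) ec] module_homD(1)[OF E(3) ec] e'c ec
    by (intro cone_zero) (simp_all add: G0.M.minus_arith E1.M.minus_arith)
  then show ?thesis using e'(1) E0.M.minus_arith(6)[OF e'c ec] by simp
qed

text \<open>The argument of \<open>sec_iso\<close>, with all equations weakened to congruences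
  modulo \<Gamma>_I1.\<close>

lemma rel_iso:
  "sub_iso R (obj E i) (rel_Z R I1 I2 E i) (rel_B R I1 I2 E i)
    (obj G i) (rel_Z R I1 I2 G i) (rel_B R I1 I2 G i) (\<phi> i)"
proof -
  note E = resolutionD[OF rE] and G = resolutionD[OF rG] and p = chain_mapD[OF \<phi>]
  note shE = shift_properties[OF rE] and shG = shift_properties[OF rG]
  interpret Gi: module R "obj G i" by (rule G(2))
  interpret Gs: module R "obj G (Suc i)" by (rule G(2))
  interpret Ei: module R "obj E i" by (rule E(2))
  interpret Es: module R "obj E (Suc i)" by (rule E(2))
  have "x \<in> rel_B R I1 I2 E i" if x: "x \<in> rel_Z R I1 I2 E i" "\<phi> i x \<in> rel_B R I1 I2 G i" for x
  proof -
    obtain b where b: "b \<in> gam R I2 (shift_obj G i)" "\<phi> i x \<ominus>\<^bsub>obj G i\<^esub> shift_dmap G i b \<in> gam R I1 (obj G i)"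
      using x(2) by (auto simp: rel_B_def)
    have xx: "x \<in> gam R I2 (obj E i)" "dmap E i x \<in> gam R I1 (obj E (Suc i))"
      using x(1) by (auto simp: rel_Z_def)
    have xc: "x \<in> carrier (obj E i)" using xx gam_subset[of R I2 "obj E i"] by blast
    show ?thesis
    proof (cases i)
      case 0
      then have "x \<in> gam R I1 (obj E 0)"
        using rel_cone_zero[of x] xx b shift_zero_gam[OF ideal2, of b] module_homD(1)[OF p(1) xc]
        by (simp add: Gi.M.minus_arith[unfolded 0])
      then show ?thesis unfolding rel_B_def using 0 xx zero_gam(3)[OF ideal2, of 0] xc
        by (auto intro!: bexI[of _ "\<zero>\<^bsub>obj E 0\<^esub>"] simp: Ei.M.minus_arith[unfolded 0])
    next
      case (Suc j)
      then obtain e' where e': "e' \<in> gam R I2 (obj E j)" "dmap E j e' \<ominus>\<^bsub>obj E i\<^esub> x \<in> gam R I1 (obj E i)"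
        using rel_cone[of x j b] xx b by auto
      have "dmap E j e' \<in> carrier (obj E i)"
        using module_homD(1)[OF E(3)] e'(1) gam_subset[of R I2 "obj E j"] Suc by blast
      then have "x \<ominus>\<^bsub>obj E i\<^esub> dmap E j e' \<in> gam R I1 (obj E i)"
        using Ei.submoduleE(3)[OF submodule_gam[OF E(2) I_subset(1)] e'(2)] Ei.M.minus_arith(8)[of "dmap E j e'" x] xc
        by simp
      then show ?thesis unfolding rel_B_def using Suc xx(1) e'(1) by auto
    qed
  qed
  moreover have "\<exists>x\<in>rel_Z R I1 I2 E i. \<phi> i x \<ominus>\<^bsub>obj G i\<^esub> y \<in> rel_B R I1 I2 G i" if y: "y \<in> rel_Z R I1 I2 G i" for y
  proof -
    have yy: "y \<in> gam R I2 (obj G i)" "dmap G i y \<in> gam R I1 (obj G (Suc i))" using y by (auto simp: rel_Z_def)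
    have yc: "y \<in> carrier (obj G i)" using yy gam_subset[of R I2 "obj G i"] by blast
    have "\<zero>\<^bsub>obj G (Suc i)\<^esub> \<ominus>\<^bsub>obj G (Suc i)\<^esub> dmap G i y \<in> gam R I1 (obj G (Suc i))"
      by (rule submodule_minus[OF G(2) submodule_gam[OF G(2) I_subset(1)] zero_gam(2)[OF ideal1] yy(2)])
    then have "\<exists>e'\<in>gam R I2 (obj E i). \<exists>g'\<in>gam R I2 (shift_obj G i).
      dmap E i e' \<ominus>\<^bsub>obj E (Suc i)\<^esub> \<zero>\<^bsub>obj E (Suc i)\<^esub> \<in> gam R I1 (obj E (Suc i)) \<and>
      (\<phi> i e' \<ominus>\<^bsub>obj G i\<^esub> shift_dmap G i g') \<ominus>\<^bsub>obj G i\<^esub> y \<in> gam R I1 (obj G i)"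
      using yy(1) zero_gam(1)[OF ideal2] zero_gam(1)[OF ideal1] module_hom_zero[OF E(2) E(2) E(3)]
        module_hom_zero[OF E(2) G(2) p(1)]
      by (intro rel_cone) auto
    then obtain e' g' where e: "e' \<in> gam R I2 (obj E i)" "g' \<in> gam R I2 (shift_obj G i)"
      "dmap E i e' \<ominus>\<^bsub>obj E (Suc i)\<^esub> \<zero>\<^bsub>obj E (Suc i)\<^esub> \<in> gam R I1 (obj E (Suc i))"
      "(\<phi> i e' \<ominus>\<^bsub>obj G i\<^esub> shift_dmap G i g') \<ominus>\<^bsub>obj G i\<^esub> y \<in> gam R I1 (obj G i)" by blast
    have ec: "e' \<in> carrier (obj E i)" using e(1) gam_subset[of R I2 "obj E i"] by blast
    have c: "\<phi> i e' \<in> carrier (obj G i)" "shift_dmap G i g' \<in> carrier (obj G i)"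
      using e(2) module_homD(1)[OF p(1) ec] module_homD(1)[OF shG(2)]
        gam_subset[of R I2 "shift_obj G i"] by blast+
    have "e' \<in> rel_Z R I1 I2 E i"
      using e(1,3) module_homD(1)[OF E(3) ec] by (simp add: rel_Z_def Es.M.minus_arith)
    moreover have "\<phi> i e' \<ominus>\<^bsub>obj G i\<^esub> y \<in> rel_B R I1 I2 G i"
    proof -
      have "(\<phi> i e' \<ominus>\<^bsub>obj G i\<^esub> shift_dmap G i g') \<ominus>\<^bsub>obj G i\<^esub> y =
        (\<phi> i e' \<ominus>\<^bsub>obj G i\<^esub> y) \<ominus>\<^bsub>obj G i\<^esub> shift_dmap G i g'"
        using c yc by (simp add: Gi.minus_eq Gi.a_ac)
      moreover have "\<phi> i e' \<ominus>\<^bsub>obj G i\<^esub> y \<in> gam R I2 (obj G i)"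
        by (rule submodule_minus[OF G(2) submodule_gam[OF G(2) I_subset(2)] gam_hom[OF E(2) G(2) p(1) I_subset(2) e(1)] yy(1)])
      ultimately show ?thesis unfolding rel_B_def using e(2,4) by auto
    qed
    ultimately show ?thesis by blast
  qed
  ultimately show ?thesis unfolding sub_iso_def using chain_map_rel[OF rE rG \<phi> I_subset] by blast
qed

end

section \<open>Change of rings\<close>

context closed_pair
begin

context
  fixes K :: "('a, 'k) module" and E :: "('a, 'e) cochain" and \<epsilon>
    and L :: "('a, 'l) module" and X :: "('a, 'd) cochain" and \<epsilon>'
  assumes rE: "resolution R K E \<epsilon>" and bE: "\<And>i. baer R (obj E i)"
    and rX: "resolution R L X \<epsilon>'" and fX: "\<And>i. flasque R (obj X i) (carrier (obj X i))"
    and KL: "mod_retract R K L"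
begin

text \<open>An injective resolution \<open>G\<close> of \<open>L\<close> over \<open>R\<close> mediates between \<open>E\<close> and \<open>X\<close>: the modules of \<open>X\<close> need
  not be injective, so there may be no chain map from \<open>E\<close> to \<open>X\<close>.\<close>

lemma les_arrow_retract:
  "arrow_retract R (cohomology (sections_complex R I1 E) i) (cohomology (sections_complex R I2 E) i)
     (les_inclusion R I1 I2 E i)
     (cohomology (sections_complex R I1 X) i) (cohomology (sections_complex R I2 X) i)
     (les_inclusion R I1 I2 X i)"
  "arrow_retract R (cohomology (sections_complex R I2 E) i) (cohomology (relative_complex R I1 I2 E) i)
     (les_projection R I1 I2 E i)
     (cohomology (sections_complex R I2 X) i) (cohomology (relative_complex R I1 I2 X) i)
     (les_projection R I1 I2 X i)"
  "arrow_retract R (cohomology (relative_complex R I1 I2 E) i) (cohomology (sections_complex R I1 E) (Suc i))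
     (les_connecting R I1 I2 E i)
     (cohomology (relative_complex R I1 I2 X) i) (cohomology (sections_complex R I1 X) (Suc i))
     (les_connecting R I1 I2 X i)"
proof -
  obtain u v where u: "u \<in> module_hom R K L" and v: "v \<in> module_hom R L K"
    and vu: "\<And>x. x \<in> carrier K \<Longrightarrow> v (u x) = x" and L: "module R L"
    using KL by (auto simp: mod_retract_def)
  obtain G :: "('a, ('a, 'l) tm) cochain" and \<epsilon>G where
    rG: "resolution R L G \<epsilon>G" and bG: "\<And>i. baer R (obj G i)"
    using exists_injective_resolution[OF noetherian L] by blast
  \<comment> \<open>The maps \<open>\<phi>\<close> and \<open>\<psi>\<close> lift the two halves of
    the splitting; \<open>\<chi>\<close> lifts the identity of \<open>L\<close> and leads from
    \<open>X\<close> into the injective \<open>G\<close>.\<close>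
  obtain \<phi> where \<phi>: "chain_map R E G \<phi>" "\<And>x. x \<in> carrier K \<Longrightarrow> \<phi> 0 (\<epsilon> x) = \<epsilon>G (u x)"
    using exists_chain_map[OF rE rG bG u] by blast
  obtain \<psi> where \<psi>: "chain_map R G E \<psi>" "\<And>x. x \<in> carrier L \<Longrightarrow> \<psi> 0 (\<epsilon>G x) = \<epsilon> (v x)"
    using exists_chain_map[OF rG rE bE v] by blast
  obtain \<chi> where \<chi>: "chain_map R X G \<chi>" "\<And>x. x \<in> carrier L \<Longrightarrow> \<chi> 0 (\<epsilon>' x) = \<epsilon>G x"
    using exists_chain_map[OF rX rG bG module_hom_id] by blast
  note fE = baer_imp_flasque[OF noetherian bE] and fG = baer_imp_flasque[OF noetherian bG]
  \<comment> \<open>Composing \<open>\<psi>\<close> with \<open>\<phi>\<close> lifts the identity of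
    \<open>K\<close>, so the composite is bijective on cohomology.\<close>
  interpret EE: flasque_qiso R I1 I2 K E \<epsilon> K E \<epsilon> "\<lambda>i x. \<psi> i (\<phi> i x)" "\<lambda>x. x"
    using rE fE chain_map_comp[OF \<phi>(1) \<psi>(1)] \<phi>(2) \<psi>(2) vu module_homD(1)[OF u]
    by unfold_locales (auto simp: bij_betw_def)
  interpret XG: flasque_qiso R I1 I2 L X \<epsilon>' L G \<epsilon>G \<chi> "\<lambda>x. x"
    using rX rG fX fG \<chi> by unfold_locales (auto simp: bij_betw_def)
  note \<phi>D = chain_mapD(2)[OF \<phi>(1)] and \<psi>D = chain_mapD(2)[OF \<psi>(1)] and \<chi>D = chain_mapD(2)[OF \<chi>(1)]
  have s: "sub_map R (obj E i) (sec_Z R I E i) (sec_B R I E i) (obj G i) (sec_Z R I G i) (sec_B R I G i) (\<phi> i)"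
    "sub_map R (obj G i) (sec_Z R I G i) (sec_B R I G i) (obj E i) (sec_Z R I E i) (sec_B R I E i) (\<psi> i)"
    if "ideal I R" for I i
    by (rule chain_map_sec[OF rE rG \<phi>(1) idealD(1)[OF that]] chain_map_sec[OF rG rE \<psi>(1) idealD(1)[OF that]])+
  note r = chain_map_rel[OF rE rG \<phi>(1) I_subset] chain_map_rel[OF rG rE \<psi>(1) I_subset]
  have c: "x \<in> carrier (obj E i)" if "x \<in> rel_Z R I1 I2 E i" for x i
    using that gam_subset[of R I2 "obj E i"] by (auto simp: rel_Z_def)
  have cG: "x \<in> carrier (obj G i)" if "x \<in> rel_Z R I1 I2 G i" for x i
    using that gam_subset[of R I2 "obj G i"] by (auto simp: rel_Z_def)
  have cX: "x \<in> carrier (obj X i)" if "x \<in> rel_Z R I1 I2 X i" for x i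
    using that gam_subset[of R I2 "obj X i"] by (auto simp: rel_Z_def)
  show "arrow_retract R (cohomology (sections_complex R I1 E) i) (cohomology (sections_complex R I2 E) i)
     (les_inclusion R I1 I2 E i)
     (cohomology (sections_complex R I1 X) i) (cohomology (sections_complex R I2 X) i)
     (les_inclusion R I1 I2 X i)"
    by (rule presented_retract[OF presented_inclusion[OF rE] presented_inclusion[OF rG] presented_inclusion[OF rX]
          s(1)[OF ideal1] s(1)[OF ideal2] refl s(2)[OF ideal1] s(2)[OF ideal2] refl
          XG.sec_iso[OF ideal1] XG.sec_iso[OF ideal2] refl EE.sec_iso[OF ideal1] EE.sec_iso[OF ideal2]])
  show "arrow_retract R (cohomology (sections_complex R I2 E) i) (cohomology (relative_complex R I1 I2 E) i)
     (les_projection R I1 I2 E i)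
     (cohomology (sections_complex R I2 X) i) (cohomology (relative_complex R I1 I2 X) i)
     (les_projection R I1 I2 X i)"
    by (rule presented_retract[OF presented_projection[OF rE] presented_projection[OF rG] presented_projection[OF rX]
          s(1)[OF ideal2] r(1) refl s(2)[OF ideal2] r(2) refl
          XG.sec_iso[OF ideal2] XG.rel_iso refl EE.sec_iso[OF ideal2] EE.rel_iso])
  show "arrow_retract R (cohomology (relative_complex R I1 I2 E) i) (cohomology (sections_complex R I1 E) (Suc i))
     (les_connecting R I1 I2 E i)
     (cohomology (relative_complex R I1 I2 X) i) (cohomology (sections_complex R I1 X) (Suc i))
     (les_connecting R I1 I2 X i)"
    by (rule presented_retract[OF presented_connecting[OF rE] presented_connecting[OF rG] presented_connecting[OF rX]
          r(1) s(1)[OF ideal1] _ r(2) s(2)[OF ideal1] _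
          XG.rel_iso XG.sec_iso[OF ideal1] _ EE.rel_iso EE.sec_iso[OF ideal1]])
      (simp_all add: \<phi>D \<psi>D \<chi>D c cG cX)
qed

lemma les_part_retract:
  assumes "is_les_part R p m I1 I2 i E N" "is_les_part R p m I1 I2 i X N'"
  shows "mod_retract R N N'"
  using assms arrow_retract_hom_part[OF les_arrow_retract(1)] arrow_retract_hom_part[OF les_arrow_retract(2)]
    arrow_retract_hom_part[OF les_arrow_retract(3)]
  by (cases m) (auto simp: is_les_part_def)

lemma local_cohomology_retract:
  assumes "module_iso R (cohomology (sections_complex R I1 E) i) N"
    and "module_iso R (cohomology (sections_complex R I1 X) i) N'"
  shows "mod_retract R N N'"
  by (rule mod_retract_iso[OF arrow_retract_source[OF les_arrow_retract(1)] assms])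

end

end

lemma injective_resolution_imp_resolution:
  assumes "injective_resolution R M E \<epsilon>"
  shows "resolution R M E \<epsilon>" "\<And>i. baer R (obj E i)"
proof -
  show "baer R (obj E i)" for i
    using assms by (auto simp: injective_resolution_def intro: injective_module_imp_baer)
  then have "module R (obj E i)" for i by (simp add: baer_def)
  then show "resolution R M E \<epsilon>"
    using assms by (simp add: injective_resolution_def resolution_def cocycles_def coboundaries_def
      a_kernel_def kernel_def)
qed

section \<open>Restriction of scalars along the ring homomorphism\<close>

locale ring_change =
  fixes R :: "('a, 'x) ring_scheme" and S :: "('b, 'y) ring_scheme" and f :: "'a \<Rightarrow> 'b"
  assumes R: "cring R" "noetherian_ring R" and S: "cring S" "noetherian_ring S"
    and f: "f \<in> ring_hom R S"
begin

definition resc :: "('b, 'm) cochain \<Rightarrow> ('a, 'm) cochain" where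
  "resc C = \<lparr>obj = (\<lambda>i. restrict_scalars f (obj C i)), dmap = dmap C\<rparr>"

lemma resc_simps [simp]: "obj (resc C) i = restrict_scalars f (obj C i)" "dmap (resc C) = dmap C"
  by (simp_all add: resc_def)

lemma restrict_carrier_update:
  "(restrict_scalars f M)\<lparr>carrier := H\<rparr> = restrict_scalars f (M\<lparr>carrier := H\<rparr>)"
  by (simp add: restrict_scalars_def)

lemma restrict_coset [simp]:
  "H +>\<^bsub>restrict_scalars f M\<^esub> x = H +>\<^bsub>M\<^esub> x" "H <+>\<^bsub>restrict_scalars f M\<^esub> H' = H <+>\<^bsub>M\<^esub> H'"
  by (simp_all add: a_r_coset_def' set_add_def')

text \<open>Restriction changes only the scalar multiplication of the record; carriers and cosets
  stay the same. Hence this is an equation, and so are the later statements on complexes and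
  cohomology.\<close>

lemma restrict_quotient: "quotient_module (restrict_scalars f M) H = restrict_scalars f (quotient_module M H)"
  by (simp add: quotient_module_def restrict_scalars_def A_RCOSETS_def' a_r_coset_def' set_add_def' fun_eq_iff)

lemma restrict_hom: "h \<in> module_hom S M N \<Longrightarrow> h \<in> module_hom R (restrict_scalars f M) (restrict_scalars f N)"
  using ring_hom_closed[OF f] by (auto intro!: module_homI simp: module_homD)

lemma restrict_module: "module S M \<Longrightarrow> module R (restrict_scalars f M)"
  by (rule restrict_scalars_is_module[OF R(1) _ f])

lemma restrict_iso: "module_iso S M N \<Longrightarrow> module_iso R (restrict_scalars f M) (restrict_scalars f N)"
  by (auto simp: module_iso_def intro: restrict_module restrict_hom)

lemma restrict_kernel [simp]: "a_kernel (restrict_scalars f A) (restrict_scalars f B) h = a_kernel A B h"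
  by (simp add: a_kernel_def kernel_def)

lemma restrict_hom_part:
  "is_hom_part S p A B h N \<Longrightarrow>
    is_hom_part R p (restrict_scalars f A) (restrict_scalars f B) h (restrict_scalars f N)"
  by (cases p) (auto simp: is_hom_part_def kernel_module_def image_module_def cokernel_module_def
      restrict_carrier_update restrict_quotient intro: restrict_iso)

lemma restrict_resolution:
  assumes "resolution S M E \<epsilon>"
  shows "resolution R (restrict_scalars f M) (resc E) \<epsilon>"
  using assms unfolding resolution_def by (simp add: restrict_module restrict_hom)

lemma image_ideal_subset: "ideal I R \<Longrightarrow> f ` I \<subseteq> carrier S"
  using idealD(1)[of I R] ring_hom_closed[OF f] by auto

lemma extended_ideal_ideal: "ideal I R \<Longrightarrow> ideal (extended_ideal S f I) S"
  unfolding extended_ideal_def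
  by (rule ring.genideal_ideal[OF cring.axioms(1)[OF S(1)] image_ideal_subset])

text \<open>Both sides are the elements killed by powers of \<open>f a\<close> for each
  \<open>a\<close> in \<open>I\<close>; passing from the image of \<open>I\<close> to the ideal it
  generates does not change torsion.\<close>

lemma restrict_sections_supp:
  assumes I: "ideal I R" and M: "module S M"
  shows "sections_supp R I (restrict_scalars f M) = sections_supp S (extended_ideal S f I) M"
proof -
  have "gam S (extended_ideal S f I) M = gam S (f ` I) M"
    unfolding extended_ideal_def by (rule gam_genideal[OF M image_ideal_subset[OF I]])
  then show ?thesis
    using sections_supp_eq_gam[OF R(2) restrict_module[OF M] I] sections_supp_eq_gam[OF S(2) M extended_ideal_ideal[OF I]]
      gam_restrict_scalars[OF R(1) S(1) f idealD(1)[OF I], of M] by simp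
qed

lemma restrict_cohomology: "cohomology (resc C) i = restrict_scalars f (cohomology C i)"
proof -
  have "cocycles (resc C) i = cocycles C i" by (simp add: cocycles_def)
  moreover have "coboundaries (resc C) i = coboundaries C i" by (simp add: coboundaries_def split: nat.split)
  ultimately show ?thesis by (simp add: cohomology_def restrict_carrier_update restrict_quotient)
qed

lemma restrict_cohomology_map: "cohomology_map (resc C) i h = cohomology_map C i h"
proof -
  have "coboundaries (resc C) i = coboundaries C i" by (simp add: coboundaries_def split: nat.split)
  then show ?thesis by (simp add: cohomology_map_def fun_eq_iff)
qed

context
  fixes E :: "('b, 'm) cochain"
  assumes E: "\<And>i. module S (obj E i)"
begin

lemma restrict_sections_complex:
  "ideal I R \<Longrightarrow> sections_complex R I (resc E) = resc (sections_complex S (extended_ideal S f I) E)"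
  by (simp add: sections_complex_def resc_def restrict_carrier_update restrict_sections_supp[OF _ E])

lemma restrict_relative_complex:
  assumes "ideal I1 R" "ideal I2 R"
  shows "relative_complex R I1 I2 (resc E) =
    resc (relative_complex S (extended_ideal S f I1) (extended_ideal S f I2) E)"
  using assms
  by (simp add: relative_complex_def restrict_sections_complex restrict_sections_supp[OF _ E])
     (simp add: resc_def restrict_quotient)

lemma restrict_les_part:
  assumes I: "ideal I1 R" "ideal I2 R"
    and N: "is_les_part S p m (extended_ideal S f I1) (extended_ideal S f I2) i E N"
  shows "is_les_part R p m I1 I2 i (resc E) (restrict_scalars f N)"
proof -
  let ?J1 = "extended_ideal S f I1" and ?J2 = "extended_ideal S f I2"
  have "les_inclusion R I1 I2 (resc E) i = les_inclusion S ?J1 ?J2 E i"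
    using I by (simp add: les_inclusion_def restrict_sections_complex restrict_cohomology_map)
  moreover have "les_projection R I1 I2 (resc E) i = les_projection S ?J1 ?J2 E i"
    using I by (simp add: les_projection_def restrict_relative_complex restrict_cohomology_map
        restrict_sections_supp[OF _ E])
  moreover have "les_connecting R I1 I2 (resc E) i = les_connecting S ?J1 ?J2 E i"
    using I by (simp add: les_connecting_def[abs_def] restrict_sections_supp[OF _ E])
  ultimately show ?thesis
    using N I unfolding is_les_part_def
    by (cases m) (simp_all add: restrict_sections_complex restrict_relative_complex restrict_cohomology
        restrict_hom_part)
qed

end

lemma les_part_value_retract:
  assumes KL: "mod_retract R K (restrict_scalars f L)"
    and I: "ideal I1 R" "ideal I2 R" "closed_set R I1 \<subseteq> closed_set R I2"
    and E: "injective_resolution R K E \<epsilon>" and E': "injective_resolution S L E' \<epsilon>'"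
  shows "is_les_part R p m I1 I2 i E N \<Longrightarrow>
      is_les_part S p m (extended_ideal S f I1) (extended_ideal S f I2) i E' N' \<Longrightarrow>
      mod_retract R N (restrict_scalars f N')"
    and "module_iso R (cohomology (sections_complex R I1 E) i) N \<Longrightarrow>
      module_iso S (cohomology (sections_complex S (extended_ideal S f I1) E') i) N' \<Longrightarrow>
      mod_retract R N (restrict_scalars f N')"
proof -
  interpret closed_pair R I1 I2 using R I by (rule closed_pair.intro)
  note rE = injective_resolution_imp_resolution[OF E] and rE' = injective_resolution_imp_resolution[OF E']
  note m' = resolutionD(2)[OF rE'(1)]
  note rX = restrict_resolution[OF rE'(1)]
  have fX: "flasque R (obj (resc E') i) (carrier (obj (resc E') i))" for i
    using flasque_restrict_scalars[OF R(1) S(2) f rE'(2)] by simp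
  note ret = les_part_retract[OF rE rX fX KL] local_cohomology_retract[OF rE rX fX KL]
  show "mod_retract R N (restrict_scalars f N')"
    if "is_les_part R p m I1 I2 i E N"
      "is_les_part S p m (extended_ideal S f I1) (extended_ideal S f I2) i E' N'"
    using ret(1)[OF that(1) restrict_les_part[OF m' I(1,2) that(2)]] .
  show "mod_retract R N (restrict_scalars f N')"
    if N: "module_iso R (cohomology (sections_complex R I1 E) i) N"
      "module_iso S (cohomology (sections_complex S (extended_ideal S f I1) E') i) N'"
  proof (rule ret(2)[OF N(1)])
    show "module_iso R (cohomology (sections_complex R I1 (resc E')) i) (restrict_scalars f N')"
      using restrict_iso[OF N(2)] I(1) by (simp add: restrict_sections_complex[OF m'] restrict_cohomology)
  qed
qed

lemma factor_value_retract:
  assumes KL: "mod_retract R K (restrict_scalars f L)" and F: "valid_factor R F"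
    and N: "is_factor_value R F K N" "is_factor_value S (map_lyubeznik_factor (extended_ideal S f) F) L N'"
  shows "mod_retract R N (restrict_scalars f N')"
proof (cases F)
  case (Local_Cohomology I i)
  \<comment> \<open>Local cohomology is the source of the inclusion map for the pair
    \<open>I\<close>, \<open>I\<close>.\<close>
  then show ?thesis
    using N F les_part_value_retract(2)[OF KL _ _ subset_refl, of I]
    by (auto simp: is_local_cohomology_def)
next
  case (LES_Part p m I1 I2 i)
  then show ?thesis
    using N F les_part_value_retract(1)[OF KL, of I1 I2] by auto
qed

text \<open>The intermediate values over \<open>R\<close> and over \<open>S\<close> are unrelated
  choices; being a retract is the only link between them, and it is strong enough to serve as the
  hypothesis for the next factor.\<close>

lemma lyubeznik_value_retract:
  fixes N :: "('a, 'u) module" and N' :: "('b, 'v) module"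
  assumes "mod_retract R K (restrict_scalars f L)" "\<forall>F\<in>set T. valid_factor R F"
    and "is_lyubeznik_value R T K N" "is_lyubeznik_value S (extended_functor S f T) L N'"
  shows "mod_retract R N (restrict_scalars f N')"
  using assms(2-4)
proof (induction T arbitrary: N N')
  case Nil
  then show ?case
    by (auto simp: extended_functor_def intro: mod_retract_iso[OF assms(1)] restrict_iso)
next
  case (Cons F T)
  then obtain K' :: "('a, 'u) module" and L' :: "('b, 'v) module"
    where "is_lyubeznik_value R T K K'" "is_factor_value R F K' N"
    "is_lyubeznik_value S (extended_functor S f T) L L'"
    "is_factor_value S (map_lyubeznik_factor (extended_ideal S f) F) L' N'"
    by (auto simp: extended_functor_def)
  then show ?case using Cons.IH[of K' L'] Cons.prems(1) by (auto intro: factor_value_retract)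
qed

section \<open>Associated primes\<close>

text \<open>Among the annihilators of elements of \<open>N\<close> that contract to \<open>P\<close>, a maximal one is prime.\<close>

lemma associated_prime_contraction:
  assumes "mod_retract R M (restrict_scalars f N)" and N: "module S N" and P: "P \<in> associated_primes R M"
  shows "\<exists>Q\<in>associated_primes S N. P = {a \<in> carrier R. f a \<in> Q}"
proof -
  obtain u v where u: "u \<in> module_hom R M (restrict_scalars f N)" "v \<in> module_hom R (restrict_scalars f N) M"
    "\<And>x. x \<in> carrier M \<Longrightarrow> v (u x) = x" and M: "module R M"
    using assms(1) by (auto simp: mod_retract_def)
  interpret M: module R M by (rule M)
  interpret N: module S N by (rule N)
  interpret NS: noetherian_ring S by (rule S(2))
  note RN = restrict_module[OF N]
  note fD = ring_hom_closed[OF f] ring_hom_mult[OF f]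
  obtain m where m: "m \<in> carrier M" "P = {a \<in> carrier R. a \<odot>\<^bsub>M\<^esub> m = \<zero>\<^bsub>M\<^esub>}" and Pp: "primeideal P R"
    using P by (auto simp: associated_primes_def)
  define n where "n = u m"
  have n: "n \<in> carrier N" using module_homD(1)[OF u(1) m(1)] by (simp add: n_def)
  \<comment> \<open>The splitting makes \<open>u\<close> injective, so \<open>m\<close> and its
    image have the same annihilator in \<open>R\<close>.\<close>
  have "a \<odot>\<^bsub>M\<^esub> m = \<zero>\<^bsub>M\<^esub> \<longleftrightarrow> f a \<odot>\<^bsub>N\<^esub> n = \<zero>\<^bsub>N\<^esub>" if a: "a \<in> carrier R" for a
  proof -
    have "u (a \<odot>\<^bsub>M\<^esub> m) = f a \<odot>\<^bsub>N\<^esub> n" using module_homD(3)[OF u(1) a m(1)] by (simp add: n_def)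
    moreover have "u \<zero>\<^bsub>M\<^esub> = \<zero>\<^bsub>N\<^esub>" "v \<zero>\<^bsub>N\<^esub> = \<zero>\<^bsub>M\<^esub>"
      using module_hom_zero[OF M RN u(1)] module_hom_zero[OF RN M u(2)] by auto
    ultimately show ?thesis using u(3)[of "a \<odot>\<^bsub>M\<^esub> m"] a m(1) by auto
  qed
  then have Pn: "P = {a \<in> carrier R. f a \<odot>\<^bsub>N\<^esub> n = \<zero>\<^bsub>N\<^esub>}" using m(2) by auto
  define ann where "ann y = {s \<in> carrier S. s \<odot>\<^bsub>N\<^esub> y = \<zero>\<^bsub>N\<^esub>}" for y
  have contr: "{a \<in> carrier R. f a \<in> ann y} = {a \<in> carrier R. f a \<odot>\<^bsub>N\<^esub> y = \<zero>\<^bsub>N\<^esub>}" for y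
    using fD by (auto simp: ann_def)
  \<comment> \<open>The contraction is fixed in advance, since a maximal element among all
    annihilators could contract to a prime other than \<open>P\<close>.\<close>
  define C where "C = {ann y | y. y \<in> carrier N \<and> {a \<in> carrier R. f a \<in> ann y} = P}"
  have ai: "ideal (ann y) S" if "y \<in> carrier N" for y
    unfolding ann_def by (rule N.ideal_annihilator[OF that])
  have "ann n \<in> C" using n Pn contr by (auto simp: C_def)
  then obtain Q where Q: "Q \<in> C" and max: "\<And>J. J \<in> C \<Longrightarrow> Q \<subseteq> J \<Longrightarrow> J = Q"
    using NS.exists_maximal_ideal_in[of C] ai unfolding C_def by blast
  then obtain y where y: "y \<in> carrier N" "Q = ann y" "{a \<in> carrier R. f a \<in> Q} = P" by (auto simp: C_def)
  have sub: "ann y \<subseteq> ann (s \<odot>\<^bsub>N\<^esub> y)" if "s \<in> carrier S" for s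
  proof
    fix t assume t: "t \<in> ann y"
    then have tS: "t \<in> carrier S" by (simp add: ann_def)
    have "t \<odot>\<^bsub>N\<^esub> (s \<odot>\<^bsub>N\<^esub> y) = s \<odot>\<^bsub>N\<^esub> (t \<odot>\<^bsub>N\<^esub> y)"
      using that y(1) tS by (simp add: N.smult_assoc1[symmetric] N.R.m_comm)
    then show "t \<in> ann (s \<odot>\<^bsub>N\<^esub> y)" using t that by (simp add: ann_def)
  qed
  have "primeideal Q S"
  proof (rule primeidealI)
    show "ideal Q S" "cring S" using y ai S by auto
    have "\<one>\<^bsub>R\<^esub> \<notin> P"
      using Pp by (metis ideal.one_imp_carrier primeideal.I_notcarr primeideal.axioms(1))
    then show "carrier S \<noteq> Q" using y(3) fD(1) by (metis (mono_tags, lifting) M.R.one_closed mem_Collect_eq)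
    fix a b assume ab: "a \<in> carrier S" "b \<in> carrier S" "a \<otimes>\<^bsub>S\<^esub> b \<in> Q"
    show "a \<in> Q \<or> b \<in> Q"
    proof (rule ccontr)
      assume neg: "\<not> ?thesis"
      let ?y = "a \<odot>\<^bsub>N\<^esub> y"
      have "b \<in> ann ?y"
        using ab y by (simp add: ann_def N.smult_assoc1[symmetric] N.R.m_comm)
      then have "ann ?y \<notin> C" using max[of "ann ?y"] sub[OF ab(1)] y(2) neg by blast
      then have "{r \<in> carrier R. f r \<in> ann ?y} \<noteq> P" using ab y(1) by (auto simp: C_def)
      moreover have "P \<subseteq> {r \<in> carrier R. f r \<in> ann ?y}" using y sub[OF ab(1)] by blast
      ultimately obtain r where r: "r \<in> carrier R" "f r \<in> ann ?y" "r \<notin> P" by blast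
      \<comment> \<open>Here \<open>r\<close> is outside \<open>P\<close> and \<open>f r\<close>
        kills \<open>a y\<close>. Passing from \<open>y\<close> to its multiple by
        \<open>f r\<close> keeps the contraction, since \<open>t r\<close> lies in the prime
        \<open>P\<close> only if \<open>t\<close> does. By maximality the annihilator is still
        \<open>Q\<close>, and it contains \<open>a\<close>.\<close>
      let ?z = "f r \<odot>\<^bsub>N\<^esub> y"
      have "a \<odot>\<^bsub>N\<^esub> ?z = f r \<odot>\<^bsub>N\<^esub> ?y"
        using ab(1) fD(1)[OF r(1)] y(1) by (simp add: N.smult_assoc1[symmetric] N.R.m_comm)
      then have az: "a \<in> ann ?z" using r(2) ab(1) by (simp add: ann_def)
      have "{t \<in> carrier R. f t \<in> ann ?z} = P"
      proof -
        have "f t \<in> ann ?z \<longleftrightarrow> t \<in> P" if t: "t \<in> carrier R" for t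
        proof -
          have "f t \<in> ann ?z \<longleftrightarrow> f (t \<otimes>\<^bsub>R\<^esub> r) \<in> ann y"
            using t r(1) y(1) fD by (simp add: ann_def N.smult_assoc1)
          also have "\<dots> \<longleftrightarrow> t \<otimes>\<^bsub>R\<^esub> r \<in> P" using y(2,3) t r(1) by auto
          also have "\<dots> \<longleftrightarrow> t \<in> P"
            using primeideal.I_prime[OF Pp t r(1)] r(3) idealD(5)[OF primeideal.axioms(1)[OF Pp], of t r] r(1) by blast
          finally show ?thesis .
        qed
        moreover have "P \<subseteq> carrier R" using Pn by auto
        ultimately show ?thesis by blast
      qed
      then have "ann ?z \<in> C" using fD(1)[OF r(1)] y(1) by (auto simp: C_def)
      then have "ann ?z = Q" using max[of "ann ?z"] sub[OF fD(1)[OF r(1)]] y(2) by blast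
      then show False using az neg by blast
    qed
  qed
  then have "Q \<in> associated_primes S N" using y(1,2) by (auto simp: associated_primes_def ann_def)
  then show ?thesis using y(3) by blast
qed

lemma finite_associated_primes:
  assumes "mod_retract R M (restrict_scalars f N)" "module S N" "finite (associated_primes S N)"
  shows "finite (associated_primes R M)"
proof (rule finite_surj[OF assms(3)])
  show "associated_primes R M \<subseteq> (\<lambda>Q. {a \<in> carrier R. f a \<in> Q}) ` associated_primes S N"
    using associated_prime_contraction[OF assms(1,2)] by blast
qed

lemma split_retract:
  assumes "splits R S f"
  shows "mod_retract R (ring_module R) (restrict_scalars f (ring_module S))"
proof -
  obtain p where p: "p \<in> module_hom R (restrict_scalars f (ring_module S)) (ring_module R)"
    "\<And>r. r \<in> carrier R \<Longrightarrow> p (f r) = r" using assms by (auto simp: splits_def)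
  have "f \<in> module_hom R (ring_module R) (restrict_scalars f (ring_module S))"
    by (rule module_homI) (auto simp: ring_hom_closed[OF f] ring_hom_add[OF f] ring_hom_mult[OF f])
  then show ?thesis
    unfolding mod_retract_def
    using cring.ring_module_is_module[OF R(1)] restrict_module[OF cring.ring_module_is_module[OF S(1)]] p by auto
qed

end

lemma factor_value_module: "is_factor_value R F M N \<Longrightarrow> module R N"
proof (cases F)
  case (LES_Part p m I1 I2 i)
  then show "is_factor_value R F M N \<Longrightarrow> module R N"
    by (cases p; cases m) (auto simp: is_les_part_def is_hom_part_def module_iso_def)
qed (auto simp: is_local_cohomology_def module_iso_def)

lemma lyubeznik_value_module: "is_lyubeznik_value R T M N \<Longrightarrow> module R N"
  by (cases T) (auto simp: module_iso_def intro: factor_value_module)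

theorem theorem1p1:
  fixes R :: "('a, 'x) ring_scheme" and S :: "('b, 'y) ring_scheme" and f :: "'a \<Rightarrow> 'b"
  assumes "cring R" and "noetherian_ring R"
    and "cring S" and "noetherian_ring S"
    and "f \<in> ring_hom R S" and "splits R S f"
  shows
    "(\<forall>T (TR :: ('a, 'u) module) (TS :: ('b, 'v) module).
        lyubeznik_functor R T \<longrightarrow>
        is_lyubeznik_value R T (ring_module R) TR \<longrightarrow>
        is_lyubeznik_value S (extended_functor S f T) (ring_module S) TS \<longrightarrow>
        finite (associated_primes S TS) \<longrightarrow>
        finite (associated_primes R TR)) \<and>
     (\<forall>I i (HR :: ('a, 'u) module) (HS :: ('b, 'v) module).
        ideal I R \<longrightarrow>
        is_local_cohomology R I i (ring_module R) HR \<longrightarrow>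
        is_local_cohomology S (extended_ideal S f I) i (ring_module S) HS \<longrightarrow>
        finite (associated_primes S HS) \<longrightarrow>
        finite (associated_primes R HR))"
proof -
  interpret ring_change R S f using assms(1-5) by (rule ring_change.intro)
  note split = split_retract[OF assms(6)]
  show ?thesis
  proof (intro conjI allI impI)
    fix T and TR :: "('a, 'u) module" and TS :: "('b, 'v) module"
    assume "lyubeznik_functor R T" and TR: "is_lyubeznik_value R T (ring_module R) TR"
      and TS: "is_lyubeznik_value S (extended_functor S f T) (ring_module S) TS"
      and fin: "finite (associated_primes S TS)"
    then have "mod_retract R TR (restrict_scalars f TS)"
      by (intro lyubeznik_value_retract[OF split]) (auto simp: lyubeznik_functor_def)
    then show "finite (associated_primes R TR)"
      using finite_associated_primes lyubeznik_value_module[OF TS] fin by blast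
  next
    fix I i and HR :: "('a, 'u) module" and HS :: "('b, 'v) module"
    assume "ideal I R" and HR: "is_local_cohomology R I i (ring_module R) HR"
      and HS: "is_local_cohomology S (extended_ideal S f I) i (ring_module S) HS"
      and fin: "finite (associated_primes S HS)"
    \<comment> \<open>A one-element list would first replace the ring by an isomorphic copy in the
      type \<open>'u\<close>, so the result on a single factor is applied to the ring
      itself.\<close>
    then have "mod_retract R HR (restrict_scalars f HS)"
      by (intro factor_value_retract[OF split, of "Local_Cohomology I i"]) auto
    moreover have "module S HS" using HS by (auto simp: is_local_cohomology_def module_iso_def)
    ultimately show "finite (associated_primes R HR)" using finite_associated_primes fin by blast
  qed
qed

end
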